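(* Let $X$ be a closed subscheme of $\mathbb{P}^n$ such that $\dim(X)=r$ and $\deg(X)=d$. Then the following are equivalent: (a) $G(X)=\deg(X)=d$; (b) $X$ is a hypersurface $F_\Lambda$ of degree $d$ in some $(r+1)$-dimensional linear subspace $\Lambda$ of $\mathbb{P}^n$; (c) for a general linear space $\Lambda_i$ of dimension $n-i$ in $\mathbb{P}^n$ and for $0\leq i\leq r-1$, $$p_a(X\cap\Lambda_i)=\binom{d-1}{r-i+1}.$$
   Context: $k$ is an algebraically closed field of characteristic $0$, $R=k[x_0,\dots,x_n]$, $\mathbb{P}^n=\operatorname{Proj}R$. For a closed subscheme $X\subset\mathbb{P}^n$, $I_X\subset R$ is its saturated homogeneous ideal, $H_X(d)=\dim_k(R/I_X)_d$ its Hilbert function, and $P_X$ its Hilbert polynomial. The arithmetic genus of an $r$-dimensional $X$ is $p_a(X)=(-1)^r(P_X(0)-1)$. For integers $c,d>0$ the $d$-binomial expansion of $c$ is the unique expression $c=\binom{k_d}{d}+\binom{k_{d-1}}{d-1}+\cdots+\binom{k_\delta}{\delta}$ with $k_d>k_{d-1}>\cdots>k_\delta\geq\delta>0$. The $d$-th Macaulay difference set of $c$ is the tuple $M_d(c)=(k_d-d,\,k_{d-1}-(d-1),\dots,k_\delta-\delta)$. For $d\gg0$ the tuples $M_d(H_X(d))$ do not depend on $d$; this eventually constant tuple is the Gotzmann difference set of $X$, and its number of entries is the Gotzmann number $G(X)$. A hypersurface of degree $d$ in a linear subspace $\Lambda$ is the closed subscheme with ideal $I_\Lambda+(F)$, where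 $F$ is a form of degree $d$ not in $I_\Lambda$.
   Formalization: Proved for 1 ≤ r < n: for r = 0, three non-collinear points in P^2 satisfy (a) and (c) but not (b); for r = n, X = P^n satisfies (a) and (c) while no (r+1)-dimensional linear subspace of P^n exists. *)

theory Defs
  imports
    "HOL-Library.Poly_Mapping"
    "HOL-Computational_Algebra.Polynomial"
    "HOL-Algebra.QuotRing"
    "HOL-Algebra.Embedded_Algebras"
begin

section \<open>The graded polynomial ring\<close>

text \<open>Variables are indexed by an arbitrary type; the homogeneous coordinate ring
  \<open>R = k[x\<^sub>0, \<dots>, x\<^sub>n]\<close> uses the indices \<open>0, \<dots>, n\<close> of type \<^typ>\<open>nat\<close>.\<close>

type_synonym ('v, 'k) mpoly = "('v \<Rightarrow>\<^sub>0 nat) \<Rightarrow>\<^sub>0 'k"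

definition polys_in :: "'v set \<Rightarrow> ('v, 'k::zero) mpoly set" where
  "polys_in V = {p. \<forall>m \<in> Poly_Mapping.keys p. Poly_Mapping.keys m \<subseteq> V}"

definition poly_ring :: "nat \<Rightarrow> (nat, 'k::field) mpoly ring" where
  "poly_ring n = \<lparr>carrier = polys_in {..n}, mult = (*), one = 1, zero = 0, add = (+)\<rparr>"

definition const :: "'k::zero \<Rightarrow> ('v, 'k) mpoly" where
  "const c = Poly_Mapping.single 0 c"

definition monom_degree :: "('v \<Rightarrow>\<^sub>0 nat) \<Rightarrow> nat" where
  "monom_degree m = (\<Sum>v \<in> Poly_Mapping.keys m. Poly_Mapping.lookup m v)"

definition eval_mpoly :: "('v \<Rightarrow> 'k) \<Rightarrow> ('v, 'k::field) mpoly \<Rightarrow> 'k" where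
  "eval_mpoly a p =
     (\<Sum>m \<in> Poly_Mapping.keys p.
        Poly_Mapping.lookup p m * (\<Prod>v \<in> Poly_Mapping.keys m. a v ^ Poly_Mapping.lookup m v))"

text \<open>The graded piece \<open>R\<^sub>d\<close>, including \<open>0\<close>.\<close>

definition forms :: "nat \<Rightarrow> nat \<Rightarrow> (nat, 'k::field) mpoly set" where
  "forms n d = {p \<in> carrier (poly_ring n). \<forall>m \<in> Poly_Mapping.keys p. monom_degree m = d}"

lemma poly_ring_cring: "cring (poly_ring n :: (nat, 'k::field) mpoly ring)"
proof -
  have mult: "p * q \<in> polys_in {..n}"
    if p: "p \<in> polys_in {..n}" and q: "q \<in> polys_in {..n}" for p q :: "(nat, 'k) mpoly"
    unfolding polys_in_def
  proof (intro CollectI ballI)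
    fix m assume "m \<in> Poly_Mapping.keys (p * q)"
    then obtain a b where "m = a + b" "a \<in> Poly_Mapping.keys p" "b \<in> Poly_Mapping.keys q"
      using keys_mult[of p q] by blast
    then show "Poly_Mapping.keys m \<subseteq> {..n}"
      using p q Poly_Mapping.keys_add[of a b] unfolding polys_in_def by blast
  qed
  have add: "p + q \<in> polys_in {..n}"
    if "p \<in> polys_in {..n}" "q \<in> polys_in {..n}" for p q :: "(nat, 'k) mpoly"
    using that Poly_Mapping.keys_add[of p q] unfolding polys_in_def by blast
  have neg: "- p \<in> polys_in {..n}" if "p \<in> polys_in {..n}" for p :: "(nat, 'k) mpoly"
    using that unfolding polys_in_def by (simp add: in_keys_iff)
  have zero: "(0 :: (nat, 'k) mpoly) \<in> polys_in {..n}" and one: "(1 :: (nat, 'k) mpoly) \<in> polys_in {..n}"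
    by (simp_all add: polys_in_def)
  show ?thesis
  proof (rule cringI)
    show "abelian_group (poly_ring n :: (nat, 'k) mpoly ring)"
    proof (rule abelian_groupI)
      fix p :: "(nat, 'k) mpoly" assume "p \<in> carrier (poly_ring n)"
      then show "\<exists>q \<in> carrier (poly_ring n). q \<oplus>\<^bsub>poly_ring n\<^esub> p = \<zero>\<^bsub>poly_ring n\<^esub>"
        using neg by (intro bexI[of _ "- p"]) (simp_all add: poly_ring_def)
    qed (simp_all add: poly_ring_def add zero add.commute add.left_commute)
    show "Group.comm_monoid (poly_ring n :: (nat, 'k) mpoly ring)"
      by (rule comm_monoidI) (simp_all add: poly_ring_def mult one mult.commute mult.left_commute)
  qed (simp add: poly_ring_def distrib_right)
qed


section \<open>Closed subschemes of projective space\<close>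

definition homogeneous_ideal :: "nat \<Rightarrow> (nat, 'k::field) mpoly set \<Rightarrow> bool" where
  "homogeneous_ideal n I \<longleftrightarrow>
     ideal I (poly_ring n) \<and> I = Idl\<^bsub>poly_ring n\<^esub> (I \<inter> (\<Union>d. forms n d))"

text \<open>\<open>\<Union>\<^sub>N (I : \<mm>\<^sup>N)\<close>; the ideal \<open>\<mm>\<^sup>N\<close> is generated by \<open>R\<^sub>N\<close>.\<close>

definition saturation :: "nat \<Rightarrow> (nat, 'k::field) mpoly set \<Rightarrow> (nat, 'k) mpoly set" where
  "saturation n I =
     {f \<in> carrier (poly_ring n). \<exists>N. \<forall>g \<in> forms n N. g \<otimes>\<^bsub>poly_ring n\<^esub> f \<in> I}"

text \<open>A closed subscheme \<open>X\<close> of projective \<open>n\<close>-space is represented by its saturated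
  homogeneous ideal \<open>I\<^sub>X\<close>; the unit ideal represents the empty scheme.\<close>

definition closed_subscheme :: "nat \<Rightarrow> (nat, 'k::field) mpoly set \<Rightarrow> bool" where
  "closed_subscheme n X \<longleftrightarrow> homogeneous_ideal n X \<and> saturation n X = X"

definition scheme_inter ::
    "nat \<Rightarrow> (nat, 'k::field) mpoly set \<Rightarrow> (nat, 'k) mpoly set \<Rightarrow> (nat, 'k) mpoly set" where
  "scheme_inter n X Y = saturation n (X <+>\<^bsub>poly_ring n\<^esub> Y)"

text \<open>The points of \<open>X = Proj (R / I\<^sub>X)\<close>: homogeneous primes containing \<open>I\<^sub>X\<close>
  but not the irrelevant ideal.\<close>

definition scheme_points :: "nat \<Rightarrow> (nat, 'k::field) mpoly set \<Rightarrow> (nat, 'k) mpoly set set" where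
  "scheme_points n X =
     {P. primeideal P (poly_ring n) \<and> homogeneous_ideal n P \<and> X \<subseteq> P \<and> \<not> forms n 1 \<subseteq> P}"

text \<open>Krull dimension: the largest number of points in a chain of specialisations, minus one.
  The empty scheme has dimension \<open>-1\<close>.\<close>

definition scheme_dim :: "nat \<Rightarrow> (nat, 'k::field) mpoly set \<Rightarrow> int" where
  "scheme_dim n X =
     int (GREATEST l. \<exists>ps. length ps = l \<and> set ps \<subseteq> scheme_points n X \<and> sorted_wrt (\<subset>) ps) - 1"


section \<open>Hilbert function, Hilbert polynomial, degree and arithmetic genus\<close>

text \<open>\<open>dim\<^sub>k (R / I\<^sub>X)\<^sub>d\<close>, with \<open>k\<close> embedded in \<open>R / I\<^sub>X\<close> as the classes of constants.\<close>

definition hilbert_function :: "nat \<Rightarrow> (nat, 'k::field) mpoly set \<Rightarrow> nat \<Rightarrow> nat" where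
  "hilbert_function n X d =
     ring.dim (poly_ring n Quot X)
       ((\<lambda>c. X +>\<^bsub>poly_ring n\<^esub> const c) ` UNIV)
       ((\<lambda>f. X +>\<^bsub>poly_ring n\<^esub> f) ` forms n d)"

definition hilbert_polynomial :: "nat \<Rightarrow> (nat, 'k::field) mpoly set \<Rightarrow> rat poly" where
  "hilbert_polynomial n X =
     (THE P. eventually (\<lambda>d. poly P (of_nat d) = of_nat (hilbert_function n X d)) sequentially)"

definition scheme_degree :: "nat \<Rightarrow> (nat, 'k::field) mpoly set \<Rightarrow> rat" where
  "scheme_degree n X =
     fact (nat (scheme_dim n X)) * Polynomial.coeff (hilbert_polynomial n X) (nat (scheme_dim n X))"

definition arithmetic_genus :: "nat \<Rightarrow> (nat, 'k::field) mpoly set \<Rightarrow> rat" where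
  "arithmetic_genus n X = (-1) powi scheme_dim n X * (poly (hilbert_polynomial n X) 0 - 1)"


section \<open>Macaulay and Gotzmann difference sets\<close>

text \<open>The list is \<open>[k\<^sub>d, k\<^sub>d\<^sub>-\<^sub>1, \<dots>, k\<^sub>\<delta>]\<close>, so its \<open>j\<close>-th entry is \<open>k\<^bsub>d - j\<^esub>\<close> and
  \<open>\<delta> = d + 1 - length ks\<close>, which is positive because \<open>length ks \<le> d\<close>.\<close>

definition binomial_expansion :: "nat \<Rightarrow> nat \<Rightarrow> nat list \<Rightarrow> bool" where
  "binomial_expansion d c ks \<longleftrightarrow>
     ks \<noteq> [] \<and> length ks \<le> d \<and> sorted_wrt (>) ks \<and> last ks \<ge> d + 1 - length ks \<and>
     c = (\<Sum>j < length ks. (ks ! j) choose (d - j))"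

definition macaulay_differences :: "nat \<Rightarrow> nat \<Rightarrow> nat list" where
  "macaulay_differences d c =
     (let ks = (THE ks. binomial_expansion d c ks)
      in map (\<lambda>j. ks ! j - (d - j)) [0..<length ks])"

definition gotzmann_differences :: "nat \<Rightarrow> (nat, 'k::field) mpoly set \<Rightarrow> nat list" where
  "gotzmann_differences n X =
     (THE M. eventually (\<lambda>d. macaulay_differences d (hilbert_function n X d) = M) sequentially)"

definition gotzmann_number :: "nat \<Rightarrow> (nat, 'k::field) mpoly set \<Rightarrow> nat" where
  "gotzmann_number n X = length (gotzmann_differences n X)"


section \<open>Linear subspaces and hypersurfaces in them\<close>

text \<open>Lists of \<open>n - m\<close> linearly independent linear forms, i.e. the frames defining
  \<open>m\<close>-dimensional linear subspaces.\<close>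

definition linear_frames :: "nat \<Rightarrow> nat \<Rightarrow> (nat, 'k::field) mpoly list set" where
  "linear_frames n m =
     {Ls. set Ls \<subseteq> forms n 1 \<and> length Ls = n - m \<and>
          ring.independent (poly_ring n) (range const) Ls}"

definition linear_subspace :: "nat \<Rightarrow> nat \<Rightarrow> (nat, 'k::field) mpoly set \<Rightarrow> bool" where
  "linear_subspace n m \<Lambda> \<longleftrightarrow>
     m \<le> n \<and> (\<exists>Ls \<in> linear_frames n m. \<Lambda> = Idl\<^bsub>poly_ring n\<^esub> (set Ls))"

definition is_hypersurface_in ::
    "nat \<Rightarrow> nat \<Rightarrow> (nat, 'k::field) mpoly set \<Rightarrow> (nat, 'k) mpoly set \<Rightarrow> bool" where
  "is_hypersurface_in n d \<Lambda> X \<longleftrightarrow>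
     (\<exists>F \<in> forms n d. F \<notin> \<Lambda> \<and> X = \<Lambda> <+>\<^bsub>poly_ring n\<^esub> (PIdl\<^bsub>poly_ring n\<^esub> F))"

text \<open>The Zariski topology on the Grassmannian of \<open>m\<close>-dimensional linear subspaces, as the quotient
  of the space of frames: \<open>U\<close> is open iff the frames defining members of \<open>U\<close> form a Zariski open
  set in the affine space of all \<open>(n - m)\<close>-tuples of linear forms (open meaning: complement of the
  common zeros of a set \<open>S\<close> of polynomials in the coefficients). The variable \<open>(l, j)\<close> of
  these polynomials stands for the coefficient of \<open>x\<^sub>j\<close> in the \<open>l\<close>-th form.\<close>

definition frame_coeff :: "(nat, 'k::field) mpoly list \<Rightarrow> nat \<times> nat \<Rightarrow> 'k" where
  "frame_coeff Ls = (\<lambda>(l, j). Poly_Mapping.lookup (Ls ! l) (Poly_Mapping.single j 1))"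

definition grassmannian_open :: "nat \<Rightarrow> nat \<Rightarrow> (nat, 'k::field) mpoly set set \<Rightarrow> bool" where
  "grassmannian_open n m U \<longleftrightarrow>
     U \<subseteq> Collect (linear_subspace n m) \<and>
     (\<exists>S \<subseteq> polys_in ({..<n - m} \<times> {..n}).
        \<forall>Ls. set Ls \<subseteq> forms n 1 \<longrightarrow> length Ls = n - m \<longrightarrow>
          (Ls \<in> linear_frames n m \<and> Idl\<^bsub>poly_ring n\<^esub> (set Ls) \<in> U
             \<longleftrightarrow> (\<exists>f \<in> S. eval_mpoly (frame_coeff Ls) f \<noteq> 0)))"

text \<open>Grassmannians are irreducible, so \<open>general\<close> means: on some nonempty open subset.\<close>

definition for_general_linear_subspace ::
    "nat \<Rightarrow> nat \<Rightarrow> ((nat, 'k::field) mpoly set \<Rightarrow> bool) \<Rightarrow> bool" where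
  "for_general_linear_subspace n m Q \<longleftrightarrow>
     (\<exists>U. grassmannian_open n m U \<and> U \<noteq> {} \<and> (\<forall>\<Lambda> \<in> U. Q \<Lambda>))"

end

(*
  Write the Hilbert polynomial of X in Gotzmann form, P(t) = sum_{j<G} binom(t - j + a_j, a_j) with
  a_0 >= a_1 >= ... >= 0. Then G = G(X), the dimension is r = a_0, and the degree is the number of j
  with a_j = r, so (a) says that all a_j equal r. The form exists because the Hilbert function of
  R/I counts the monomials outside the initial ideal, and these are partitioned into cones which
  can be split until there is one cone in each degree (an argument of Dube).

  (a) => (b): cutting with general linear forms gives, by induction on r, a lower bound for the
  Hilbert function of a saturated ideal with all a_j = r, namely that of a hypersurface of degree d
  in P^{r+1}; for r > 0 equality for large t forces equality everywhere. Hence I_X contains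
  n - r - 1 independent linear forms and one further form of degree d, and these generate it.

  (b) => (c): one value of the Hilbert function of X cut by l_1, ..., l_i decides whether the section is
  again a hypersurface of degree d, and fraction-free elimination writes this condition as the
  non-vanishing of polynomials in the coefficients of the l_j.

  (c) => (a): every non-empty open set of frames contains one that is a filter-regular sequence, since
  the bad forms can be avoided on lines. Cutting with it lowers every a_j by one and drops the
  negative ones, so the genus of the section by i forms, i being the largest a_j < r, differs
  from the prescribed value by the number of such a_j.

  The chain definition of dimension agrees with a_0: along a chain of homogeneous primes the
  degree of the Hilbert polynomial drops strictly, and chains of full length are found by Noetherian
  induction, which passes from I to I + (f) and I : f, or to I + (x) if I is prime.
*)

theory Submission
  imports Defs
begin

text \<open>Two devices stand in for structure theory. Induction along I + (f) and I : f stands in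
  for primary decomposition: a property that holds for homogeneous primes and passes through the
  exact sequence of the two ideals holds for all homogeneous ideals. Sets of linear forms that every
  line through one of their points leaves only finitely often stand in for open sets: over an
  infinite field two such sets meet, so filter-regularity can be combined with any satisfiable
  polynomial condition on the coefficients. Lists and dimensions depend on large degrees only, but
  (b) concerns all degrees, and this is where saturation enters: modulo a saturated ideal a
  filter-regular form is a nonzerodivisor, so the first difference of the Hilbert function is that
  of the section in every degree. The section itself need not be saturated, and only a lower bound
  passes through it. That suffices, since the excess over the bound cannot decrease and vanishes in
  the end. The genus binom(d - 1, r + 1) is, up to sign and the constant 1, the telescoped value at
  0 of the Gotzmann polynomial of \<open>d\<close> entries \<open>r\<close>.\<close>

abbreviation lookup where "lookup \<equiv> Poly_Mapping.lookup"
abbreviation keys where "keys \<equiv> Poly_Mapping.keys"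
abbreviation single where "single \<equiv> Poly_Mapping.single"

section \<open>Hilbert functions in Gotzmann form\<close>

text \<open>The number of monomials of degree \<open>s\<close> in \<open>u\<close> variables.\<close>

definition mono_count :: "nat \<Rightarrow> nat \<Rightarrow> nat" where
  "mono_count u s = (case u of 0 \<Rightarrow> if s = 0 then 1 else 0 | Suc a \<Rightarrow> (s + a) choose a)"

lemma mono_count_0_right [simp]: "mono_count u 0 = 1"
  by (simp add: mono_count_def split: nat.splits)

lemma mono_count_Suc_left: "mono_count (Suc a) s = (s + a) choose a"
  by (simp add: mono_count_def)

text \<open>Sort the monomials by whether the last variable divides them; numerically this is
  Pascal's rule.\<close>

lemma mono_count_Suc_Suc: "mono_count (Suc u) (Suc s) = mono_count u (Suc s) + mono_count (Suc u) s"
proof (cases u)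
  case (Suc a)
  have "Suc s + Suc a choose Suc a = (s + Suc a choose a) + (s + Suc a choose Suc a)"
    by simp
  then show ?thesis by (simp add: Suc mono_count_def)
qed (simp add: mono_count_def)

lemma mono_count_degree_one: "mono_count u 1 = u"
  by (cases u) (simp_all add: mono_count_def)

lemma mono_count_pos: "u > 0 \<Longrightarrow> mono_count u s > 0"
  by (cases u) (simp_all add: mono_count_def)

lemma mono_count_Suc_mono: "mono_count u s \<le> mono_count (Suc u) s"
  by (cases s) (simp_all add: mono_count_Suc_Suc)

lemma mono_count_mono: "u \<le> v \<Longrightarrow> mono_count u s \<le> mono_count v s"
  by (induction rule: dec_induct) (auto intro: le_trans mono_count_Suc_mono)

lemma mono_count_sum: "(\<Sum>s\<le>t. mono_count u s) = mono_count (Suc u) t"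
  by (induction t) (simp_all add: mono_count_Suc_Suc)

lemma mono_count_degree_mono: "s \<le> t \<Longrightarrow> u > 0 \<Longrightarrow> mono_count u s \<le> mono_count u t"
proof (induction rule: dec_induct)
  case (step t)
  then show ?case by (cases u) (simp_all add: mono_count_Suc_Suc)
qed simp

text \<open>The number of elements of degree \<open>t\<close> in a cone
  \<open>x^m k[u variables]\<close> whose generator has degree \<open>e\<close>. The case
  distinction keeps the count 0 below the generator, where truncated subtraction would give
  1.\<close>

definition cone_count :: "nat \<Rightarrow> nat \<Rightarrow> nat \<Rightarrow> nat" where
  "cone_count u e t = (if e \<le> t then mono_count u (t - e) else 0)"

lemma cone_count_0 [simp]: "cone_count u 0 t = mono_count u t"
  by (simp add: cone_count_def)

lemma cone_count_at_0: "cone_count u e 0 = (if e = 0 then 1 else 0)"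
  by (simp add: cone_count_def)

text \<open>The counting form of a hyperplane section: a first difference in \<open>t\<close> costs
  one free variable.\<close>

lemma cone_count_Suc:
  "cone_count (Suc u) e (Suc t) = cone_count u e (Suc t) + cone_count (Suc u) e t"
  by (auto simp: cone_count_def Suc_diff_le mono_count_Suc_Suc not_less_eq_eq le_Suc_eq)

text \<open>A monomial of the cone either avoids one chosen free variable or is a multiple of it;
  the multiples form a cone generated one degree higher.\<close>

lemma cone_count_split: "cone_count (Suc u) e t = cone_count u e t + cone_count (Suc u) (Suc e) t"
proof (cases "e < t")
  case True
  then obtain s where "t = e + Suc s" by (metis less_iff_Suc_add add_Suc_right)
  then show ?thesis by (simp add: cone_count_def mono_count_Suc_Suc)
qed (auto simp: cone_count_def)

lemma cone_count_degree_mono: "u > 0 \<Longrightarrow> t \<le> t' \<Longrightarrow> cone_count u e t \<le> cone_count u e t'"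
  by (auto simp: cone_count_def intro!: mono_count_degree_mono)

text \<open>For \<open>s = 0\<close> and large \<open>t\<close> this is the sum of the binom(t - j +
  a_j, a_j); the offset \<open>s\<close> lets induction pass to the tail. A cone that has not
  started counts 0, so small degrees can deviate from the polynomial; this makes the sum the exact
  Hilbert function of a hypersurface.\<close>

primrec gotz :: "nat \<Rightarrow> nat list \<Rightarrow> nat \<Rightarrow> nat" where
  "gotz s [] t = 0"
| "gotz s (a # as) t = cone_count (Suc a) s t + gotz (Suc s) as t"

lemma gotz_nth: "gotz s as t = (\<Sum>j<length as. cone_count (Suc (as ! j)) (s + j) t)"
proof (induction as arbitrary: s)
  case (Cons a as)
  show ?case
    unfolding gotz.simps Cons.IH list.size(4) add_Suc_right add_0_right sum.lessThan_Suc_shift by (simp del: sum.lessThan_Suc)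
qed simp

lemma gotz_degree_mono: "t \<le> t' \<Longrightarrow> gotz s as t \<le> gotz s as t'"
  unfolding gotz_nth by (intro sum_mono cone_count_degree_mono) auto

text \<open>The list of a general hyperplane section. Stopping at the first 0 discards only zeros,
  since the lists in use are weakly decreasing.\<close>

fun cut_dims :: "nat list \<Rightarrow> nat list" where
  "cut_dims [] = []"
| "cut_dims (0 # as) = []"
| "cut_dims (Suc a # as) = a # cut_dims as"

lemma cut_dims_set: "a \<in> set (cut_dims as) \<Longrightarrow> Suc a \<in> set as"
  by (induction as rule: cut_dims.induct) auto

lemma sorted_cut_dims: "sorted_wrt (\<ge>) as \<Longrightarrow> sorted_wrt (\<ge>) (cut_dims as)"
  by (induction as rule: cut_dims.induct) (auto dest!: cut_dims_set)

lemma cut_dims_replicate: "cut_dims (replicate d (Suc r)) = replicate d r"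
  by (induction d) auto

lemma gotz_replicate_0: "s + d \<le> Suc t \<Longrightarrow> gotz s (replicate d 0) t = d"
  by (induction d arbitrary: s) (auto simp: cone_count_def mono_count_def)

text \<open>Termwise \<open>cone_count_Suc\<close>. The bound on \<open>t\<close> ensures that all
  cones have started by degree \<open>t\<close>: a cone with \<open>a = 0\<close> jumps from 0 to 1
  where it starts and is constant only afterwards.\<close>

lemma gotz_cut_dims:
  assumes "sorted_wrt (\<ge>) as" "s + length as \<le> Suc t"
  shows "gotz s as (Suc t) = gotz s as t + gotz s (cut_dims as) (Suc t)"
  using assms
proof (induction as arbitrary: s rule: cut_dims.induct)
  case (2 as)
  then have "as = replicate (length as) 0"
    by (intro replicate_eqI) auto
  then obtain k where k: "as = replicate k 0" ..
  show ?case using gotz_replicate_0[of s "Suc k" t] gotz_replicate_0[of s "Suc k" "Suc t"] "2.prems"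
    by (simp add: k)
next
  case (3 a as)
  then show ?case by (simp add: cone_count_Suc)
qed simp

text \<open>\<open>cone_count_split\<close> telescopes. For \<open>s = 0\<close> the
  \<open>d\<close> cones in consecutive degrees count what a form of degree \<open>d\<close> leaves
  of the polynomial ring in \<open>r + 2\<close> variables. The additive form avoids truncated
  subtraction.\<close>

lemma gotz_replicate:
  "gotz s (replicate d r) t + cone_count (r + 2) (s + d) t = cone_count (r + 2) s t"
proof (induction d arbitrary: s)
  case (Suc d)
  show ?case using Suc.IH[of "Suc s"] cone_count_split[of "Suc r" s t] by simp
qed simp

text \<open>Unlike \<open>gotz_cut_dims\<close> this holds in every degree, because no entry is 0.
  The comparison of Hilbert functions in all degrees rests on it.\<close>

lemma gotz_replicate_Suc:
  "gotz s (replicate d (Suc r)) (Suc t) = gotz s (replicate d (Suc r)) t + gotz s (replicate d r) (Suc t)"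
  by (induction d arbitrary: s) (simp_all add: cone_count_Suc)

lemma gotz_at_0: "gotz s (replicate d r) 0 = (if s = 0 \<and> d > 0 then 1 else 0)"
  by (induction d arbitrary: s) (simp_all add: cone_count_at_0)

lemma gotz_replicate_le: "gotz s (replicate d 0) t \<le> Suc t - s"
proof (induction d arbitrary: s)
  case (Suc d)
  from Suc[of "Suc s"] show ?case by (auto simp: cone_count_def mono_count_def)
qed simp

lemma gotz_replicate_0_le: "gotz s (replicate d 0) t \<le> d"
proof (induction d arbitrary: s)
  case (Suc d)
  from Suc[of "Suc s"] show ?case by (auto simp: cone_count_def mono_count_def)
qed simp

section \<open>Polynomial growth\<close>

text \<open>Growth of order at most \<open>t\<^bsup>s - 1\<^esup>\<close>; for \<open>s = 0\<close> this forces a function to vanish eventually.\<close>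

definition grows :: "(nat \<Rightarrow> nat) \<Rightarrow> nat \<Rightarrow> bool" where
  "grows f s \<longleftrightarrow> (\<exists>C. \<forall>\<^sub>F t in sequentially. f t * Suc t \<le> C * Suc t ^ s)"

lemma grows_mono:
  assumes "\<forall>\<^sub>F t in sequentially. f t \<le> g t" "grows g s" shows "grows f s"
proof -
  from assms(2) obtain C where C: "\<forall>\<^sub>F t in sequentially. g t * Suc t \<le> C * Suc t ^ s"
    unfolding grows_def by blast
  from assms(1) C have "\<forall>\<^sub>F t in sequentially. f t * Suc t \<le> C * Suc t ^ s"
    by eventually_elim (meson le_trans mult_le_mono1)
  then show ?thesis unfolding grows_def by blast
qed

lemma grows_mono_exponent: "grows f s \<Longrightarrow> s \<le> s' \<Longrightarrow> grows f s'"
proof -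
  assume "grows f s" "s \<le> s'"
  then obtain C where C: "\<forall>\<^sub>F t in sequentially. f t * Suc t \<le> C * Suc t ^ s"
    unfolding grows_def by blast
  then have "\<forall>\<^sub>F t in sequentially. f t * Suc t \<le> C * Suc t ^ s'"
  proof eventually_elim
    case (elim t)
    have "Suc t ^ s \<le> Suc t ^ s'" using \<open>s \<le> s'\<close> by (intro power_increasing) auto
    then show ?case using elim by (meson le_trans mult_le_mono2)
  qed
  then show ?thesis unfolding grows_def by blast
qed

lemma grows_add:
  assumes "grows f s" "grows g s" shows "grows (\<lambda>t. f t + g t) s"
proof -
  obtain C D where "\<forall>\<^sub>F t in sequentially. f t * Suc t \<le> C * Suc t ^ s"
    "\<forall>\<^sub>F t in sequentially. g t * Suc t \<le> D * Suc t ^ s"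
    using assms unfolding grows_def by blast
  then have "\<forall>\<^sub>F t in sequentially. (f t + g t) * Suc t \<le> (C + D) * Suc t ^ s"
    by eventually_elim (simp add: add_mult_distrib)
  then show ?thesis unfolding grows_def by blast
qed

lemma grows_mult_const:
  assumes "grows f s" shows "grows (\<lambda>t. c * f t) s"
proof -
  obtain C where "\<forall>\<^sub>F t in sequentially. f t * Suc t \<le> C * Suc t ^ s"
    using assms unfolding grows_def by blast
  then have "\<forall>\<^sub>F t in sequentially. (c * f t) * Suc t \<le> (c * C) * Suc t ^ s"
    by eventually_elim (simp only: mult.assoc mult_le_mono2)
  then show ?thesis unfolding grows_def by blast
qed

lemma grows_shift:
  assumes "grows f (Suc s)" shows "grows (\<lambda>t. f (t - e)) (Suc s)"
proof -
  obtain C N where C: "\<And>t. t \<ge> N \<Longrightarrow> f t * Suc t \<le> C * Suc t ^ Suc s"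
    using assms unfolding grows_def eventually_sequentially by blast
  have C': "f t \<le> C * Suc t ^ s" if "t \<ge> N" for t
  proof -
    have "f t * Suc t \<le> (C * Suc t ^ s) * Suc t" using C[OF that] by (simp only: power_Suc ac_simps)
    then show ?thesis by (rule mult_le_cancel2[THEN iffD1, THEN mp]) simp
  qed
  have "f (t - e) * Suc t \<le> C * Suc t ^ Suc s" if "t \<ge> N + e" for t
  proof -
    have "f (t - e) \<le> C * Suc (t - e) ^ s" using C' that by simp
    also have "\<dots> \<le> C * Suc t ^ s" by (intro mult_le_mono2 power_mono) auto
    finally have "f (t - e) * Suc t \<le> C * Suc t ^ s * Suc t" by (rule mult_le_mono1)
    then show ?thesis by (simp only: power_Suc ac_simps)
  qed
  then show ?thesis unfolding grows_def eventually_sequentially by blast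
qed

lemma grows_0_iff: "grows f 0 \<longleftrightarrow> (\<forall>\<^sub>F t in sequentially. f t = 0)"
proof
  assume "grows f 0"
  then obtain C where "\<forall>\<^sub>F t in sequentially. f t * Suc t \<le> C" unfolding grows_def by auto
  with eventually_ge_at_top[of C] show "\<forall>\<^sub>F t in sequentially. f t = 0"
  proof eventually_elim
    case (elim t)
    then have "f t * Suc t < Suc t" by linarith
    then show ?case by (cases "f t") auto
  qed
next
  assume "\<forall>\<^sub>F t in sequentially. f t = 0"
  then have "\<forall>\<^sub>F t in sequentially. f t * Suc t \<le> 0 * Suc t ^ 0" by eventually_elim simp
  then show "grows f 0" unfolding grows_def by blast
qed

lemma grows_shift':
  assumes "grows f s" shows "grows (\<lambda>t. f (t - e)) s"
proof (cases s)
  case 0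
  with assms obtain N where "\<And>t. t \<ge> N \<Longrightarrow> f t = 0" by (auto simp: grows_0_iff eventually_sequentially)
  then have "\<And>t. t \<ge> N + e \<Longrightarrow> f (t - e) = 0" by simp
  then show ?thesis unfolding 0 grows_0_iff eventually_sequentially by blast
qed (use assms grows_shift in blast)

text \<open>The Krull dimension of the graded ring, one more than that of the scheme; 0 stands for
  the empty scheme.\<close>

definition gotz_dim :: "nat list \<Rightarrow> nat" where
  "gotz_dim as = (if as = [] then 0 else Suc (hd as))"

lemma gotz_dim_cut_dims: "gotz_dim (cut_dims as) = gotz_dim as - 1"
  by (cases as rule: cut_dims.cases) (auto simp: gotz_dim_def)

lemma binomial_le_power: "(t + a) choose a \<le> (t + a) ^ a"
  by (rule binomial_le_pow) simp

lemma grows_cone_count: "grows (cone_count (Suc a) e) (Suc a)"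
proof -
  have "cone_count (Suc a) e t * Suc t \<le> (Suc a ^ a) * Suc t ^ Suc a" for t
  proof -
    have "cone_count (Suc a) e t \<le> cone_count (Suc a) 0 t"
      by (auto simp: cone_count_def intro!: mono_count_degree_mono)
    also have "\<dots> \<le> (t + a) ^ a" by (simp add: mono_count_Suc_left binomial_le_power)
    also have "\<dots> \<le> (Suc a * Suc t) ^ a" by (intro power_mono) auto
    finally have "cone_count (Suc a) e t * Suc t \<le> (Suc a * Suc t) ^ a * Suc t" by (rule mult_le_mono1)
    then show ?thesis by (simp only: power_mult_distrib power_Suc ac_simps)
  qed
  then show ?thesis unfolding grows_def by (intro exI always_eventually allI)
qed

lemma grows_gotz: "(\<And>a. a \<in> set as \<Longrightarrow> Suc a \<le> D) \<Longrightarrow> grows (gotz s as) D"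
proof (induction as arbitrary: s)
  case Nil
  then show ?case by (auto simp: grows_def)
next
  case (Cons a as)
  have "gotz s (a # as) = (\<lambda>t. cone_count (Suc a) s t + gotz (Suc s) as t)" by auto
  moreover have "grows (cone_count (Suc a) s) D"
    using Cons.prems by (intro grows_mono_exponent[OF grows_cone_count]) auto
  ultimately show ?case using Cons by (auto intro!: grows_add)
qed

lemma grows_gotz_dim: "sorted_wrt (\<ge>) as \<Longrightarrow> grows (gotz s as) (gotz_dim as)"
  by (intro grows_gotz) (cases as, auto simp: gotz_dim_def)

lemma power_le_binomial: "Suc t ^ a \<le> fact a * ((t + a) choose a)"
proof (induction a)
  case (Suc a)
  have "fact (Suc a) * ((t + Suc a) choose Suc a) = fact a * ((Suc (t + a) choose Suc a) * Suc a)"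
    by (simp add: algebra_simps)
  also have "\<dots> = fact a * (Suc (t + a) * ((t + a) choose a))"
    by (simp only: Suc_times_binomial_eq)
  also have "\<dots> = Suc (t + a) * (fact a * ((t + a) choose a))" by (simp only: ac_simps)
  also have "\<dots> \<ge> Suc t * Suc t ^ a" by (intro mult_le_mono Suc.IH) auto
  finally show ?case by simp
qed simp

lemma gotz_dim_le_if_grows:
  assumes "grows (gotz 0 as) s" shows "gotz_dim as \<le> s"
proof (cases as)
  case (Cons a bs)
  obtain C N where C: "\<And>t. t \<ge> N \<Longrightarrow> gotz 0 as t * Suc t \<le> C * Suc t ^ s"
    using assms unfolding grows_def eventually_sequentially by blast
  \<comment> \<open>The first cone alone grows like \<open>t^a / a!\<close>, so beyond
    \<open>N\<close> any \<open>t\<close> with \<open>Suc t > fact a * C\<close> turns the bound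
    into a strict comparison of powers.\<close>
  define t where "t = max N (Suc (fact a * C))"
  have "Suc t ^ a \<le> fact a * gotz 0 as t"
    using power_le_binomial[of t a] by (simp add: Cons mono_count_Suc_left add_mult_distrib2)
  then have "Suc t ^ a * Suc t \<le> fact a * gotz 0 as t * Suc t" by (rule mult_le_mono1)
  also have "\<dots> \<le> fact a * (C * Suc t ^ s)" unfolding mult.assoc by (intro mult_le_mono2 C) (simp add: t_def)
  also have "\<dots> < Suc t * Suc t ^ s"
    unfolding mult.assoc[symmetric] by (intro mult_strict_right_mono) (auto simp: t_def)
  finally have "Suc t ^ Suc a < Suc t ^ Suc s" by (simp add: mult.commute)
  then have "Suc a < Suc s" by (rule power_less_imp_less_exp[rotated]) (auto simp: t_def max_def)
  then show ?thesis by (simp add: gotz_dim_def Cons)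
qed (simp add: gotz_dim_def)

text \<open>Sum \<open>gotz_cut_dims\<close> over \<open>e\<close> consecutive degrees and bound
  each increment by the last one. This serves for sections by forms of degree \<open>e\<close>,
  which are differences over \<open>e\<close> steps.\<close>

lemma gotz_diff_le:
  assumes "sorted_wrt (\<ge>) as" "length as + e \<le> t"
  shows "gotz 0 as t \<le> gotz 0 as (t - e) + e * gotz 0 (cut_dims as) t"
  using assms(2)
proof (induction e)
  case (Suc e)
  then obtain t' where t': "t - e = Suc t'" by (metis Suc_diff_Suc Suc_le_lessD add_Suc_right add_leD2)
  then have t'': "t - Suc e = t'" by simp
  have "gotz 0 as (t - e) = gotz 0 as (t - Suc e) + gotz 0 (cut_dims as) (t - e)"
    using gotz_cut_dims[OF assms(1), of 0 t'] Suc.prems t' t'' by simp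
  moreover have "gotz 0 (cut_dims as) (t - e) \<le> gotz 0 (cut_dims as) t" by (simp add: gotz_degree_mono)
  ultimately show ?case using Suc by simp
qed simp

section \<open>Binomial expansions\<close>

primrec binom_sum :: "nat \<Rightarrow> nat list \<Rightarrow> nat" where
  "binom_sum d [] = 0"
| "binom_sum d (k # ks) = (k choose d) + binom_sum (d - 1) ks"

lemma binom_sum_nth: "binom_sum d ks = (\<Sum>j<length ks. (ks ! j) choose (d - j))"
proof (induction ks arbitrary: d)
  case (Cons k ks)
  show ?case unfolding binom_sum.simps Cons.IH list.size(4) add_Suc_right add_0_right sum.lessThan_Suc_shift by (simp del: sum.lessThan_Suc)
qed simp

text \<open>The shape conditions of \<open>binomial_expansion\<close> with the empty list allowed,
  so that induction can pass to tails.\<close>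

definition admissible :: "nat \<Rightarrow> nat list \<Rightarrow> bool" where
  "admissible d ks \<longleftrightarrow> length ks \<le> d \<and> sorted_wrt (>) ks \<and> (ks \<noteq> [] \<longrightarrow> last ks \<ge> d + 1 - length ks)"

lemma binomial_expansion_iff: "binomial_expansion d c ks \<longleftrightarrow> ks \<noteq> [] \<and> admissible d ks \<and> c = binom_sum d ks"
  unfolding binomial_expansion_def admissible_def binom_sum_nth by blast

lemma admissible_Cons:
  assumes "admissible d (k # ks)"
  shows "admissible (d - 1) ks" "d > 0" "ks \<noteq> [] \<Longrightarrow> k > hd ks"
  using assms unfolding admissible_def by (auto split: if_splits)

lemma admissible_hd: "admissible d (k # ks) \<Longrightarrow> k \<ge> d"
proof (induction ks arbitrary: d k)
  case (Cons k' ks)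
  from admissible_Cons[OF Cons.prems] Cons.IH[of "d - 1" k'] show ?case by auto
qed (auto simp: admissible_def)

text \<open>Pascal's rule splits \<open>Suc k choose d\<close> into \<open>k choose d\<close> and
  \<open>k choose (d - 1)\<close>, and the tail stays below the second part because its head is
  smaller than \<open>k\<close>. Hence the sum determines the head, which gives uniqueness of the
  expansion.\<close>

lemma binom_sum_upper: "admissible d (k # ks) \<Longrightarrow> binom_sum d (k # ks) < Suc k choose d"
proof (induction ks arbitrary: d k)
  case Nil
  then have "k \<ge> d" "d > 0" using admissible_hd admissible_Cons by blast+
  then show ?case by (cases d) auto
next
  case (Cons k' ks)
  note adm = admissible_Cons[OF Cons.prems]
  have "binom_sum (d - 1) (k' # ks) < Suc k' choose (d - 1)" using Cons.IH adm(1) .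
  also have "\<dots> \<le> k choose (d - 1)" using adm(3) by (intro binomial_right_mono) auto
  finally show ?case using adm(2) by (cases d) auto
qed

lemma binom_sum_pos: "admissible d (k # ks) \<Longrightarrow> binom_sum d (k # ks) > 0"
  using admissible_hd[of d k ks] by (simp add: zero_less_binomial)

lemma binom_sum_hd_less:
  assumes "admissible d (k # ks)" "admissible d (k' # ks')" "k < k'"
  shows "binom_sum d (k # ks) < binom_sum d (k' # ks')"
proof -
  have "binom_sum d (k # ks) < Suc k choose d" using binom_sum_upper assms(1) .
  also have "\<dots> \<le> k' choose d" using assms(3) by (intro binomial_right_mono) auto
  finally show ?thesis by simp
qed

lemma binom_sum_inject:
  "admissible d ks \<Longrightarrow> admissible d ks' \<Longrightarrow> binom_sum d ks = binom_sum d ks' \<Longrightarrow> ks = ks'"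
proof (induction ks arbitrary: d ks')
  case Nil
  then show ?case by (cases ks') (auto dest: binom_sum_pos)
next
  case (Cons k ks)
  show ?case
  proof (cases ks')
    case Nil
    then show ?thesis using Cons.prems binom_sum_pos by fastforce
  next
    case (Cons k' ls)
    have "k = k'"
      using binom_sum_hd_less[of d k ks k' ls] binom_sum_hd_less[of d k' ls k ks] Cons.prems
      unfolding Cons by (metis less_irrefl linorder_neqE_nat)
    moreover have "ks = ls"
      by (rule Cons.IH[of "d - 1"]) (use Cons.prems \<open>k = k'\<close> in \<open>auto simp: Cons dest: admissible_Cons\<close>)
    ultimately show ?thesis by (simp add: Cons)
  qed
qed

definition expansion_of :: "nat \<Rightarrow> nat list \<Rightarrow> nat list" where
  "expansion_of t as = map (\<lambda>j. t - j + as ! j) [0..<length as]"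

lemma expansion_of_gotz:
  assumes "as \<noteq> []" "sorted_wrt (\<ge>) as" "length as \<le> t"
  shows "binomial_expansion t (gotz 0 as t) (expansion_of t as)"
  unfolding binomial_expansion_def
proof (intro conjI)
  show "sorted_wrt (>) (expansion_of t as)"
    unfolding sorted_wrt_iff_nth_less
  proof (intro allI impI)
    fix i j assume ij: "i < j" "j < length (expansion_of t as)"
    then have "as ! j \<le> as ! i" using assms(2) by (auto simp: sorted_wrt_iff_nth_less expansion_of_def)
    then show "expansion_of t as ! i > expansion_of t as ! j"
      using ij assms(3) by (auto simp: expansion_of_def)
  qed
  show "last (expansion_of t as) \<ge> t + 1 - length (expansion_of t as)"
    using assms(1) by (cases "length as") (auto simp: expansion_of_def last_map)
  show "gotz 0 as t = (\<Sum>j<length (expansion_of t as). (expansion_of t as ! j) choose (t - j))"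
    unfolding gotz_nth
  proof (rule sum.cong)
    fix j assume "j \<in> {..<length (expansion_of t as)}"
    then have j: "j < length as" by (simp add: expansion_of_def)
    have "(t - j + as ! j) choose (t - j) = (t - j + as ! j) choose (as ! j)"
      using binomial_symmetric[of "t - j" "t - j + as ! j"] by simp
    then show "cone_count (Suc (as ! j)) (0 + j) t = (expansion_of t as ! j) choose (t - j)"
      using j assms(3) by (simp add: cone_count_def expansion_of_def mono_count_Suc_left)
  qed (simp add: expansion_of_def)
qed (use assms in \<open>auto simp: expansion_of_def\<close>)

text \<open>Since binom(t - j + a_j, a_j) = binom(t - j + a_j, t - j), a Gotzmann sum whose cones
  have all started is already the \<open>t\<close>-binomial expansion, and its list can be read
  off.\<close>

lemma macaulay_differences_gotz:
  assumes "as \<noteq> []" "sorted_wrt (\<ge>) as" "length as \<le> t"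
  shows "macaulay_differences t (gotz 0 as t) = as"
proof -
  have "(THE ks. binomial_expansion t (gotz 0 as t) ks) = expansion_of t as"
    using expansion_of_gotz[OF assms]
    by (intro the_equality) (auto simp: binomial_expansion_iff intro: binom_sum_inject)
  then show ?thesis
    unfolding macaulay_differences_def Let_def
    by (intro nth_equalityI) (auto simp: expansion_of_def)
qed

lemma gotz_inject:
  assumes "as \<noteq> []" "sorted_wrt (\<ge>) as" "bs \<noteq> []" "sorted_wrt (\<ge>) bs"
    and ev: "\<forall>\<^sub>F t in sequentially. gotz 0 as t = gotz 0 bs t"
  shows "as = bs"
proof -
  have "\<forall>\<^sub>F t in sequentially. as = bs"
    using ev eventually_ge_at_top[of "length as"] eventually_ge_at_top[of "length bs"]
    by eventually_elim (metis macaulay_differences_gotz assms(1-4))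
  then show ?thesis by simp
qed

section \<open>Gotzmann polynomials\<close>

text \<open>The polynomial binom(T - j + a, a) in T.\<close>

definition binom_poly :: "nat \<Rightarrow> nat \<Rightarrow> rat poly" where
  "binom_poly a j = Polynomial.smult (1 / fact a) (\<Prod>i=1..a. [:of_nat i - of_nat j, 1:])"

primrec gotz_poly :: "nat \<Rightarrow> nat list \<Rightarrow> rat poly" where
  "gotz_poly s [] = 0"
| "gotz_poly s (a # as) = binom_poly a s + gotz_poly (Suc s) as"

lemma prod_shift_fact: "(\<Prod>i=1..a. of_nat m + of_nat i :: rat) * fact m = fact (m + a)"
proof (induction a)
  case (Suc a)
  have "(\<Prod>i=1..Suc a. of_nat m + of_nat i :: rat) * fact m
      = (of_nat m + of_nat (Suc a)) * ((\<Prod>i=1..a. of_nat m + of_nat i) * fact m)"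
    by simp
  then show ?case unfolding Suc.IH by (simp add: algebra_simps)
qed simp

lemma poly_binom_poly: "j \<le> t \<Longrightarrow> poly (binom_poly a j) (of_nat t) = of_nat (cone_count (Suc a) j t)"
proof -
  assume "j \<le> t"
  then obtain m where t: "t = j + m" by (metis le_Suc_ex)
  have "(\<Prod>i=1..a. of_nat m + of_nat i :: rat) = fact (m + a) / fact m"
    using prod_shift_fact[of m a] by (simp add: field_simps)
  moreover have "of_nat ((m + a) choose a) = fact (m + a) / (fact a * fact m :: rat)"
    using binomial_fact[of a "m + a"] by simp
  ultimately show ?thesis
    by (simp add: binom_poly_def poly_prod t cone_count_def mono_count_Suc_left algebra_simps)
qed

lemma degree_binom_poly: "Polynomial.degree (binom_poly a j) = a"
  and coeff_binom_poly: "fact a * Polynomial.coeff (binom_poly a j) a = 1"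
proof -
  let ?p = "\<Prod>i=1..a. [:of_nat i - of_nat j, 1:] :: rat poly"
  have deg: "Polynomial.degree ?p = a"
    by (subst degree_prod_eq_sum_degree) auto
  moreover have "lead_coeff ?p = 1" by (simp add: lead_coeff_prod)
  ultimately have "Polynomial.coeff ?p a = 1" by simp
  with deg show "Polynomial.degree (binom_poly a j) = a" "fact a * Polynomial.coeff (binom_poly a j) a = 1"
    by (simp_all add: binom_poly_def)
qed

lemma poly_gotz_poly: "s + length as \<le> Suc t \<Longrightarrow> poly (gotz_poly s as) (of_nat t) = of_nat (gotz s as t)"
  by (induction as arbitrary: s) (simp_all add: poly_binom_poly)

text \<open>Terms with \<open>a < r\<close> have smaller degree, and each term with
  \<open>a = r\<close> has leading coefficient 1/r!. So the degree of a scheme counts the largest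
  entries of its list.\<close>

lemma coeff_gotz_poly:
  "(\<And>a. a \<in> set as \<Longrightarrow> a \<le> r) \<Longrightarrow> fact r * Polynomial.coeff (gotz_poly s as) r = of_nat (count_list as r)"
proof (induction as arbitrary: s)
  case (Cons a as)
  have "fact r * Polynomial.coeff (binom_poly a s) r = (if a = r then 1 else 0)"
  proof (cases "a = r")
    case False
    then have "a < r" using Cons.prems by force
    then show ?thesis using False by (simp add: coeff_eq_0 degree_binom_poly)
  qed (simp add: coeff_binom_poly)
  then show ?case using Cons by (simp add: distrib_left)
qed simp

lemma poly_binom_poly_0_left: "poly (binom_poly 0 j) x = 1"
  by (simp add: binom_poly_def)

lemma poly_binom_poly_at_0: "poly (binom_poly a 0) 0 = 1"
proof -
  have "(\<Prod>i=1..a. of_nat i :: rat) = fact a" by (simp add: fact_prod)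
  then show ?thesis by (simp add: binom_poly_def poly_prod)
qed

text \<open>Upper negation: binom(a - 1 - m, a) = (-1)^a binom(m, a).\<close>

lemma poly_binom_poly_Suc_at_0: "poly (binom_poly a (Suc m)) 0 = (-1) ^ a * of_nat (m choose a)"
proof -
  have "(\<Prod>i=1..a. of_nat i - of_nat (Suc m) :: rat) = (\<Prod>i=0..<a. - (of_nat m - of_nat i))"
    by (rule prod.reindex_bij_witness[where i = Suc and j = "\<lambda>i. i - 1"]) auto
  also have "\<dots> = (-1) ^ a * (\<Prod>i=0..<a. of_nat m - of_nat i)"
    by (subst prod_uminus) simp
  finally show ?thesis
    by (simp add: binom_poly_def poly_prod binomial_gbinomial gbinomial_prod_rev)
qed

lemma poly_gotz_poly_at_0_aux:
  "poly (gotz_poly (Suc m) (replicate e a)) 0 = (-1) ^ a * (of_nat ((m + e) choose Suc a) - of_nat (m choose Suc a))"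
proof (induction e arbitrary: m)
  case (Suc e)
  show ?case by (simp add: Suc.IH poly_binom_poly_Suc_at_0 algebra_simps)
qed simp

text \<open>The origin of the prescribed genus: the term with generator degree 0 contributes 1, and
  by Pascal's rule the others telescope to a single binomial coefficient up to sign.\<close>

lemma poly_gotz_poly_at_0:
  "d > 0 \<Longrightarrow> poly (gotz_poly 0 (replicate d a)) 0 = 1 + (-1) ^ a * of_nat ((d - 1) choose Suc a)"
  by (cases d) (simp_all add: poly_binom_poly_at_0 poly_gotz_poly_at_0_aux)

lemma gotz_poly_append: "gotz_poly s (as @ bs) = gotz_poly s as + gotz_poly (s + length as) bs"
  by (induction as arbitrary: s) (simp_all add: algebra_simps)

lemma poly_gotz_poly_replicate_0: "poly (gotz_poly s (replicate e 0)) x = of_nat e"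
  by (induction e arbitrary: s) (simp_all add: poly_binom_poly_0_left)

section \<open>Standard decompositions of complements of monomial ideals\<close>

lemma monom_degree_superset:
  assumes "finite V" "keys m \<subseteq> V"
  shows "monom_degree m = (\<Sum>v\<in>V. lookup m v)"
  unfolding monom_degree_def using assms by (intro sum.mono_neutral_left) (auto simp: in_keys_iff)

lemma monom_degree_add: "monom_degree (a + b) = monom_degree a + monom_degree b"
proof -
  let ?V = "keys a \<union> keys b"
  have "keys (a + b) \<subseteq> ?V" by (rule Poly_Mapping.keys_add)
  then show ?thesis
    using monom_degree_superset[of ?V "a + b"] monom_degree_superset[of ?V a] monom_degree_superset[of ?V b]
    by (simp add: lookup_add sum.distrib)
qed

lemma monom_degree_0 [simp]: "monom_degree 0 = 0"
  by (simp add: monom_degree_def)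

lemma monom_degree_single [simp]: "monom_degree (single v c) = c"
  by (simp add: monom_degree_def)

lemma monom_degree_eq_0_iff: "monom_degree m = 0 \<longleftrightarrow> m = 0"
  by (auto simp: monom_degree_def poly_mapping_eq_iff in_keys_iff fun_eq_iff)

lemma keys_add_nat: "keys (a + b) = keys a \<union> keys (b :: 'v \<Rightarrow>\<^sub>0 nat)"
  by (auto simp: in_keys_iff lookup_add)

lemma monomial_factor:
  assumes "v \<in> keys m"
  shows "(m - single v 1) + single v (1::nat) = m"
  using assms by (intro poly_mapping_eqI) (auto simp: lookup_add lookup_minus lookup_single in_keys_iff when_def)

definition monomials :: "'v set \<Rightarrow> nat \<Rightarrow> ('v \<Rightarrow>\<^sub>0 nat) set" where
  "monomials V t = {m. keys m \<subseteq> V \<and> monom_degree m = t}"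

lemma monomials_0: "monomials V 0 = {0}"
  by (auto simp: monomials_def monom_degree_eq_0_iff)

lemma monomials_Suc:
  assumes "x \<in> V"
  shows "monomials V (Suc t) = monomials (V - {x}) (Suc t) \<union> (\<lambda>m. m + single x 1) ` monomials V t"
    (is "_ = ?A \<union> ?B")
proof (intro equalityI subsetI)
  fix m assume m: "m \<in> monomials V (Suc t)"
  show "m \<in> ?A \<union> ?B"
  proof (cases "x \<in> keys m")
    case True
    let ?m = "m - single x 1"
    have eq: "?m + single x 1 = m" using monomial_factor[OF True] .
    then have "?m \<in> monomials V t"
      using m monom_degree_add[of ?m "single x 1"] keys_add_nat[of ?m "single x 1"]
      by (auto simp: monomials_def)
    then show ?thesis using eq by (intro UnI2) (auto intro!: image_eqI[where x = ?m])
  qed (use m in \<open>auto simp: monomials_def\<close>)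
qed (use assms in \<open>auto simp: monomials_def monom_degree_add keys_add_nat\<close>)

lemma monomials_empty: "monomials {} (Suc t) = {}"
  by (auto simp: monomials_def)

lemma finite_monomials: "finite V \<Longrightarrow> finite (monomials V t)"
proof (induction V arbitrary: t rule: finite_induct)
  case empty
  then show ?case by (cases t) (simp_all add: monomials_0 monomials_empty)
next
  case (insert x V)
  show ?case
  proof (induction t)
    case (Suc t)
    then show ?case using insert monomials_Suc[of x "insert x V" t] by simp
  qed (simp add: monomials_0)
qed

text \<open>The predicate \<open>P\<close> will be non-membership in a monomial ideal; the second
  summand then counts the complement of the colon ideal by \<open>x\<close>.\<close>

lemma card_monomials_Suc:
  assumes "finite V" "x \<in> V"
  shows "card {m \<in> monomials V (Suc t). P m} = card {m \<in> monomials (V - {x}) (Suc t). P m}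
           + card {m \<in> monomials V t. P (m + single x 1)}"
proof -
  let ?s = "\<lambda>m. m + single x (1::nat)"
  have "{m \<in> monomials V (Suc t). P m}
      = {m \<in> monomials (V - {x}) (Suc t). P m} \<union> ?s ` {m \<in> monomials V t. P (?s m)}"
    unfolding monomials_Suc[OF assms(2)] by auto
  moreover have "{m \<in> monomials (V - {x}) (Suc t). P m} \<inter> ?s ` {m \<in> monomials V t. P (?s m)} = {}"
    by (auto simp: monomials_def keys_add_nat)
  moreover have "card (?s ` {m \<in> monomials V t. P (?s m)}) = card {m \<in> monomials V t. P (?s m)}"
    by (rule card_image) (auto simp: inj_on_def)
  ultimately show ?thesis
    using finite_monomials[OF assms(1)] finite_monomials[of "V - {x}" "Suc t"] assms(1)
    by (simp add: card_Un_disjoint)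
qed

lemma card_monomials: "finite V \<Longrightarrow> card (monomials V t) = mono_count (card V) t"
proof (induction V arbitrary: t rule: finite_induct)
  case empty
  then show ?case by (cases t) (simp_all add: monomials_0 monomials_empty mono_count_def)
next
  case (insert x V)
  show ?case
  proof (induction t)
    case (Suc t)
    then show ?case using insert card_monomials_Suc[of "insert x V" x t "\<lambda>_. True"]
      by (simp add: mono_count_Suc_Suc)
  qed (simp add: monomials_0)
qed

text \<open>The set of monomials of a monomial ideal in the variables \<open>V\<close>.\<close>

definition upset :: "'v set \<Rightarrow> ('v \<Rightarrow>\<^sub>0 nat) set \<Rightarrow> bool" where
  "upset V I \<longleftrightarrow> (\<forall>m \<in> I. keys m \<subseteq> V) \<and>
     (\<forall>m \<in> I. \<forall>m'. keys m' \<subseteq> V \<longrightarrow> m + m' \<in> I)"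

section \<open>Dickson's lemma and the ascending chain condition for monomial ideals\<close>

lemma nat_seq_incseq_subseq:
  fixes s :: "nat \<Rightarrow> nat"
  shows "\<exists>h :: nat \<Rightarrow> nat. strict_mono h \<and> mono (\<lambda>i. s (h i))"
proof -
  obtain h :: "nat \<Rightarrow> nat" where h: "strict_mono h" "monoseq (\<lambda>i. s (h i))" using seq_monosub by blast
  show ?thesis
  proof (cases "mono (\<lambda>i. s (h i))")
    case False
    then have dec: "antimono (\<lambda>i. s (h i))" using h(2) by (simp add: monoseq_iff)
    \<comment> \<open>A non-increasing sequence of natural numbers is constant from the place where
      its minimum is attained.\<close>
    obtain k where k: "\<And>i. s (h k) \<le> s (h i)" using ex_has_least_nat[of "\<lambda>_. True" 0 "\<lambda>i. s (h i)"] by blast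
    have "strict_mono (\<lambda>i. h (k + i))" using h(1) by (auto simp: strict_mono_def)
    moreover have "s (h (k + i)) = s (h k)" for i using k[of "k + i"] antimonoD[OF dec, of k "k + i"] by simp
    ultimately have "strict_mono (\<lambda>i. h (k + i)) \<and> mono (\<lambda>i. s (h (k + i)))" by (simp add: mono_def)
    then show ?thesis by blast
  qed (use h in blast)
qed

text \<open>Dickson's lemma for sequences: refining once per variable leaves a subsequence that is
  monotone in all exponents, so its earlier monomials divide the later ones.\<close>

lemma dickson_subseq:
  fixes f :: "nat \<Rightarrow> 'v \<Rightarrow>\<^sub>0 nat"
  assumes "finite V"
  shows "\<exists>g :: nat \<Rightarrow> nat. strict_mono g \<and> (\<forall>v\<in>V. mono (\<lambda>i. lookup (f (g i)) v :: nat))"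
  using assms
proof (induction V rule: finite_induct)
  case empty
  show ?case by (auto intro!: exI[of _ id] simp: strict_mono_def)
next
  case (insert x V)
  then obtain g :: "nat \<Rightarrow> nat" where g: "strict_mono g" "\<And>v. v \<in> V \<Longrightarrow> mono (\<lambda>i. lookup (f (g i)) v)" by blast
  obtain h :: "nat \<Rightarrow> nat" where h: "strict_mono h" "mono (\<lambda>i. lookup (f (g (h i))) x)"
    using nat_seq_incseq_subseq[of "\<lambda>i. lookup (f (g i)) x"] by blast
  have "strict_mono (\<lambda>i. g (h i))" using g(1) h(1) by (simp add: strict_mono_def)
  moreover have "mono (\<lambda>i. lookup (f (g (h i))) v)" if "v \<in> insert x V" for v
  proof (cases "v = x")
    case False
    have "h i \<le> h j" if "i \<le> j" for i j using h(1) that by (simp add: strict_mono_less_eq)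
    then show ?thesis using g(2)[of v] that False unfolding mono_def by blast
  qed (use h(2) in simp)
  ultimately show ?case by (intro exI[of _ "\<lambda>i. g (h i)"]) blast
qed

text \<open>Along a strictly increasing chain choose a new monomial at every step. By Dickson's
  lemma an earlier one divides a later one, which therefore was not new. Larger sets count as
  smaller in the relation.\<close>

lemma wf_upset:
  assumes "finite V"
  shows "wf {(J, I). upset V I \<and> upset V J \<and> I \<subset> J}"
  unfolding wf_iff_no_infinite_down_chain
proof
  assume "\<exists>F. \<forall>i. (F (Suc i), F i) \<in> {(J, I). upset V I \<and> upset V J \<and> I \<subset> J}"
  then obtain F where F: "\<And>i. upset V (F i)" "\<And>i. F i \<subset> F (Suc i)" by blast
  have incl: "F i \<subseteq> F j" if "i \<le> j" for i j
  proof -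
    have "F n \<subseteq> F (Suc n)" for n using F(2) by blast
    then show ?thesis using lift_Suc_mono_le[of F i j] that by blast
  qed
  from F(2) have "\<exists>m. m \<in> F (Suc i) \<and> m \<notin> F i" for i by blast
  then obtain m where m: "\<And>i. m i \<in> F (Suc i)" "\<And>i. m i \<notin> F i" by metis
  obtain g :: "nat \<Rightarrow> nat" where g: "strict_mono g" "\<And>v. v \<in> V \<Longrightarrow> mono (\<lambda>i. lookup (m (g i)) v)"
    using dickson_subseq[OF assms, of m] by blast
  have sub: "keys (m i) \<subseteq> V" for i using F(1) m(1) unfolding upset_def by blast
  have le: "lookup (m (g 0)) v \<le> lookup (m (g 1)) v" for v
  proof (cases "v \<in> V")
    case True
    then show ?thesis using g(2)[OF True] by (auto dest: monoD)
  next
    case False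
    then have "v \<notin> keys (m (g 0))" using sub by blast
    then show ?thesis by (simp add: in_keys_iff)
  qed
  have "m (g 1) = m (g 0) + (m (g 1) - m (g 0))"
    by (intro poly_mapping_eqI) (simp add: lookup_add lookup_minus le[simplified])
  moreover have "keys (m (g 1) - m (g 0)) \<subseteq> V"
    using sub[of "g 1"] by (auto simp: in_keys_iff lookup_minus)
  ultimately have "m (g 1) \<in> F (Suc (g 0))"
    using F(1)[of "Suc (g 0)"] m(1)[of "g 0"] unfolding upset_def by metis
  moreover have "Suc (g 0) \<le> g 1" using g(1) by (simp add: strict_mono_def Suc_le_eq)
  ultimately show False using incl m(2) by blast
qed

lemma cone_count_Suc_Suc: "cone_count u (Suc e) (Suc t) = cone_count u e t"
  by (simp add: cone_count_def)

text \<open>A pair \<open>(e, u)\<close> stands for a cone with generator of degree \<open>e\<close>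
  and \<open>u\<close> free variables; only these numbers are kept, not the cones.\<close>

definition cones_sum :: "(nat \<times> nat) multiset \<Rightarrow> nat \<Rightarrow> nat" where
  "cones_sum A t = (\<Sum>x\<in>#A. cone_count (snd x) (fst x) t)"

definition monomial_independent :: "('v \<Rightarrow>\<^sub>0 nat) set \<Rightarrow> 'v set \<Rightarrow> bool" where
  "monomial_independent I s \<longleftrightarrow> (\<forall>m \<in> I. \<not> keys m \<subseteq> s)"

text \<open>The dimension of the quotient by the monomial ideal, as the size of a largest set of
  variables independent modulo it. Inserting 0 keeps \<open>Max\<close> meaningful if
  \<open>0 \<in> I\<close>, when no set is independent.\<close>

definition monomial_dim :: "'v set \<Rightarrow> ('v \<Rightarrow>\<^sub>0 nat) set \<Rightarrow> nat" where
  "monomial_dim V I = Max (insert 0 (card ` {s. s \<subseteq> V \<and> monomial_independent I s}))"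

lemma monomial_dim_ge:
  "finite V \<Longrightarrow> s \<subseteq> V \<Longrightarrow> monomial_independent I s \<Longrightarrow> card s \<le> monomial_dim V I"
  unfolding monomial_dim_def by (intro Max_ge) (auto intro: finite_subset[of _ "Pow V"])

lemma monomial_dim_le:
  "finite V \<Longrightarrow> (\<And>s. s \<subseteq> V \<Longrightarrow> monomial_independent I s \<Longrightarrow> card s \<le> D) \<Longrightarrow> monomial_dim V I \<le> D"
  unfolding monomial_dim_def by (subst Max_le_iff) (auto intro: finite_subset[of _ "Pow V"])

lemma monomial_dim_attained:
  assumes "finite V" "0 \<notin> I"
  obtains s where "s \<subseteq> V" "monomial_independent I s" "card s = monomial_dim V I"
proof -
  have "monomial_dim V I \<in> insert 0 (card ` {s. s \<subseteq> V \<and> monomial_independent I s})"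
    unfolding monomial_dim_def using assms(1) by (intro Max_in) (auto intro: finite_subset[of _ "Pow V"])
  moreover have "monomial_independent I {}" using assms(2) by (auto simp: monomial_independent_def)
  then have "0 \<in> card ` {s. s \<subseteq> V \<and> monomial_independent I s}" by force
  ultimately show ?thesis using that by force
qed

text \<open>Dube's standardness condition: every degree from \<open>s\<close> up to a generator
  holds a cone that is at least as large. It provides a cone of the largest dimension in the lowest
  degree, and this is the cone that \<open>standard_cones_gotz\<close> keeps.\<close>

definition standard_cones :: "nat \<Rightarrow> (nat \<times> nat) multiset \<Rightarrow> bool" where
  "standard_cones s A \<longleftrightarrow>
     (\<forall>(e, u) \<in># A. s \<le> e \<and> (\<forall>d. s \<le> d \<and> d \<le> e \<longrightarrow> (\<exists>u'\<ge>u. (d, u') \<in># A)))"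

lemma standard_conesD:
  "standard_cones s A \<Longrightarrow> (e, u) \<in># A \<Longrightarrow> s \<le> e"
  "standard_cones s A \<Longrightarrow> (e, u) \<in># A \<Longrightarrow> s \<le> d \<Longrightarrow> d \<le> e \<Longrightarrow> \<exists>u'\<ge>u. (d, u') \<in># A"
  unfolding standard_cones_def by blast+

text \<open>Splitting off a variable outside a largest independent set keeps the dimension on one side, so
  the cone generated by \<open>1\<close> dominates the cones coming from the other side.\<close>

lemma standard_decomposition:
  fixes V :: "'v set"
  assumes "finite V" "upset V I"
  shows "\<exists>A. (\<forall>t. card {m \<in> monomials V t. m \<notin> I} = cones_sum A t) \<and> standard_cones 0 A \<and>
           (\<forall>(e, u) \<in># A. u \<le> monomial_dim V I) \<and> (A \<noteq> {#} \<longrightarrow> (0, monomial_dim V I) \<in># A)"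
  using assms
proof (induction "card V" arbitrary: V I rule: less_induct)
  case less
  note outer = less.hyps and finV = less.prems(1)
  show ?case using less.prems(2)
  proof (induction I rule: wf_induct_rule[OF wf_upset[OF finV]])
    case (1 I)
    note up = 1(2)
    consider "0 \<in> I" | "0 \<notin> I" "monomial_independent I V" | "0 \<notin> I" "\<not> monomial_independent I V"
      by blast
    then show ?case
    proof cases
      case 1
      then have "m \<in> I" if "keys m \<subseteq> V" for m
        using up that unfolding upset_def by (metis add_0)
      then have "{m \<in> monomials V t. m \<notin> I} = {}" for t by (auto simp: monomials_def)
      then have "card {m \<in> monomials V t. m \<notin> I} = cones_sum {#} t" for t
        by (simp only: cones_sum_def card.empty image_mset_empty sum_mset.empty)
      then show ?thesis by (intro exI[of _ "{#}"]) (auto simp: standard_cones_def)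
    next
      case 2
      then have I: "I = {}" using up by (auto simp: monomial_independent_def upset_def)
      have dim: "monomial_dim V I = card V"
        by (intro antisym monomial_dim_ge monomial_dim_le) (use finV 2 in \<open>auto intro: card_mono\<close>)
      show ?thesis
        by (intro exI[of _ "{#(0, card V)#}"])
          (simp add: I dim[unfolded I] cones_sum_def standard_cones_def card_monomials[OF finV])
    next
      case 3
      obtain s where s: "s \<subseteq> V" "monomial_independent I s" "card s = monomial_dim V I"
        using monomial_dim_attained[OF finV 3(1)] by blast
      have "s \<noteq> V" using s(2) 3(2) by blast
      then obtain x where x: "x \<in> V" "x \<notin> s" using s(1) by blast
      define X where "X = single x (1::nat)"
      define I1 where "I1 = {m \<in> I. keys m \<subseteq> V - {x}}"
      define I2 where "I2 = {m. keys m \<subseteq> V \<and> m + X \<in> I}"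
      have up1: "upset (V - {x}) I1"
        using up unfolding upset_def I1_def by (clarsimp simp: keys_add_nat) blast
      have "m + m' \<in> I2" if m: "m \<in> I2" "keys m' \<subseteq> V" for m m'
      proof -
        have "m + X + m' \<in> I" using up m unfolding upset_def I2_def by blast
        then show ?thesis using m by (simp add: I2_def keys_add_nat add.commute add.left_commute)
      qed
      moreover have "keys m \<subseteq> V" if "m \<in> I2" for m using that by (simp add: I2_def)
      ultimately have up2: "upset V I2" unfolding upset_def by blast
      have sub: "I \<subseteq> I2" using up x(1) unfolding upset_def I2_def X_def by auto
      \<comment> \<open>If the two agreed, factors \<open>x\<close> could be cancelled from members
        of \<open>I\<close>, and \<open>s\<close> together with \<open>x\<close> would still be
        independent, although \<open>s\<close> is largest.\<close>
      have "I \<noteq> I2"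
      proof
        assume eq: "I = I2"
        have *: "m \<in> I" if "m + single x k \<in> I" "keys m \<subseteq> V" for m k
          using that
        proof (induction k)
          case (Suc k)
          have k: "single x (Suc k) = single x k + X"
            unfolding X_def by (simp flip: single_add)
          have "keys (m + single x k) \<subseteq> V"
            using Suc.prems x(1) by (auto simp: keys_add_nat split: if_splits)
          then have "m + single x k \<in> I2"
            using Suc.prems unfolding I2_def k by (simp add: add.assoc)
          then show ?case using Suc eq by simp
        qed simp
        have "monomial_independent I (insert x s)"
          unfolding monomial_independent_def
        proof (intro ballI notI)
          fix m assume m: "m \<in> I" "keys m \<subseteq> insert x s"
          let ?m = "m - single x (lookup m x)"
          have eq: "?m + single x (lookup m x) = m"
            by (intro poly_mapping_eqI) (auto simp: lookup_add lookup_minus lookup_single when_def)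
          have km: "keys ?m \<subseteq> s"
          proof
            fix v assume "v \<in> keys ?m"
            then have v: "lookup m v - (lookup m x when x = v) \<noteq> 0"
              by (simp add: in_keys_iff lookup_minus lookup_single)
            then have "v \<noteq> x" by auto
            moreover have "v \<in> keys m" using v by (auto simp: in_keys_iff)
            ultimately show "v \<in> s" using m(2) by blast
          qed
          then have "?m \<in> I" using *[of ?m "lookup m x"] s(1) m(1) by (simp add: eq)
          then show False using km s(2) unfolding monomial_independent_def by blast
        qed
        then have "card (insert x s) \<le> monomial_dim V I" using s(1) x(1) finV by (intro monomial_dim_ge) auto
        moreover have "finite s" using s(1) finV finite_subset by blast
        ultimately show False using s(3) x(2) by simp
      qed
      then have "I \<subset> I2" using sub by blast
      then have IH2: "\<exists>A. (\<forall>t. card {m \<in> monomials V t. m \<notin> I2} = cones_sum A t) \<and> standard_cones 0 A \<and>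
           (\<forall>(e, u) \<in># A. u \<le> monomial_dim V I2) \<and> (A \<noteq> {#} \<longrightarrow> (0, monomial_dim V I2) \<in># A)"
        using 1(1)[of I2] up up2 by blast
      have IH1: "\<exists>A. (\<forall>t. card {m \<in> monomials (V - {x}) t. m \<notin> I1} = cones_sum A t) \<and> standard_cones 0 A \<and>
           (\<forall>(e, u) \<in># A. u \<le> monomial_dim (V - {x}) I1) \<and> (A \<noteq> {#} \<longrightarrow> (0, monomial_dim (V - {x}) I1) \<in># A)"
        by (rule outer) (use x finV up1 in \<open>simp_all del: card_Diff_insert add: card_Diff1_less\<close>)
      obtain A1 A2 where A1: "\<And>t. card {m \<in> monomials (V - {x}) t. m \<notin> I1} = cones_sum A1 t"
          "standard_cones 0 A1" "\<And>e u. (e, u) \<in># A1 \<Longrightarrow> u \<le> monomial_dim (V - {x}) I1"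
          "A1 \<noteq> {#} \<Longrightarrow> (0, monomial_dim (V - {x}) I1) \<in># A1"
        and A2: "\<And>t. card {m \<in> monomials V t. m \<notin> I2} = cones_sum A2 t"
          "standard_cones 0 A2" "\<And>e u. (e, u) \<in># A2 \<Longrightarrow> u \<le> monomial_dim V I2"
        using IH1 IH2 by blast
      have dim1: "monomial_dim (V - {x}) I1 = monomial_dim V I"
      proof (rule antisym)
        show "monomial_dim (V - {x}) I1 \<le> monomial_dim V I"
        proof (rule monomial_dim_le)
          fix s assume s: "s \<subseteq> V - {x}" "monomial_independent I1 s"
          then have "monomial_independent I s" unfolding monomial_independent_def I1_def by blast
          then show "card s \<le> monomial_dim V I" using s(1) finV by (intro monomial_dim_ge) auto
        qed (use finV in simp)
        have "monomial_independent I1 s" using s(2) by (auto simp: monomial_independent_def I1_def)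
        then show "monomial_dim V I \<le> monomial_dim (V - {x}) I1"
          using s(1,3) x(2) finV monomial_dim_ge[of "V - {x}" s I1] by auto
      qed
      have dim2: "monomial_dim V I2 \<le> monomial_dim V I"
      proof (rule monomial_dim_le)
        fix s assume s: "s \<subseteq> V" "monomial_independent I2 s"
        then have "monomial_independent I s" using sub unfolding monomial_independent_def by blast
        then show "card s \<le> monomial_dim V I" using s(1) finV by (intro monomial_dim_ge) auto
      qed (use finV in simp)
      \<comment> \<open>Monomials outside \<open>I\<close> without \<open>x\<close> are counted by
        \<open>A1\<close>; the others are \<open>X\<close> times a monomial outside
        \<open>I2\<close>, hence the degree shift.\<close>
      define A where "A = A1 + image_mset (\<lambda>x. (Suc (fst x), snd x)) A2"
      have sum_A: "cones_sum A t = cones_sum A1 t + (\<Sum>x\<in>#A2. cone_count (snd x) (Suc (fst x)) t)" for t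
        by (simp add: A_def cones_sum_def image_mset.compositionality comp_def)
      have I1: "{m \<in> monomials (V - {x}) t. m \<notin> I1} = {m \<in> monomials (V - {x}) t. m \<notin> I}" for t
        by (auto simp: I1_def monomials_def)
      have I2: "{m \<in> monomials V t. m \<notin> I2} = {m \<in> monomials V t. m + X \<notin> I}" for t
        by (auto simp: I2_def monomials_def)
      have count: "card {m \<in> monomials V t. m \<notin> I} = cones_sum A t" for t
      proof (cases t)
        case 0
        have "{m \<in> monomials V 0. m \<notin> I} = {m \<in> monomials (V - {x}) 0. m \<notin> I}" by (simp add: monomials_0)
        then show ?thesis using A1(1)[of 0] by (simp add: 0 sum_A I1 cone_count_def)
      next
        case (Suc t')
        have "(\<Sum>x\<in>#A2. cone_count (snd x) (Suc (fst x)) (Suc t')) = cones_sum A2 t'"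
          by (simp add: cone_count_Suc_Suc cones_sum_def)
        then show ?thesis
          using card_monomials_Suc[OF finV x(1), of t' "\<lambda>m. m \<notin> I"] A1(1)[of t] A2(1)[of t']
          by (simp add: Suc sum_A I1 I2 X_def)
      qed
      have "{m \<in> monomials (V - {x}) 0. m \<notin> I} = {0}" using 3(1) by (auto simp: monomials_0)
      then have "A1 \<noteq> {#}" using A1(1)[of 0] I1[of 0] by (auto simp: cones_sum_def)
      then have top: "(0, monomial_dim V I) \<in># A1" using A1(4) dim1 by simp
      have bound: "u \<le> monomial_dim V I" if "(e, u) \<in># A" for e u
        using that A1(3) A2(3) dim1 dim2 by (force simp: A_def)
      have "standard_cones 0 A"
        unfolding standard_cones_def
      proof (clarify, intro conjI allI impI)
        fix e u d assume eu: "(e, u) \<in># A" and d: "0 \<le> d \<and> d \<le> e"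
        show "\<exists>u'\<ge>u. (d, u') \<in># A"
        proof (cases "(e, u) \<in># A1")
          case True
          then show ?thesis using standard_conesD(2)[OF A1(2) True] d unfolding A_def by auto
        next
          case False
          then obtain e' where e': "e = Suc e'" "(e', u) \<in># A2" using eu by (auto simp: A_def)
          show ?thesis
          proof (cases d)
            case 0
            \<comment> \<open>Degree 0 lies below all shifted cones and is served by the cone of top
              dimension from \<open>A1\<close>.\<close>
            then show ?thesis using top bound[OF eu] by (auto simp: A_def)
          next
            case (Suc d')
            then have "d' \<le> e'" using d e' by simp
            then obtain u' where "u' \<ge> u" "(d', u') \<in># A2"
              using standard_conesD(2)[OF A2(2) e'(2)] by auto
            then show ?thesis by (auto simp: A_def Suc image_iff intro!: exI[of _ u'] bexI[of _ "(d', u')"])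
          qed
        qed
      qed simp
      then show ?thesis
        using count bound top by (intro exI[of _ A]) (auto simp: A_def)
    qed
  qed
qed

text \<open>Without its generator, a cone with \<open>u\<close> free variables is the disjoint union
  of cones with 1, ..., \<open>u\<close> free variables generated one degree higher: sort the
  monomials by the last free variable that occurs.\<close>

definition split_cones :: "nat \<Rightarrow> (nat \<times> nat) multiset \<Rightarrow> (nat \<times> nat) multiset" where
  "split_cones s B = (\<Sum>x\<in>#B. mset (map (\<lambda>i. (Suc s, i)) [1..<Suc (snd x)]))"

lemma cone_count_split_sum:
  "s < t \<Longrightarrow> cone_count u s t = cones_sum (mset (map (\<lambda>i. (Suc s, i)) [1..<Suc u])) t"
proof (induction u)
  case (Suc u)
  then show ?case using cone_count_split[of u s t] by (simp add: cones_sum_def)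
qed (simp add: cones_sum_def cone_count_def mono_count_def)

lemma cones_sum_add: "cones_sum (A + B) t = cones_sum A t + cones_sum B t"
  by (simp add: cones_sum_def)

lemma cones_sum_split_cones:
  "s < t \<Longrightarrow> (\<And>x. x \<in># B \<Longrightarrow> fst x = s) \<Longrightarrow> cones_sum (split_cones s B) t = cones_sum B t"
proof (induction B)
  case (add x B)
  then have "fst x = s" by auto
  then show ?case
    using add cone_count_split_sum[of s t "snd x"]
    by (simp add: split_cones_def cones_sum_add) (simp add: cones_sum_def)
qed (simp add: split_cones_def cones_sum_def)

lemma in_split_cones: "x \<in># split_cones s B \<Longrightarrow> fst x = Suc s \<and> snd x \<ge> 1 \<and> (\<exists>y\<in>#B. snd x \<le> snd y)"
  by (induction B) (auto simp: split_cones_def)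

lemma split_cones_dims:
  "(\<And>x. x \<in># B \<Longrightarrow> snd x \<ge> 1) \<Longrightarrow>
     image_mset snd (split_cones s B) = image_mset snd B + (\<Sum>x\<in>#B. mset [1..<snd x])"
proof (induction B)
  case (add x B)
  then have "snd x \<ge> 1" by simp
  then obtain u where u: "snd x = Suc u" by (cases "snd x") auto
  have "image_mset snd (mset (map (\<lambda>i. (Suc s, i)) [1..<Suc (Suc u)])) = add_mset (Suc u) (mset [1..<Suc u])"
    by (simp add: image_mset.compositionality comp_def flip: mset_map)
  moreover have "image_mset snd (split_cones s B) = image_mset snd B + (\<Sum>x\<in>#B. mset [1..<snd x])"
    using add by auto
  ultimately show ?case by (simp add: split_cones_def u union_ac del: upt_Suc)
qed (simp add: split_cones_def)

lemma in_sum_mset_upt: "k \<in># (\<Sum>x\<in>#B. mset [1..<snd x]) \<Longrightarrow> \<exists>x\<in>#B. k < snd x"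
  by (induction B) auto

text \<open>One cone of the largest dimension is kept in each degree; splitting the others by one degree
  replaces one maximal dimension by smaller ones in the multiset order.\<close>

lemma standard_cones_gotz:
  assumes "standard_cones s A" "\<And>x. x \<in># A \<Longrightarrow> snd x \<ge> 1"
  shows "\<exists>as. sorted_wrt (\<ge>) as \<and> (\<forall>a \<in> set as. \<exists>x\<in>#A. a < snd x) \<and>
           (\<forall>\<^sub>F t in sequentially. cones_sum A t = gotz s as t)"
  using assms
proof (induction A arbitrary: s
    rule: wf_induct_rule[OF wf_inv_image[OF wf_mult[OF wf_less], of "image_mset snd"]])
  case (1 A)
  note std = 1(2) and pos = 1(3)
  show ?case
  proof (cases "A = {#}")
    case True
    then show ?thesis by (intro exI[of _ "[]"]) (simp add: cones_sum_def)
  next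
    case False
    define u0 where "u0 = Max (snd ` set_mset A)"
    have "u0 \<in> snd ` set_mset A" unfolding u0_def using False by (intro Max_in) auto
    then obtain e0 where e0: "(e0, u0) \<in># A" by force
    have max: "snd x \<le> u0" if "x \<in># A" for x unfolding u0_def using that by (intro Max_ge) auto
    have "s \<le> e0" using standard_conesD(1)[OF std e0] .
    then obtain u' where "u' \<ge> u0" "(s, u') \<in># A" using standard_conesD(2)[OF std e0, of s] by auto
    then have top: "(s, u0) \<in># A" using max[of "(s, u')"] by simp
    define B where "B = filter_mset (\<lambda>x. fst x = s) (A - {#(s, u0)#})"
    define C where "C = filter_mset (\<lambda>x. fst x \<noteq> s) (A - {#(s, u0)#})"
    have A: "A = {#(s, u0)#} + (B + C)"
      using top unfolding B_def C_def by (simp flip: multiset_partition)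
    define A' where "A' = C + split_cones s B"
    have B: "fst x = s" "snd x \<ge> 1" if "x \<in># B" for x
      using that pos[of x] by (auto simp: B_def dest: in_diffD)
    have Cin: "x \<in># C \<longleftrightarrow> x \<in># A \<and> fst x \<noteq> s" for x
      unfolding C_def by (auto dest: in_diffD)
    have pos': "snd x \<ge> 1" if "x \<in># A'" for x
      using that pos[of x] by (auto simp: A'_def Cin dest: in_split_cones)
    have std': "standard_cones (Suc s) A'"
      unfolding standard_cones_def
    proof (clarify, intro conjI allI impI)
      fix e u assume eu: "(e, u) \<in># A'"
      show "Suc s \<le> e"
      proof (cases "(e, u) \<in># C")
        case True
        then have "(e, u) \<in># A" "e \<noteq> s" by (simp_all add: Cin)
        moreover from this have "s \<le> e" using standard_conesD(1)[OF std] by blast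
        ultimately show ?thesis by simp
      next
        case False
        then show ?thesis using eu in_split_cones[of "(e, u)" s B] by (simp add: A'_def)
      qed
      fix d assume d: "Suc s \<le> d \<and> d \<le> e"
      show "\<exists>u'\<ge>u. (d, u') \<in># A'"
      proof (cases "(e, u) \<in># C")
        case True
        then have "(e, u) \<in># A" by (simp add: Cin)
        then obtain u' where "u' \<ge> u" "(d, u') \<in># A" using standard_conesD(2)[OF std, of e u d] d by (meson Suc_leD)
        then show ?thesis using d by (intro exI[of _ u']) (auto simp: A'_def Cin)
      next
        case False
        then have "(e, u) \<in># split_cones s B" using eu by (simp add: A'_def)
        then have "d = e" using in_split_cones[of "(e, u)" s B] d by simp
        then show ?thesis using eu by blast
      qed
    qed
    have "(image_mset snd A', image_mset snd A) \<in> Multiset.mult {(x, y). x < y}"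
    proof -
      have "image_mset snd A' = (image_mset snd C + image_mset snd B) + (\<Sum>x\<in>#B. mset [1..<snd x])"
        unfolding A'_def using split_cones_dims[of B s] B by (simp add: union_ac)
      moreover have "image_mset snd A = (image_mset snd C + image_mset snd B) + {#u0#}"
        unfolding A by (simp add: union_ac)
      moreover have "k < u0" if "k \<in># (\<Sum>x\<in>#B. mset [1..<snd x])" for k
      proof -
        from in_sum_mset_upt[OF that] obtain x where "x \<in># B" "k < snd x" by blast
        moreover have "snd x \<le> u0" using \<open>x \<in># B\<close> max[of x] unfolding A by auto
        ultimately show ?thesis by simp
      qed
      ultimately show ?thesis by (simp only:, intro one_step_implies_mult) auto
    qed
    then obtain as where as: "sorted_wrt (\<ge>) as" "\<And>a. a \<in> set as \<Longrightarrow> \<exists>x\<in>#A'. a < snd x"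
      "\<forall>\<^sub>F t in sequentially. cones_sum A' t = gotz (Suc s) as t"
      using 1(1)[of A', OF _ std' pos'] by (auto simp: in_inv_image)
    have lt: "a < u0" if a: "a \<in> set as" for a
    proof -
      obtain x where x: "x \<in># A'" "a < snd x" using as(2)[OF a] by blast
      have "snd x \<le> u0"
      proof (cases "x \<in># C")
        case False
        then obtain y where "y \<in># B" "snd x \<le> snd y" using x in_split_cones[of x s B] by (auto simp: A'_def)
        moreover have "snd y \<le> u0" using \<open>y \<in># B\<close> max[of y] unfolding A by auto
        ultimately show ?thesis by simp
      qed (use max Cin in blast)
      then show ?thesis using x by simp
    qed
    have u0: "u0 \<ge> 1" using pos[OF top] by simp
    \<comment> \<open>The kept cone becomes the head of the list, where \<open>u0\<close> free
      variables give the entry \<open>u0 - 1\<close>. Splitting loses only generators in degree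
      \<open>s\<close>, hence \<open>t > s\<close>.\<close>
    have "\<forall>\<^sub>F t in sequentially. cones_sum A t = gotz s ((u0 - 1) # as) t"
      using as(3) eventually_gt_at_top[of s]
    proof eventually_elim
      case (elim t)
      have "cones_sum A t = cone_count u0 s t + cones_sum A' t"
        unfolding A'_def cones_sum_add
        using cones_sum_split_cones[of s t B] elim(2) B(1) by (subst A) (simp add: cones_sum_add, simp add: cones_sum_def)
      then show ?case using elim(1) u0 by simp
    qed
    moreover have "sorted_wrt (\<ge>) ((u0 - 1) # as)" using as(1) lt by fastforce
    moreover have "\<exists>x\<in>#A. a < snd x" if "a \<in> set ((u0 - 1) # as)" for a
      using that lt[of a] u0 top by (intro bexI[of _ "(s, u0)"]) auto
    ultimately show ?thesis by blast
  qed
qed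

theorem upset_complement_gotz:
  assumes "finite V" "upset V I"
  shows "\<exists>as. sorted_wrt (\<ge>) as \<and> (\<forall>\<^sub>F t in sequentially. card {m \<in> monomials V t. m \<notin> I} = gotz 0 as t)"
proof -
  obtain A where A: "\<And>t. card {m \<in> monomials V t. m \<notin> I} = cones_sum A t" "standard_cones 0 A"
    using standard_decomposition[OF assms] by blast
  \<comment> \<open>Cones without free variables are single monomials and count nothing in large
    degrees. Without them the family is still standard, since every witness has at least as many
    variables as the given cone.\<close>
  define B where "B = filter_mset (\<lambda>x. snd x \<ge> 1) A"
  have "standard_cones 0 B"
    unfolding standard_cones_def
  proof (clarify, intro conjI allI impI)
    fix e u d assume "(e, u) \<in># B" "0 \<le> d \<and> d \<le> e"
    then obtain u' where "u' \<ge> u" "(d, u') \<in># A" "u \<ge> 1" using standard_conesD(2)[OF A(2)] unfolding B_def by force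
    then show "\<exists>u'\<ge>u. (d, u') \<in># B" by (auto simp: B_def)
  qed simp
  then obtain as where as: "sorted_wrt (\<ge>) as" "\<forall>\<^sub>F t in sequentially. cones_sum B t = gotz 0 as t"
    using standard_cones_gotz[of 0 B] by (auto simp: B_def)
  have "\<forall>\<^sub>F t in sequentially. cones_sum A t = cones_sum B t"
  proof -
    have "\<forall>\<^sub>F t in sequentially. \<forall>x\<in>set_mset A. snd x = 0 \<longrightarrow> cone_count (snd x) (fst x) t = 0"
    proof (rule eventually_ball_finite)
      show "\<forall>x\<in>set_mset A. \<forall>\<^sub>F t in sequentially. snd x = 0 \<longrightarrow> cone_count (snd x) (fst x) t = 0"
      proof
        fix x :: "nat \<times> nat"
        show "\<forall>\<^sub>F t in sequentially. snd x = 0 \<longrightarrow> cone_count (snd x) (fst x) t = 0"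
          using eventually_gt_at_top[of "fst x"]
          by eventually_elim (simp add: cone_count_def mono_count_def)
      qed
    qed simp
    then show ?thesis
    proof eventually_elim
      case (elim t)
      then have "\<And>x. x \<in># filter_mset (\<lambda>x. \<not> snd x \<ge> 1) A \<Longrightarrow> cone_count (snd x) (fst x) t = 0"
        by (force simp: not_less_eq_eq)
      then have "cones_sum (filter_mset (\<lambda>x. \<not> snd x \<ge> 1) A) t = 0"
        unfolding cones_sum_def by (simp add: sum_mset_0_iff)
      then show ?case
        using cones_sum_add[of B "filter_mset (\<lambda>x. \<not> snd x \<ge> 1) A" t] unfolding B_def
        by (simp only: multiset_partition[symmetric] add_0_right)
    qed
  qed
  with as(2) have "\<forall>\<^sub>F t in sequentially. card {m \<in> monomials V t. m \<notin> I} = gotz 0 as t"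
    by eventually_elim (simp add: A(1))
  then show ?thesis using as(1) by blast
qed

section \<open>Finite-dimensional subspaces\<close>

context vector_space
begin

lemma finite_basis:
  assumes "V \<subseteq> span W" "finite W"
  obtains B where "B \<subseteq> V" "finite B" "independent B" "V \<subseteq> span B" "card B = dim V"
proof -
  obtain B where B: "B \<subseteq> V" "independent B" "V \<subseteq> span B" "card B = dim V" using basis_exists by blast
  moreover have "finite B" using independent_span_bound[OF assms(2) B(2)] B(1) assms(1) by blast
  ultimately show ?thesis using that by blast
qed

lemma dim_le_dim:
  assumes "V \<subseteq> U" "U \<subseteq> span W" "finite W"
  shows "dim V \<le> dim U"
proof -
  obtain B where B: "B \<subseteq> U" "finite B" "U \<subseteq> span B" "card B = dim U" using finite_basis[OF assms(2,3)] by metis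
  show ?thesis using dim_le_card[of V B] B assms(1) by auto
qed

lemma subspace_eq_if_dim_le:
  assumes "V \<subseteq> U" "U \<subseteq> span W" "finite W" "subspace V" "dim U \<le> dim V"
  shows "V = U"
proof (rule ccontr)
  assume "V \<noteq> U"
  then obtain x where x: "x \<in> U" "x \<notin> V" using assms(1) by blast
  have VW: "V \<subseteq> span W" using assms(1,2) by blast
  obtain B where B: "B \<subseteq> V" "finite B" "independent B" "V \<subseteq> span B" "card B = dim V"
    using finite_basis[OF VW assms(3)] by metis
  have "span B = V" using B(1,4) assms(4) span_minimal by blast
  then have "x \<notin> span B" using x by blast
  then have ind: "independent (insert x B)" using B(3) independent_insertI by blast
  have "x \<notin> B" using x B(1) by blast
  then have "card (insert x B) = Suc (dim V)" using B(2,5) by simp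
  moreover have "card (insert x B) = dim (insert x B)" using ind dim_eq_card_independent by simp
  moreover have "dim (insert x B) \<le> dim U" by (rule dim_le_dim[OF _ assms(2,3)]) (use x B(1) assms(1) in auto)
  ultimately show False using assms(5) by simp
qed

text \<open>Rank-nullity for the map from \<open>V\<close> to the quotient by \<open>U\<close>
  induced by \<open>\<phi>\<close>, phrased without the quotient space. With \<open>\<phi>\<close>
  multiplication by a form it yields the exact sequence for I + (f) and I : f.\<close>

lemma dim_sum_image:
  assumes "module_hom scale scale \<phi>"
    and U: "subspace U" "U \<subseteq> span W" "finite W"
    and V: "subspace V" "V \<subseteq> span W'" "finite W'"
  shows "dim {u + \<phi> v |u v. u \<in> U \<and> v \<in> V} + dim {v \<in> V. \<phi> v \<in> U} = dim U + dim V"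
proof -
  interpret \<phi>: module_hom scale scale \<phi> by fact
  define K where "K = {v \<in> V. \<phi> v \<in> U}"
  have KW: "K \<subseteq> span W'" using V(2) by (auto simp: K_def)
  obtain B where B: "B \<subseteq> K" "finite B" "independent B" "K \<subseteq> span B" "card B = dim K"
    using finite_basis[OF KW V(3)] by metis
  have "B \<subseteq> V" using B(1) by (auto simp: K_def)
  then obtain B' where B': "B \<subseteq> B'" "B' \<subseteq> V" "independent B'" "V \<subseteq> span B'"
    using maximal_independent_subset_extend[OF _ B(3)] by metis
  have finB': "finite B'" using independent_span_bound[OF V(3) B'(3)] B'(2) V(2) by blast
  obtain D where D: "D \<subseteq> U" "finite D" "independent D" "U \<subseteq> span D" "card D = dim U"
    using finite_basis[OF U(2,3)] by metis
  have spanD: "span D = U" using D(1,4) U(1) span_minimal by blast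
  \<comment> \<open>A dependence modulo \<open>U\<close> among images of basis vectors outside
    \<open>B\<close> would put a combination of them into the kernel \<open>K\<close>, which
    \<open>B\<close> spans.\<close>
  have "independent (D \<union> \<phi> ` C) \<and> card (D \<union> \<phi> ` C) = card D + card C"
    if "finite C" "C \<subseteq> B' - B" for C
    using that
  proof (induction C rule: finite_induct)
    case (insert c C)
    have "\<phi> c \<notin> span (D \<union> \<phi> ` C)"
    proof
      assume "\<phi> c \<in> span (D \<union> \<phi> ` C)"
      then obtain u w where u: "u \<in> span D" "w \<in> span (\<phi> ` C)" "\<phi> c = u + w"
        unfolding span_Un by blast
      then obtain v where v: "v \<in> span C" "w = \<phi> v" unfolding \<phi>.span_image by blast
      have "span C \<subseteq> V" using insert.prems B'(2) V(1) by (intro span_minimal) auto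
      then have "c - v \<in> V" using v insert.prems B'(2) V(1) by (intro subspace_diff) auto
      moreover have "\<phi> (c - v) \<in> U" using u v spanD by (simp add: \<phi>.diff)
      ultimately have "c - v \<in> span B" using B(4) by (auto simp: K_def)
      then have "c - v + v \<in> span (B \<union> C)"
        using v(1) span_mono[of B "B \<union> C"] span_mono[of C "B \<union> C"] by (intro span_add) auto
      then have "c \<in> span (B' - {c})"
        using span_mono[of "B \<union> C" "B' - {c}"] insert.prems insert.hyps B'(1) by auto
      then show False using B'(3) insert.prems unfolding dependent_def by auto
    qed
    moreover from this have "\<phi> c \<notin> D \<union> \<phi> ` C" by (metis span_base)
    ultimately show ?case using insert D(2) by (simp add: independent_insertI)
  qed (use D(3) in simp)
  from this[of "B' - B"] finB' have ind: "independent (D \<union> \<phi> ` (B' - B))"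
    "card (D \<union> \<phi> ` (B' - B)) = card D + card (B' - B)" by auto
  have "{u + \<phi> v |u v. u \<in> U \<and> v \<in> V} = span (D \<union> \<phi> ` (B' - B))"
  proof (intro equalityI subsetI)
    fix x assume "x \<in> {u + \<phi> v |u v. u \<in> U \<and> v \<in> V}"
    then obtain u v where x: "u \<in> U" "v \<in> V" "x = u + \<phi> v" by blast
    have "B \<union> (B' - B) = B'" using B'(1) by blast
    then have "v \<in> span (B \<union> (B' - B))" using x(2) B'(4) by auto
    then obtain a b where ab: "a \<in> span B" "b \<in> span (B' - B)" "v = a + b" unfolding span_Un by blast
    have "\<phi> a \<in> span (\<phi> ` B)" using ab(1) unfolding \<phi>.span_image by blast
    moreover have "\<phi> ` B \<subseteq> U" using B(1) by (auto simp: K_def)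
    ultimately have "\<phi> a \<in> U" using U(1) span_minimal by blast
    then have "u + \<phi> a \<in> span D" using x(1) U(1) spanD by (simp add: subspace_add)
    moreover have "\<phi> b \<in> span (\<phi> ` (B' - B))" using ab(2) unfolding \<phi>.span_image by blast
    ultimately have "(u + \<phi> a) + \<phi> b \<in> span (D \<union> \<phi> ` (B' - B))" unfolding span_Un by blast
    then show "x \<in> span (D \<union> \<phi> ` (B' - B))" using x(3) ab(3) by (simp add: \<phi>.add add.assoc)
  next
    fix x assume "x \<in> span (D \<union> \<phi> ` (B' - B))"
    then obtain u w where u: "u \<in> span D" "w \<in> span (\<phi> ` (B' - B))" "x = u + w" unfolding span_Un by blast
    then obtain v where v: "v \<in> span (B' - B)" "w = \<phi> v" unfolding \<phi>.span_image by blast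
    have "span (B' - B) \<subseteq> V" using B'(2) V(1) by (intro span_minimal) auto
    then show "x \<in> {u + \<phi> v |u v. u \<in> U \<and> v \<in> V}" using u v spanD by auto
  qed
  then have "dim {u + \<phi> v |u v. u \<in> U \<and> v \<in> V} = card D + card (B' - B)"
    using ind dim_span_eq_card_independent by simp
  moreover have "dim V = card B'" using basis_card_eq_dim[OF B'(2,4,3)] by simp
  moreover have "card (B' - B) + card B = card B'"
    using B'(1) finB' by (metis card_Diff_subset card_mono finite_subset le_add_diff_inverse2)
  ultimately show ?thesis using B(5) D(5) unfolding K_def by simp
qed

end

section \<open>Homogeneous polynomials\<close>

definition cmul :: "'k::field \<Rightarrow> ('v, 'k) mpoly \<Rightarrow> ('v, 'k) mpoly" where
  "cmul c p = const c * p"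

lemma lookup_cmul [simp]: "lookup (cmul c p) m = c * lookup p m"
proof -
  have "cmul c p = Poly_Mapping.map ((*) c) p"
    by (simp add: cmul_def const_def mult_map_scale_conv_mult)
  then show ?thesis by (simp add: Poly_Mapping.map.rep_eq when_def)
qed

interpretation mp: vector_space cmul
  by unfold_locales (auto intro!: poly_mapping_eqI simp: lookup_add algebra_simps)

lemma keys_cmul_subset: "keys (cmul c p) \<subseteq> keys p"
  by (auto simp: in_keys_iff)

lemma cmul_mult_left: "cmul c p * q = cmul c (p * q)"
  by (simp add: cmul_def mult.assoc)

lemma const_mult: "const c * p = cmul c p"
  by (simp add: cmul_def)

abbreviation polys :: "nat \<Rightarrow> (nat, 'k::field) mpoly set" where
  "polys n \<equiv> polys_in {..n}"

lemma polys_iff: "p \<in> polys n \<longleftrightarrow> (\<forall>m\<in>keys p. keys m \<subseteq> {..n})"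
  by (simp add: polys_in_def)

lemma carrier_poly_ring [simp]: "carrier (poly_ring n) = polys n"
  and mult_poly_ring [simp]: "p \<otimes>\<^bsub>poly_ring n\<^esub> q = p * q"
  and add_poly_ring [simp]: "p \<oplus>\<^bsub>poly_ring n\<^esub> q = p + q"
  and zero_poly_ring [simp]: "\<zero>\<^bsub>poly_ring n\<^esub> = 0"
  and one_poly_ring [simp]: "\<one>\<^bsub>poly_ring n\<^esub> = 1"
  by (simp_all add: poly_ring_def)

interpretation poly_ring: cring "poly_ring n"
  by (rule poly_ring_cring)

lemma polys_0 [simp]: "0 \<in> polys n"
  and polys_1 [simp]: "1 \<in> polys n"
  and polys_add: "p \<in> polys n \<Longrightarrow> q \<in> polys n \<Longrightarrow> p + q \<in> polys n"
  and polys_mult: "p \<in> polys n \<Longrightarrow> q \<in> polys n \<Longrightarrow> p * q \<in> polys n"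
  using poly_ring.zero_closed[of n] poly_ring.one_closed[of n] poly_ring.a_closed[of p n q] poly_ring.m_closed[of p n q]
  by simp_all

lemma polys_const [simp]: "const c \<in> polys n"
  by (auto simp: polys_iff const_def split: if_splits)

lemma polys_cmul: "p \<in> polys n \<Longrightarrow> cmul c p \<in> polys n"
  by (simp add: cmul_def polys_mult)

lemma polys_uminus: "p \<in> polys n \<Longrightarrow> - p \<in> polys n"
  by (simp add: polys_iff in_keys_iff)

lemma polys_diff: "p \<in> polys n \<Longrightarrow> q \<in> polys n \<Longrightarrow> p - q \<in> polys n"
  using polys_add[of p n "- q"] polys_uminus[of q n] by simp

lemma forms_iff: "p \<in> forms n t \<longleftrightarrow> keys p \<subseteq> monomials {..n} t"
  by (auto simp: forms_def polys_iff monomials_def)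

lemma forms_polys: "p \<in> forms n t \<Longrightarrow> p \<in> polys n"
  by (auto simp: forms_def)

lemma forms_0 [simp]: "0 \<in> forms n t"
  by (simp add: forms_iff)

lemma forms_add: "p \<in> forms n t \<Longrightarrow> q \<in> forms n t \<Longrightarrow> p + q \<in> forms n t"
  using Poly_Mapping.keys_add[of p q] by (auto simp: forms_iff)

lemma forms_cmul: "p \<in> forms n t \<Longrightarrow> cmul c p \<in> forms n t"
  using keys_cmul_subset[of c p] by (auto simp: forms_iff)

lemma subspace_forms: "mp.subspace (forms n t)"
  by (simp add: mp.subspace_def forms_add forms_cmul)

lemma forms_mult: "p \<in> forms n s \<Longrightarrow> q \<in> forms n t \<Longrightarrow> p * q \<in> forms n (s + t)"
  using keys_mult[of p q] by (fastforce simp: forms_iff monomials_def monom_degree_add keys_add_nat)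

lemma forms_single: "m \<in> monomials {..n} t \<Longrightarrow> single m c \<in> forms n t"
  by (simp add: forms_iff)

lemma const_forms: "const c \<in> forms n 0"
  by (simp add: const_def forms_single monomials_0)

lemma forms_degree_0: "p \<in> forms n 0 \<Longrightarrow> \<exists>c. p = const c"
  unfolding forms_iff monomials_0
  by (rule exI[of _ "lookup p 0"])
    (auto intro!: poly_mapping_eqI simp: const_def lookup_single when_def in_keys_iff)

lemma sum_singles: "p = (\<Sum>m\<in>keys p. single m (lookup p m))"
proof (rule poly_mapping_eqI)
  fix k
  show "lookup p k
      = lookup (\<Sum>m\<in>keys p. single m (lookup p m)) k"
    by (cases "k \<in> keys p") (auto simp: lookup_sum lookup_single when_def in_keys_iff)
qed

lemma single_eq_cmul: "single m c = cmul c (single m 1)"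
  by (auto intro!: poly_mapping_eqI simp: lookup_single when_def)

lemma forms_span: "forms n t = mp.span ((\<lambda>m. single m 1) ` monomials {..n} t)"
proof (intro equalityI subsetI)
  fix p assume p: "p \<in> forms n t"
  have "(\<Sum>m\<in>keys p. single m (lookup p m))
      \<in> mp.span ((\<lambda>m. single m 1) ` monomials {..n} t)"
    by (intro mp.span_sum, subst single_eq_cmul, intro mp.span_scale mp.span_base) (use p in \<open>auto simp: forms_iff\<close>)
  then show "p \<in> mp.span ((\<lambda>m. single m 1) ` monomials {..n} t)"
    using sum_singles[of p] by simp
next
  fix p :: "(nat, 'a) mpoly" assume p: "p \<in> mp.span ((\<lambda>m. single m 1) ` monomials {..n} t)"
  have "mp.span ((\<lambda>m. single m 1) ` monomials {..n} t) \<subseteq> (forms n t :: (nat, 'a) mpoly set)"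
    by (intro mp.span_minimal subspace_forms) (auto intro: forms_single)
  then show "p \<in> forms n t" using p by blast
qed

lemma finite_monomials_upto: "finite ((\<lambda>m. single m 1) ` monomials {..n::nat} t)"
  by (simp add: finite_monomials)

lemmas finite_dim_forms = equalityD1[OF forms_span] finite_monomials_upto

section \<open>Homogeneous components\<close>

definition hcomp :: "nat \<Rightarrow> ('v, 'k::zero) mpoly \<Rightarrow> ('v, 'k) mpoly" where
  "hcomp t p = Poly_Mapping.mapp (\<lambda>m c. c when monom_degree m = t) p"

lemma lookup_hcomp: "lookup (hcomp t p) m = (lookup p m when monom_degree m = t)"
  by (auto simp: hcomp_def lookup_mapp when_def in_keys_iff)

lemma keys_hcomp: "keys (hcomp t p) = {m \<in> keys p. monom_degree m = t}"
  by (auto simp: in_keys_iff lookup_hcomp)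

lemma hcomp_add: "hcomp t (p + q) = hcomp t p + hcomp t (q :: ('v, 'k::monoid_add) mpoly)"
  by (auto intro!: poly_mapping_eqI simp: lookup_hcomp lookup_add when_def)

lemma hcomp_eq_self: "(\<And>m. m \<in> keys p \<Longrightarrow> monom_degree m = t) \<Longrightarrow> hcomp t p = p"
  by (intro poly_mapping_eqI) (auto simp: lookup_hcomp in_keys_iff when_def)

lemma hcomp_eq_0: "(\<And>m. m \<in> keys p \<Longrightarrow> monom_degree m \<noteq> t) \<Longrightarrow> hcomp t p = 0"
  by (intro poly_mapping_eqI) (auto simp: lookup_hcomp in_keys_iff when_def)

lemma hcomp_0 [simp]: "hcomp t 0 = 0"
  by (rule hcomp_eq_0) simp

lemma hcomp_form: "p \<in> forms n s \<Longrightarrow> hcomp t p = (if t = s then p else 0)"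
  by (auto simp: forms_def intro!: hcomp_eq_self hcomp_eq_0)

lemma hcomp_forms: "p \<in> polys n \<Longrightarrow> hcomp t p \<in> forms n t"
  by (auto simp: forms_iff keys_hcomp monomials_def polys_iff)

lemma sum_hcomp: "p = (\<Sum>t\<in>monom_degree ` keys p. hcomp t p)"
proof (rule poly_mapping_eqI)
  fix k
  show "lookup p k
      = lookup (\<Sum>t\<in>monom_degree ` keys p. hcomp t p) k"
    by (cases "k \<in> keys p") (auto simp: lookup_sum lookup_hcomp when_def in_keys_iff)
qed

lemma hcomp_mult_form:
  fixes q :: "(nat, 'k::field) mpoly"
  assumes q: "q \<in> forms n s"
  shows "hcomp (s + t) (q * p) = q * hcomp t p"
proof -
  have "q * p = q * hcomp t p + q * (p - hcomp t p)" by (simp add: algebra_simps)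
  moreover have "hcomp (s + t) (q * hcomp t p) = q * hcomp t p"
  proof (rule hcomp_eq_self)
    fix m assume "m \<in> keys (q * hcomp t p)"
    then obtain a b where "m = a + b" "a \<in> keys q" "b \<in> keys (hcomp t p)"
      using keys_mult by blast
    then show "monom_degree m = s + t" using q by (auto simp: keys_hcomp forms_def monom_degree_add)
  qed
  moreover have "hcomp (s + t) (q * (p - hcomp t p)) = 0"
  proof (rule hcomp_eq_0)
    fix m assume "m \<in> keys (q * (p - hcomp t p))"
    then obtain a b where "m = a + b" "a \<in> keys q" "b \<in> keys (p - hcomp t p)"
      using keys_mult by blast
    then show "monom_degree m \<noteq> s + t" using q
      by (auto simp: in_keys_iff lookup_minus lookup_hcomp forms_def monom_degree_add when_def split: if_splits)
  qed
  ultimately show ?thesis by (simp add: hcomp_add)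
qed

lemma hcomp_mult_form_less:
  fixes q :: "(nat, 'k::field) mpoly"
  assumes q: "q \<in> forms n s" and "t < s"
  shows "hcomp t (q * p) = 0"
proof (rule hcomp_eq_0)
  fix m assume "m \<in> keys (q * p)"
  then obtain a b where "m = a + b" "a \<in> keys q" using keys_mult by blast
  then show "monom_degree m \<noteq> t" using assms by (auto simp: forms_def monom_degree_add)
qed

section \<open>Homogeneous ideals\<close>

text \<open>Homogeneous ideals, with homogeneity expressed by closure under homogeneous components
  instead of generation by forms.\<close>

definition hideal :: "nat \<Rightarrow> (nat, 'k::field) mpoly set \<Rightarrow> bool" where
  "hideal n I \<longleftrightarrow> I \<subseteq> polys n \<and> 0 \<in> I \<and> (\<forall>p\<in>I. \<forall>q\<in>I. p + q \<in> I) \<and>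
     (\<forall>p\<in>I. \<forall>q\<in>polys n. q * p \<in> I) \<and> (\<forall>p\<in>I. \<forall>t. hcomp t p \<in> I)"

lemma hidealD:
  assumes "hideal n I"
  shows hideal_polys: "p \<in> I \<Longrightarrow> p \<in> polys n"
    and hideal_0: "0 \<in> I"
    and hideal_add: "p \<in> I \<Longrightarrow> q \<in> I \<Longrightarrow> p + q \<in> I"
    and hideal_mult: "p \<in> I \<Longrightarrow> q \<in> polys n \<Longrightarrow> q * p \<in> I"
    and hideal_hcomp: "p \<in> I \<Longrightarrow> hcomp t p \<in> I"
  using assms by (auto simp: hideal_def)

lemma hideal_cmul: "hideal n I \<Longrightarrow> p \<in> I \<Longrightarrow> cmul c p \<in> I"
  by (simp add: cmul_def hideal_mult)

lemma hideal_mult': "hideal n I \<Longrightarrow> p \<in> I \<Longrightarrow> q \<in> polys n \<Longrightarrow> p * q \<in> I"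
  using hideal_mult by (simp add: mult.commute)

lemma hideal_uminus: "hideal n I \<Longrightarrow> p \<in> I \<Longrightarrow> - p \<in> I"
  using hideal_mult[of n I p "- 1"] polys_uminus[OF polys_1, of n] by simp

lemma hideal_diff: "hideal n I \<Longrightarrow> p \<in> I \<Longrightarrow> q \<in> I \<Longrightarrow> p - q \<in> I"
  using hideal_add[of n I p "- q"] hideal_uminus[of n I q] by simp

lemma hideal_sum: "hideal n I \<Longrightarrow> (\<And>i. i \<in> A \<Longrightarrow> f i \<in> I) \<Longrightarrow> sum f A \<in> I"
  by (induction A rule: infinite_finite_induct) (auto simp: hideal_0 hideal_add)

lemma hideal_mem_iff: "hideal n I \<Longrightarrow> p \<in> I \<longleftrightarrow> (\<forall>t. hcomp t p \<in> I)"
  using hideal_sum[of n I "monom_degree ` keys p" "\<lambda>t. hcomp t p"] sum_hcomp[of p] hideal_hcomp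
  by metis

lemma hideal_subset_iff:
  assumes "hideal n I" "hideal n J"
  shows "I \<subseteq> J \<longleftrightarrow> (\<forall>t. I \<inter> forms n t \<subseteq> J)"
proof (intro iffI allI subsetI)
  fix p assume *: "\<forall>t. I \<inter> forms n t \<subseteq> J" and p: "p \<in> I"
  have "hcomp t p \<in> J" for t
    using * hideal_hcomp[OF assms(1) p] hcomp_forms hideal_polys[OF assms(1) p] by blast
  then show "p \<in> J" using hideal_mem_iff[OF assms(2)] by blast
qed auto

lemma hidealI:
  assumes "I \<subseteq> polys n" "0 \<in> I" "\<And>p q. p \<in> I \<Longrightarrow> q \<in> I \<Longrightarrow> p + q \<in> I"
    "\<And>p q. p \<in> I \<Longrightarrow> q \<in> polys n \<Longrightarrow> q * p \<in> I" "\<And>p t. p \<in> I \<Longrightarrow> hcomp t p \<in> I"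
  shows "hideal n I"
  using assms by (auto simp: hideal_def)

text \<open>An ideal generated by forms is closed under components because the polynomials all of
  whose components lie in \<open>I\<close> form an ideal that contains the generating forms.\<close>

lemma homogeneous_ideal_iff:
  fixes I :: "(nat, 'k::field) mpoly set"
  shows "homogeneous_ideal n I \<longleftrightarrow> hideal n I"
proof
  assume I: "homogeneous_ideal n I"
  then have id: "ideal I (poly_ring n)" by (simp add: homogeneous_ideal_def)
  interpret I: ideal I "poly_ring n" by fact
  have sub: "I \<subseteq> polys n" using I.a_subset by simp
  have add: "p + q \<in> I" if "p \<in> I" "q \<in> I" for p q using I.a_closed[OF that] by simp
  have mult: "q * p \<in> I" if "p \<in> I" "q \<in> polys n" for p q using I.I_l_closed[OF that(1)] that(2) by simp
  define J where "J = {p \<in> polys n. \<forall>t. hcomp t p \<in> I}"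
  have zero: "0 \<in> I" using I.zero_closed by simp
  have idJ: "ideal J (poly_ring n)"
  proof (rule idealI)
    show "ring (poly_ring n)" by (rule poly_ring.ring_axioms)
    show "subgroup J (add_monoid (poly_ring n))"
    proof (rule poly_ring.add.subgroupI)
      show "J \<subseteq> carrier (poly_ring n)" by (auto simp: J_def)
      show "J \<noteq> {}" using zero by (auto simp: J_def intro!: exI[of _ 0])
      fix a assume a: "a \<in> J"
      have inv: "\<ominus>\<^bsub>poly_ring n\<^esub> a = - a"
        using a polys_uminus[of a n] by (intro poly_ring.minus_equality) (auto simp: J_def)
      have neg: "- p \<in> I" if "p \<in> I" for p
        using mult[OF that, of "- 1"] polys_uminus[OF polys_1, of n] by simp
      have "hcomp t (- a) = - hcomp t a" for t
        by (intro poly_mapping_eqI) (simp add: lookup_hcomp when_def)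
      then show "\<ominus>\<^bsub>poly_ring n\<^esub> a \<in> J"
        unfolding inv using a neg polys_uminus[of a n] by (auto simp: J_def)
      fix b assume b: "b \<in> J"
      show "a \<oplus>\<^bsub>poly_ring n\<^esub> b \<in> J"
        using a b add by (auto simp: J_def hcomp_add polys_add)
    qed
    fix a x :: "(nat, 'k) mpoly" assume a: "a \<in> J" and x: "x \<in> carrier (poly_ring n)"
    have "hcomp t (x * a) \<in> I" for t
    proof -
      have "x * a = (\<Sum>s\<in>monom_degree ` keys x. hcomp s x * a)"
        by (subst sum_hcomp[of x]) (simp add: sum_distrib_right)
      moreover have "hcomp t (\<Sum>s\<in>S. hcomp s x * a) \<in> I" if "finite S" for S
        using that
      proof (induction S rule: finite_induct)
        case (insert s S)
        have s: "hcomp s x \<in> forms n s" using x by (simp add: hcomp_forms)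
        have "hcomp t (hcomp s x * a) \<in> I"
        proof (cases "t < s")
          case False
          then show ?thesis using hcomp_mult_form[OF s, of "t - s" a] a mult forms_polys[OF s] by (simp add: J_def)
        qed (use hcomp_mult_form_less[OF s] zero in simp)
        then show ?case using insert by (simp add: hcomp_add add)
      qed (use zero in simp)
      ultimately show ?thesis by simp
    qed
    then show "x \<otimes>\<^bsub>poly_ring n\<^esub> a \<in> J" "a \<otimes>\<^bsub>poly_ring n\<^esub> x \<in> J"
      using a x by (auto simp: J_def polys_mult mult.commute)
  qed
  have "I \<inter> (\<Union>d. forms n d) \<subseteq> J"
    using zero by (auto simp: J_def hcomp_form forms_polys)
  then have "I \<subseteq> J" using poly_ring.genideal_minimal[OF idJ] I unfolding homogeneous_ideal_def by metis
  then show "hideal n I"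
    using sub zero add mult by (intro hidealI) (auto simp: J_def)
next
  assume I: "hideal n I"
  have id: "ideal I (poly_ring n)"
  proof (rule idealI)
    show "ring (poly_ring n)" by (rule poly_ring.ring_axioms)
    show "subgroup I (add_monoid (poly_ring n))"
    proof (rule poly_ring.add.subgroupI)
      fix a assume a: "a \<in> I"
      have "\<ominus>\<^bsub>poly_ring n\<^esub> a = - a"
        using a hideal_polys[OF I] polys_uminus[of a n] by (intro poly_ring.minus_equality) auto
      then show "\<ominus>\<^bsub>poly_ring n\<^esub> a \<in> I" using hideal_uminus[OF I a] by simp
      fix b assume b: "b \<in> I"
      show "a \<oplus>\<^bsub>poly_ring n\<^esub> b \<in> I" using hideal_add[OF I a b] by simp
    qed (use hideal_polys[OF I] hideal_0[OF I] in auto)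
  qed (use hideal_mult[OF I] hideal_mult'[OF I] in auto)
  have "I \<subseteq> Idl\<^bsub>poly_ring n\<^esub> (I \<inter> (\<Union>d. forms n d))"
  proof
    fix p assume p: "p \<in> I"
    have sub: "I \<inter> (\<Union>d. forms n d) \<subseteq> carrier (poly_ring n)" using hideal_polys[OF I] by auto
    interpret G: ideal "Idl\<^bsub>poly_ring n\<^esub> (I \<inter> (\<Union>d. forms n d))" "poly_ring n"
      by (rule poly_ring.genideal_ideal[OF sub])
    have mem: "hcomp t p \<in> Idl\<^bsub>poly_ring n\<^esub> (I \<inter> (\<Union>d. forms n d))" for t
      using poly_ring.genideal_self[OF sub] hideal_hcomp[OF I p] hcomp_forms hideal_polys[OF I p] by blast
    have "(\<Sum>t\<in>S. hcomp t p) \<in> Idl\<^bsub>poly_ring n\<^esub> (I \<inter> (\<Union>d. forms n d))" if "finite S" for S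
      using that
    proof (induction S rule: finite_induct)
      case empty
      then show ?case using G.zero_closed by simp
    next
      case (insert s S)
      then show ?case using G.a_closed[OF mem[of s]] by simp
    qed
    then show "p \<in> Idl\<^bsub>poly_ring n\<^esub> (I \<inter> (\<Union>d. forms n d))" by (subst sum_hcomp) simp
  qed
  moreover have "Idl\<^bsub>poly_ring n\<^esub> (I \<inter> (\<Union>d. forms n d)) \<subseteq> I"
    by (rule poly_ring.genideal_minimal[OF id]) auto
  ultimately show "homogeneous_ideal n I" using id by (auto simp: homogeneous_ideal_def)
qed

lemma hideal_ideal: "hideal n I \<Longrightarrow> ideal I (poly_ring n)"
  using homogeneous_ideal_iff homogeneous_ideal_def by blast

section \<open>Adjoining a form, colon ideals and Hilbert functions\<close>

definition adjoin :: "nat \<Rightarrow> (nat, 'k::field) mpoly set \<Rightarrow> (nat, 'k) mpoly \<Rightarrow> (nat, 'k) mpoly set" where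
  "adjoin n I f = {a + q * f |a q. a \<in> I \<and> q \<in> polys n}"

definition colon :: "nat \<Rightarrow> (nat, 'k::field) mpoly set \<Rightarrow> (nat, 'k) mpoly \<Rightarrow> (nat, 'k) mpoly set" where
  "colon n I f = {q \<in> polys n. q * f \<in> I}"

lemma adjoin_superset: "I \<subseteq> adjoin n I f"
proof
  fix p assume "p \<in> I"
  then have "\<exists>a q. p = a + q * f \<and> a \<in> I \<and> q \<in> polys n" by (intro exI[of _ p] exI[of _ 0]) simp
  then show "p \<in> adjoin n I f" by (simp add: adjoin_def)
qed

lemma adjoin_self: "hideal n I \<Longrightarrow> f \<in> adjoin n I f"
  unfolding adjoin_def by (rule CollectI, rule exI[of _ 0], rule exI[of _ 1]) (simp add: hideal_0)

lemma adjoin_minimal: "hideal n J \<Longrightarrow> I \<subseteq> J \<Longrightarrow> f \<in> J \<Longrightarrow> adjoin n I f \<subseteq> J"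
  by (auto simp: adjoin_def intro!: hideal_add hideal_mult)

lemma hideal_adjoin:
  fixes I :: "(nat, 'k::field) mpoly set"
  assumes "hideal n I" "f \<in> forms n e" shows "hideal n (adjoin n I f)"
proof (rule hidealI)
  show "adjoin n I f \<subseteq> polys n"
    using assms by (auto simp: adjoin_def intro!: polys_add polys_mult dest: forms_polys hideal_polys)
  show "0 \<in> adjoin n I f" using adjoin_superset hideal_0[OF assms(1)] by blast
next
  fix p q :: "(nat, 'k) mpoly" assume "p \<in> adjoin n I f" "q \<in> adjoin n I f"
  then obtain a b a' b' where "p = a + b * f" "q = a' + b' * f" "a \<in> I" "a' \<in> I" "b \<in> polys n" "b' \<in> polys n"
    by (auto simp: adjoin_def)
  then have "p + q = (a + a') + (b + b') * f \<and> a + a' \<in> I \<and> b + b' \<in> polys n"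
    using assms by (auto simp: algebra_simps intro: hideal_add polys_add)
  then show "p + q \<in> adjoin n I f" unfolding adjoin_def by blast
next
  fix p q :: "(nat, 'k) mpoly" assume p: "p \<in> adjoin n I f" and q: "q \<in> polys n"
  then obtain a b where "p = a + b * f" "a \<in> I" "b \<in> polys n" by (auto simp: adjoin_def)
  then have "q * p = q * a + (q * b) * f" "q * a \<in> I" "q * b \<in> polys n"
    using hideal_mult[OF assms(1) _ q] polys_mult[OF q] by (simp_all add: algebra_simps)
  then show "q * p \<in> adjoin n I f" unfolding adjoin_def by blast
next
  fix p t assume "p \<in> adjoin n I f"
  then obtain a b where p: "p = a + b * f" "a \<in> I" "b \<in> polys n" by (auto simp: adjoin_def)
  have "hcomp t p = hcomp t a + (if t < e then 0 else hcomp (t - e) b) * f"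
  proof (cases "t < e")
    case True
    then show ?thesis using hcomp_mult_form_less[OF assms(2), of t b] by (simp add: p(1) hcomp_add mult.commute)
  next
    case False
    then show ?thesis using hcomp_mult_form[OF assms(2), of "t - e" b] by (simp add: p(1) hcomp_add mult.commute)
  qed
  moreover have "hcomp t a \<in> I" using p(2) hideal_hcomp assms(1) by blast
  moreover have "(if t < e then 0 else hcomp (t - e) b) \<in> polys n"
    using p(3) hcomp_forms forms_polys by (metis polys_0)
  ultimately show "hcomp t p \<in> adjoin n I f" unfolding adjoin_def by blast
qed

lemma colon_superset: "hideal n I \<Longrightarrow> f \<in> polys n \<Longrightarrow> I \<subseteq> colon n I f"
  by (auto simp: colon_def dest: hideal_polys intro: hideal_mult')

lemma hideal_colon:
  assumes "hideal n I" "f \<in> forms n e" shows "hideal n (colon n I f)"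
proof (rule hidealI)
  fix p t assume p: "p \<in> colon n I f"
  then have "hcomp t p * f = hcomp (e + t) (p * f)"
    using hcomp_mult_form[OF assms(2), of t p] by (simp add: mult.commute)
  also have "\<dots> \<in> I" using p assms(1) by (auto simp: colon_def intro: hideal_hcomp)
  finally show "hcomp t p \<in> colon n I f"
    using p hcomp_forms[of p n t] forms_polys[of "hcomp t p" n t] by (auto simp: colon_def)
qed (use assms in \<open>auto simp: colon_def distrib_right mult.assoc hideal_0 intro: hideal_add hideal_mult polys_add polys_mult\<close>)

text \<open>The Hilbert function measured inside the vector space of forms;
  \<open>hilbert_function_eq\<close> links it to the quotient ring.\<close>

definition hilb :: "nat \<Rightarrow> (nat, 'k::field) mpoly set \<Rightarrow> nat \<Rightarrow> nat" where
  "hilb n I t = mp.dim (forms n t :: (nat, 'k) mpoly set) - mp.dim (I \<inter> forms n t)"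

lemma subspace_graded: "hideal n I \<Longrightarrow> mp.subspace (I \<inter> forms n t)"
  by (intro mp.subspaceI) (auto simp: hideal_0 forms_add forms_cmul hideal_add hideal_cmul)

lemma dim_graded_le: "V \<subseteq> U \<Longrightarrow> U \<subseteq> forms n t \<Longrightarrow> mp.dim V \<le> mp.dim U"
  by (rule mp.dim_le_dim[OF _ _ finite_dim_forms(2)[of n t]]) (auto simp: forms_span)

lemma hilb_dim:
  fixes I :: "(nat, 'k::field) mpoly set"
  shows "hilb n I t + mp.dim (I \<inter> forms n t) = mp.dim (forms n t :: (nat, 'k) mpoly set)"
  using dim_graded_le[of "I \<inter> forms n t" "forms n t" n t] by (simp add: hilb_def)

lemma hilb_antimono: "I \<subseteq> J \<Longrightarrow> hilb n J t \<le> hilb n I t"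
  unfolding hilb_def by (intro diff_le_mono2 dim_graded_le[where n = n and t = t]) auto

lemma hilb_eq_imp_subset:
  assumes "hideal n I" "hideal n J" "I \<subseteq> J" "hilb n I t \<le> hilb n J t"
  shows "J \<inter> forms n t \<subseteq> I"
proof -
  have "mp.dim (J \<inter> forms n t) \<le> mp.dim (I \<inter> forms n t)"
    using assms(4) hilb_dim[of n I t] hilb_dim[of n J t] by linarith
  then have "I \<inter> forms n t = J \<inter> forms n t"
    using assms(3)
      mp.subspace_eq_if_dim_le[OF _ _ _ subspace_graded[OF assms(1)], where U = "J \<inter> forms n t" and t1 = t
        and W = "(\<lambda>m. single m 1) ` monomials {..n} t"]
    by (auto simp: forms_span[symmetric] finite_monomials)
  then show ?thesis by blast
qed

lemma hideal_eq_if_hilb_le: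
  assumes "hideal n I" "hideal n J" "I \<subseteq> J" "\<And>t. hilb n I t \<le> hilb n J t"
  shows "I = J"
  using hideal_subset_iff[OF assms(2,1)] hilb_eq_imp_subset[OF assms(1-3)] assms(3,4) by blast

lemma module_hom_mult: "module_hom cmul cmul (\<lambda>q. q * f)"
  by unfold_locales (simp_all add: distrib_right cmul_mult_left)

lemma adjoin_graded:
  assumes I: "hideal n I" and f: "f \<in> forms n e" and p: "p \<in> adjoin n I f" "p \<in> forms n t" and "e \<le> t"
  obtains a b where "a \<in> I" "b \<in> forms n (t - e)" "p = a + b * f" "a \<in> forms n t"
proof -
  obtain a b where ab: "p = a + b * f" "a \<in> I" "b \<in> polys n" using p(1) by (auto simp: adjoin_def)
  have "p = hcomp t p" using hcomp_form[OF p(2), of t] by simp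
  also have "\<dots> = hcomp t a + hcomp (t - e) b * f"
    using hcomp_mult_form[OF f, of "t - e" b] \<open>e \<le> t\<close> by (simp add: ab(1) hcomp_add mult.commute)
  finally show thesis
    using that hideal_hcomp[OF I ab(2)] hcomp_forms[OF ab(3)] hcomp_forms[OF hideal_polys[OF I ab(2)]] by blast
qed

text \<open>The exact sequence \<open>0 \<rightarrow> R/(I : f)(-e) \<rightarrow> R/I \<rightarrow> R/(I + f) \<rightarrow> 0\<close>.\<close>

lemma hilb_exact:
  assumes I: "hideal n I" and f: "f \<in> forms n e" and "e \<le> t"
  shows "hilb n I t = hilb n (adjoin n I f) t + hilb n (colon n I f) (t - e)"
proof -
  have eq1: "adjoin n I f \<inter> forms n t = {u + q * f |u q. u \<in> I \<inter> forms n t \<and> q \<in> forms n (t - e)}"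
  proof (intro equalityI subsetI)
    fix p assume p: "p \<in> adjoin n I f \<inter> forms n t"
    then show "p \<in> {u + q * f |u q. u \<in> I \<inter> forms n t \<and> q \<in> forms n (t - e)}"
      using adjoin_graded[OF I f _ _ \<open>e \<le> t\<close>, of p] by blast
  next
    fix p assume "p \<in> {u + q * f |u q. u \<in> I \<inter> forms n t \<and> q \<in> forms n (t - e)}"
    then obtain u q where uq: "p = u + q * f" "u \<in> I" "u \<in> forms n t" "q \<in> forms n (t - e)" by blast
    then have "p \<in> forms n t" using forms_mult[OF uq(4) f] \<open>e \<le> t\<close> by (simp add: forms_add)
    moreover have "p \<in> adjoin n I f" using uq forms_polys unfolding adjoin_def by blast
    ultimately show "p \<in> adjoin n I f \<inter> forms n t" by blast
  qed
  have eq2: "colon n I f \<inter> forms n (t - e) = {q \<in> forms n (t - e). q * f \<in> I \<inter> forms n t}"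
    using forms_mult[OF _ f, of _ "t - e"] \<open>e \<le> t\<close> by (auto simp: colon_def dest: forms_polys)
  have "mp.dim (adjoin n I f \<inter> forms n t) + mp.dim (colon n I f \<inter> forms n (t - e))
      = mp.dim (I \<inter> forms n t) + mp.dim (forms n (t - e) :: (nat, 'a) mpoly set)"
    unfolding eq1 eq2
    by (rule mp.dim_sum_image[OF module_hom_mult subspace_graded[OF I] _ finite_dim_forms(2)
          subspace_forms finite_dim_forms]) (use forms_span in blast)
  then show ?thesis
    using hilb_dim[of n I t] hilb_dim[of n "adjoin n I f" t] hilb_dim[of n "colon n I f" "t - e"] by simp
qed

lemma hilb_adjoin_less:
  assumes I: "hideal n I" and f: "f \<in> forms n e" and "t < e"
  shows "hilb n (adjoin n I f) t = hilb n I t"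
proof -
  have "adjoin n I f \<inter> forms n t \<subseteq> I"
  proof
    fix p assume p: "p \<in> adjoin n I f \<inter> forms n t"
    then obtain a b where ab: "p = a + b * f" "a \<in> I" by (auto simp: adjoin_def)
    have "p = hcomp t p" using p hcomp_form[of p n t t] by simp
    also have "\<dots> = hcomp t a"
      using hcomp_mult_form_less[OF f \<open>t < e\<close>, of b] by (simp add: ab(1) hcomp_add mult.commute)
    finally show "p \<in> I" using hideal_hcomp[OF I ab(2)] by simp
  qed
  then have "adjoin n I f \<inter> forms n t = I \<inter> forms n t" using adjoin_superset by blast
  then show ?thesis by (simp add: hilb_def)
qed

section \<open>Leading monomials\<close>

text \<open>The maximum refers to the linear order of the type
  \<open>nat \<Rightarrow>\<^sub>0 nat\<close>, which is compatible with addition.\<close>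

definition lead :: "(nat, 'k::field) mpoly \<Rightarrow> nat \<Rightarrow>\<^sub>0 nat" where
  "lead p = Max (keys p)"

lemma lead_in_keys: "p \<noteq> 0 \<Longrightarrow> lead p \<in> keys p"
  unfolding lead_def by (intro Max_in) auto

lemma lead_max: "m \<in> keys p \<Longrightarrow> m \<le> lead p"
  unfolding lead_def by (intro Max_ge) auto

lemma lookup_lead: "p \<noteq> 0 \<Longrightarrow> lookup p (lead p) \<noteq> 0"
  using lead_in_keys by (simp add: in_keys_iff)

lemma lookup_single_mult: "lookup (single a 1 * p) (a + m) = lookup p (m :: nat \<Rightarrow>\<^sub>0 nat)"
  for p :: "(nat, 'k::field) mpoly"
proof -
  have "lookup (single a 1 * p) (a + m)
      = (\<Sum>l. (1 when a = l) * (\<Sum>q. lookup p q when a + m = l + q))"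
    by (simp add: lookup_mult lookup_single)
  also have "\<dots> = (\<Sum>l. (\<Sum>q. lookup p q when a + m = l + q) when a = l)"
    by (simp add: when_mult)
  also have "\<dots> = (\<Sum>q. lookup p q when m = q)" by simp
  finally show ?thesis by simp
qed

lemma lead_single_mult:
  assumes "p \<noteq> 0"
  shows "lead (single a 1 * p) = a + lead p" "single a 1 * p \<noteq> 0"
proof -
  have *: "a + lead p \<in> keys (single a 1 * p)"
    using lookup_lead[OF assms] by (simp add: in_keys_iff lookup_single_mult)
  then show "single a 1 * p \<noteq> 0" by auto
  show "lead (single a 1 * p) = a + lead p"
    unfolding lead_def
  proof (rule Max_eqI)
    fix m assume "m \<in> keys (single a 1 * p)"
    then obtain b where "m = a + b" "b \<in> keys p"
      using keys_mult[of "single a 1" p] by auto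
    then show "m \<le> a + Max (keys p)" using lead_max[of b p] by (simp add: lead_def add_left_mono)
  qed (use * in \<open>simp_all add: lead_def\<close>)
qed

text \<open>Choose one element of \<open>V\<close> for each leading monomial: distinct leading
  monomials make the choice independent, and subtracting multiples reduces any element of
  \<open>V\<close> to 0.\<close>

lemma dim_eq_card_lead:
  fixes V :: "(nat, 'k::field) mpoly set"
  assumes V: "mp.subspace V" "V \<subseteq> forms n t"
  shows "mp.dim V = card (lead ` (V - {0}))"
proof -
  define M where "M = lead ` (V - {0})"
  have fin: "finite M"
  proof (rule finite_subset)
    show "M \<subseteq> monomials {..n} t" using V(2) lead_in_keys by (fastforce simp: M_def forms_iff)
  qed (simp add: finite_monomials)
  have "\<forall>m\<in>M. \<exists>p. p \<in> V \<and> p \<noteq> 0 \<and> lead p = m" by (auto simp: M_def)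
  then obtain P where P: "\<And>m. m \<in> M \<Longrightarrow> P m \<in> V" "\<And>m. m \<in> M \<Longrightarrow> P m \<noteq> 0" "\<And>m. m \<in> M \<Longrightarrow> lead (P m) = m"
    by metis
  have inj: "inj_on P M" using P(3) by (metis inj_onI)
  have ind: "mp.independent (P ` M)"
    using fin P
  proof (induction M rule: finite_linorder_max_induct)
    case (insert b A)
    have "mp.subspace {v. lookup v b = 0}" by (auto simp: mp.subspace_def lookup_add)
    moreover have "lookup (P a) b = 0" if "a \<in> A" for a
    proof -
      have "a < b" using insert.hyps that by blast
      then have "b \<notin> keys (P a)" using lead_max[of b "P a"] insert.prems(3)[of a] that by auto
      then show ?thesis by (simp add: in_keys_iff)
    qed
    ultimately have "mp.span (P ` A) \<subseteq> {v. lookup v b = 0}" by (intro mp.span_minimal) auto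
    moreover have "lookup (P b) b \<noteq> 0"
      using lookup_lead[OF insert.prems(2)[of b]] insert.prems(3)[of b] by simp
    ultimately have "P b \<notin> mp.span (P ` A)" by blast
    moreover have "mp.independent (P ` A)" using insert by simp
    ultimately show ?case by (simp add: mp.independent_insertI)
  qed (simp add: mp.independent_empty)
  have "v \<in> mp.span (P ` M)" if "v \<in> V" for v
    using that
  \<comment> \<open>\<open>M\<close> is finite, so the number of leading monomials still available
    decreases along the reduction.\<close>
  proof (induction "card {m \<in> M. v \<noteq> 0 \<and> m \<le> lead v}" arbitrary: v rule: less_induct)
    case less
    show ?case
    proof (cases "v = 0")
      case True
      then show ?thesis by (simp add: mp.span_zero)
    next
      case False
      define m where "m = lead v"
      have m: "m \<in> M" using False less.prems by (auto simp: M_def m_def)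
      define c where "c = lookup v m / lookup (P m) m"
      define w where "w = v - cmul c (P m)"
      have nz: "lookup (P m) m \<noteq> 0" using lookup_lead[OF P(2)[OF m]] P(3)[OF m] by simp
      have wV: "w \<in> V" unfolding w_def by (rule mp.subspace_diff[OF V(1) less.prems mp.subspace_scale[OF V(1) P(1)[OF m]]])
      have wm: "lookup w m = 0" using nz by (simp add: w_def c_def lookup_minus)
      have "{m' \<in> M. w \<noteq> 0 \<and> m' \<le> lead w} \<subset> {m' \<in> M. v \<noteq> 0 \<and> m' \<le> lead v}"
      proof (cases "w = 0")
        case True
        then show ?thesis using m False by (auto simp: m_def)
      next
        case wnz: False
        have "lead w \<in> keys v \<union> keys (P m)"
          using lead_in_keys[OF wnz] keys_cmul_subset[of c "P m"]
          by (auto simp: w_def in_keys_iff lookup_minus)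
        then have "lead w \<le> m" using lead_max[of "lead w" v] lead_max[of "lead w" "P m"] P(3)[OF m] by (auto simp: m_def)
        moreover have "lead w \<noteq> m" using lead_in_keys[OF wnz] wm by (auto simp: in_keys_iff)
        ultimately have "lead w < lead v" by (simp add: m_def)
        then show ?thesis using m False wnz unfolding m_def by force
      qed
      then have "w \<in> mp.span (P ` M)" using less.hyps[of w] wV fin by (simp add: psubset_card_mono)
      moreover have "cmul c (P m) \<in> mp.span (P ` M)" using m by (intro mp.span_scale mp.span_base) simp
      ultimately have "w + cmul c (P m) \<in> mp.span (P ` M)" by (rule mp.span_add)
      then show ?thesis by (simp add: w_def)
    qed
  qed
  then have "V \<subseteq> mp.span (P ` M)" by blast
  moreover have "P ` M \<subseteq> V" using P(1) by blast
  ultimately have "mp.dim V = card (P ` M)" using mp.basis_card_eq_dim[of "P ` M" V] ind by simp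
  then show ?thesis using card_image[OF inj] by (simp add: M_def)
qed

definition initial_monomials :: "nat \<Rightarrow> (nat, 'k::field) mpoly set \<Rightarrow> (nat \<Rightarrow>\<^sub>0 nat) set" where
  "initial_monomials n I = (\<Union>t. lead ` (I \<inter> forms n t - {0}))"

lemma initial_monomials_degree:
  "initial_monomials n I \<inter> monomials {..n} t = lead ` (I \<inter> forms n t - {0})"
proof (intro equalityI subsetI)
  fix m assume m: "m \<in> initial_monomials n I \<inter> monomials {..n} t"
  then obtain s p where p: "p \<in> I" "p \<in> forms n s" "p \<noteq> 0" "m = lead p" by (auto simp: initial_monomials_def)
  have "m \<in> monomials {..n} s" using lead_in_keys[OF p(3)] p by (auto simp: forms_iff)
  then have "s = t" using m by (auto simp: monomials_def)
  then show "m \<in> lead ` (I \<inter> forms n t - {0})" using p by blast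
next
  fix m assume "m \<in> lead ` (I \<inter> forms n t - {0})"
  then obtain p where p: "p \<in> I" "p \<in> forms n t" "p \<noteq> 0" "m = lead p" by blast
  then have "m \<in> initial_monomials n I" unfolding initial_monomials_def by blast
  then show "m \<in> initial_monomials n I \<inter> monomials {..n} t"
    using lead_in_keys[OF p(3)] p by (auto simp: forms_iff)
qed

lemma upset_initial_monomials:
  assumes "hideal n I" shows "upset {..n} (initial_monomials n I)"
  unfolding upset_def
proof (intro conjI ballI allI impI)
  fix m assume "m \<in> initial_monomials n I"
  then obtain s p where p: "p \<in> I" "p \<in> forms n s" "p \<noteq> 0" "m = lead p" by (auto simp: initial_monomials_def)
  show "keys m \<subseteq> {..n}" using lead_in_keys[OF p(3)] p by (auto simp: forms_iff monomials_def)
next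
  fix m assume "m \<in> initial_monomials n I"
  then obtain s p where p: "p \<in> I" "p \<in> forms n s" "p \<noteq> 0" "m = lead p" by (auto simp: initial_monomials_def)
  fix m' :: "nat \<Rightarrow>\<^sub>0 nat" assume m': "keys m' \<subseteq> {..n}"
  let ?q = "single m' 1 * p"
  have "single m' (1::'a) \<in> forms n (monom_degree m')" using m' by (simp add: forms_single monomials_def)
  then have "?q \<in> forms n (monom_degree m' + s)" "?q \<in> I"
    using forms_mult p hideal_mult[OF assms] forms_polys by blast+
  moreover have "lead ?q = m + m'" "?q \<noteq> 0" using lead_single_mult[OF p(3), of m'] p(4) by (simp_all add: add.commute)
  ultimately have "m + m' \<in> lead ` (I \<inter> forms n (monom_degree m' + s) - {0})" by (metis DiffI IntI image_eqI singletonD)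
  then show "m + m' \<in> initial_monomials n I" unfolding initial_monomials_def by blast
qed

lemma dim_forms: "mp.dim (forms n t :: (nat, 'k::field) mpoly set) = card (monomials {..n} t)"
proof -
  have "lead ` (forms n t - {0} :: (nat, 'k) mpoly set) = monomials {..n} t"
  proof (intro equalityI subsetI)
    fix m assume "m \<in> lead ` (forms n t - {0} :: (nat, 'k) mpoly set)"
    then show "m \<in> monomials {..n} t" using lead_in_keys by (fastforce simp: forms_iff)
  next
    fix m assume "m \<in> monomials {..n} t"
    then have "single m (1::'k) \<in> forms n t - {0}"
      using forms_single by (auto simp: poly_mapping_eq_iff fun_eq_iff lookup_single when_def)
    moreover have "lead (single m (1::'k)) = m" by (simp add: lead_def)
    ultimately show "m \<in> lead ` (forms n t - {0} :: (nat, 'k) mpoly set)" by (metis imageI)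
  qed
  then show ?thesis using dim_eq_card_lead[OF subspace_forms order_refl] by metis
qed

lemma hilb_eq_card:
  assumes "hideal n I"
  shows "hilb n I t = card {m \<in> monomials {..n} t. m \<notin> initial_monomials n I}"
proof -
  have "mp.dim (I \<inter> forms n t) = card (initial_monomials n I \<inter> monomials {..n} t)"
    using dim_eq_card_lead[OF subspace_graded[OF assms] Int_lower2, of t] by (simp add: initial_monomials_degree)
  moreover have "{m \<in> monomials {..n} t. m \<notin> initial_monomials n I}
      = monomials {..n} t - (initial_monomials n I \<inter> monomials {..n} t)" by blast
  ultimately show ?thesis
    using finite_monomials[of "{..n}" t] by (simp add: hilb_def dim_forms card_Diff_subset)
qed

section \<open>Gotzmann list and dimension of a homogeneous ideal\<close>

definition gotz_list :: "nat \<Rightarrow> (nat, 'k::field) mpoly set \<Rightarrow> nat list \<Rightarrow> bool" where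
  "gotz_list n I as \<longleftrightarrow> sorted_wrt (\<ge>) as \<and> (\<forall>\<^sub>F t in sequentially. hilb n I t = gotz 0 as t)"

lemma gotz_list_exists:
  assumes "hideal n I" shows "\<exists>as. gotz_list n I as"
  using upset_complement_gotz[OF _ upset_initial_monomials[OF assms]] hilb_eq_card[OF assms]
  by (simp add: gotz_list_def)

text \<open>The ascending chain condition is inherited from monomial ideals: strict inclusion
  survives the passage to initial ideals, since equal initial ideals mean equal Hilbert
  functions.\<close>

theorem wf_hideal: "wf {(J, I). hideal n I \<and> hideal n J \<and> I \<subset> (J :: (nat, 'k::field) mpoly set)}"
proof (rule wf_subset)
  show "wf (inv_image {(J, I). upset {..n} I \<and> upset {..n} J \<and> I \<subset> J} (initial_monomials n :: (nat, 'k) mpoly set \<Rightarrow> _))"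
    by (intro wf_inv_image wf_upset) simp
  show "{(J, I). hideal n I \<and> hideal n J \<and> I \<subset> (J :: (nat, 'k) mpoly set)}
      \<subseteq> inv_image {(J, I). upset {..n} I \<and> upset {..n} J \<and> I \<subset> J} (initial_monomials n)"
  proof (rule subrelI)
    fix J I :: "(nat, 'k) mpoly set" assume "(J, I) \<in> {(J, I). hideal n I \<and> hideal n J \<and> I \<subset> J}"
    then have IJ: "hideal n I" "hideal n J" "I \<subset> J" by auto
    have "initial_monomials n I \<subseteq> initial_monomials n J" using IJ(3) unfolding initial_monomials_def by blast
    moreover have "initial_monomials n I \<noteq> initial_monomials n J"
    proof
      assume "initial_monomials n I = initial_monomials n J"
      then have "hilb n I t \<le> hilb n J t" for t using hilb_eq_card[OF IJ(1), of t] hilb_eq_card[OF IJ(2), of t] by simp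
      then show False using hideal_eq_if_hilb_le IJ by blast
    qed
    ultimately show "(J, I) \<in> inv_image {(J, I). upset {..n} I \<and> upset {..n} J \<and> I \<subset> J} (initial_monomials n)"
      using upset_initial_monomials IJ by (auto simp: in_inv_image)
  qed
qed

lemma gotz_list_sorted: "gotz_list n I as \<Longrightarrow> sorted_wrt (\<ge>) as"
  by (simp add: gotz_list_def)

lemma gotz_list_grows: "gotz_list n I as \<Longrightarrow> grows (hilb n I) s \<longleftrightarrow> gotz_dim as \<le> s"
proof
  assume I: "gotz_list n I as" and "grows (hilb n I) s"
  then have "grows (gotz 0 as) s"
    unfolding gotz_list_def by (intro grows_mono[of "gotz 0 as" "hilb n I"]) (auto elim: eventually_mono)
  then show "gotz_dim as \<le> s" by (rule gotz_dim_le_if_grows)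
next
  assume I: "gotz_list n I as" and "gotz_dim as \<le> s"
  then have "grows (gotz 0 as) s" using grows_gotz_dim grows_mono_exponent gotz_list_sorted by blast
  then show "grows (hilb n I) s"
    using I unfolding gotz_list_def by (intro grows_mono[of "hilb n I" "gotz 0 as"]) (auto elim: eventually_mono)
qed

text \<open>Binomial expansions decide between non-empty lists only; the empty list is told apart by
  its growth.\<close>

lemma gotz_list_unique:
  assumes "gotz_list n I as" "gotz_list n I bs" shows "as = bs"
proof -
  have dim: "gotz_dim as = gotz_dim bs"
    using gotz_list_grows[OF assms(1)] gotz_list_grows[OF assms(2)] by (metis antisym order_refl)
  show ?thesis
  proof (cases "as = []")
    case False
    moreover from this have "bs \<noteq> []" using dim by (auto simp: gotz_dim_def split: if_splits)
    moreover have "\<forall>\<^sub>F t in sequentially. gotz 0 as t = gotz 0 bs t"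
      using assms unfolding gotz_list_def by (auto elim: eventually_elim2)
    ultimately show ?thesis using gotz_inject gotz_list_sorted assms by blast
  qed (use dim in \<open>auto simp: gotz_dim_def split: if_splits\<close>)
qed

definition hlist :: "nat \<Rightarrow> (nat, 'k::field) mpoly set \<Rightarrow> nat list" where
  "hlist n I = (THE as. gotz_list n I as)"

lemma hlist_eqI: "gotz_list n I as \<Longrightarrow> hlist n I = as"
  unfolding hlist_def using gotz_list_unique by blast

lemma gotz_list_hlist: "hideal n I \<Longrightarrow> gotz_list n I (hlist n I)"
  using gotz_list_exists hlist_eqI by metis

definition hdim :: "nat \<Rightarrow> (nat, 'k::field) mpoly set \<Rightarrow> nat" where
  "hdim n I = gotz_dim (hlist n I)"

text \<open>Reads the dimension as an order of growth, so that dimensions are compared through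
  Hilbert functions.\<close>

lemma hdim_le_iff: "hideal n I \<Longrightarrow> hdim n I \<le> s \<longleftrightarrow> grows (hilb n I) s"
  unfolding hdim_def by (rule gotz_list_grows[OF gotz_list_hlist, symmetric])

lemma hdim_antimono: "hideal n I \<Longrightarrow> hideal n J \<Longrightarrow> I \<subseteq> J \<Longrightarrow> hdim n J \<le> hdim n I"
  using hdim_le_iff[of n J "hdim n I"] hdim_le_iff[of n I "hdim n I"] hilb_antimono[of I J n]
    grows_mono[of "hilb n J" "hilb n I" "hdim n I"] by auto

lemma hdim_le_max:
  assumes I: "hideal n I" and f: "f \<in> forms n e"
  shows "hdim n I \<le> max (hdim n (adjoin n I f)) (hdim n (colon n I f))" (is "_ \<le> ?s")
proof -
  have "grows (hilb n (adjoin n I f)) ?s" "grows (hilb n (colon n I f)) ?s"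
    using hdim_le_iff[OF hideal_adjoin[OF I f]] hdim_le_iff[OF hideal_colon[OF I f]] by (metis max.cobounded1 max.cobounded2)+
  then have gr: "grows (\<lambda>t. hilb n (adjoin n I f) t + hilb n (colon n I f) (t - e)) ?s"
    by (intro grows_add grows_shift')
  have "\<forall>\<^sub>F t in sequentially. hilb n I t \<le> hilb n (adjoin n I f) t + hilb n (colon n I f) (t - e)"
    using eventually_ge_at_top[of e] by eventually_elim (simp add: hilb_exact[OF I f])
  from grows_mono[OF this gr] show ?thesis by (simp add: hdim_le_iff[OF I])
qed

lemma hilb_eq_0_iff:
  assumes "hideal n I" shows "hilb n I t = 0 \<longleftrightarrow> forms n t \<subseteq> I"
proof
  assume "hilb n I t = 0"
  then have "mp.dim (forms n t :: (nat, 'a) mpoly set) \<le> mp.dim (I \<inter> forms n t)" by (simp add: hilb_def)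
  then have "I \<inter> forms n t = forms n t"
    using mp.subspace_eq_if_dim_le[OF Int_lower2 finite_dim_forms subspace_graded[OF assms]] by blast
  then show "forms n t \<subseteq> I" by blast
next
  assume "forms n t \<subseteq> I"
  then show "hilb n I t = 0" by (simp add: hilb_def Int_absorb1)
qed

lemma hideal_polys_self: "hideal n (polys n)"
  by (rule hidealI) (auto intro: polys_add polys_mult forms_polys hcomp_forms)

lemma hideal_eq_polys_iff: "hideal n I \<Longrightarrow> I = polys n \<longleftrightarrow> 1 \<in> I"
  using hideal_mult[of n I 1] hideal_polys by fastforce

lemma hideal_zero: "hideal n {0}"
  by (rule hidealI) auto

lemma monomials_split:
  assumes "m \<in> monomials V (N + k)"
  shows "\<exists>a\<in>monomials V N. \<exists>b\<in>monomials V k. m = a + b"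
  using assms
proof (induction k arbitrary: m)
  case 0
  then show ?case by (intro bexI[of _ m] bexI[of _ 0]) (auto simp: monomials_0)
next
  case (Suc k)
  then have "m \<noteq> 0" by (auto simp: monomials_def)
  then obtain v where v: "v \<in> keys m" by (auto simp: poly_mapping_eq_iff in_keys_iff fun_eq_iff)
  define m' where "m' = m - single v 1"
  have m: "m = m' + single v 1" unfolding m'_def using monomial_factor[OF v] by simp
  then have "m' \<in> monomials V (N + k)" "v \<in> V"
    using Suc.prems by (auto simp: monomials_def monom_degree_add keys_add_nat)
  then obtain a b where ab: "a \<in> monomials V N" "b \<in> monomials V k" "m' = a + b" using Suc.IH by blast
  then have "b + single v 1 \<in> monomials V (Suc k)"
    using \<open>v \<in> V\<close> by (auto simp: monomials_def monom_degree_add keys_add_nat)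
  moreover have "m = a + (b + single v 1)" using m ab(3) by (simp add: add.assoc)
  ultimately show ?case using ab(1) by blast
qed

lemma forms_mult_mem:
  fixes I :: "(nat, 'k::field) mpoly set"
  assumes I: "hideal n I" and mem: "\<And>g. g \<in> forms n N \<Longrightarrow> g * f \<in> I" and g: "g \<in> forms n (N + k)"
  shows "g * f \<in> I"
proof -
  have "single m c * f \<in> I" if m: "m \<in> keys g" for m and c :: 'k
  proof -
    have "m \<in> monomials {..n} (N + k)" using g m unfolding forms_iff by blast
    then obtain a b where ab: "a \<in> monomials {..n} N" "b \<in> monomials {..n} k" "m = a + b"
      using monomials_split by blast
    have eq: "single m c * f = single b c * (single a 1 * f)"
      by (simp add: ab(3) mult_single flip: mult.assoc) (simp add: add.commute)
    show ?thesis unfolding eq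
      by (rule hideal_mult[OF I mem[OF forms_single[OF ab(1)]] forms_polys[OF forms_single[OF ab(2)]]])
  qed
  then have "(\<Sum>m\<in>keys g. single m (lookup g m) * f) \<in> I"
    by (intro hideal_sum[OF I])
  then show ?thesis unfolding sum_distrib_right[symmetric] sum_singles[symmetric] .
qed

section \<open>Homogeneous primes and Noetherian induction\<close>

text \<open>Primality is tested on forms only; \<open>hprime_iff\<close> shows that these are the
  homogeneous prime ideals.\<close>

definition hprime :: "nat \<Rightarrow> (nat, 'k::field) mpoly set \<Rightarrow> bool" where
  "hprime n I \<longleftrightarrow> hideal n I \<and> I \<noteq> polys n \<and>
     (\<forall>e e'. \<forall>f \<in> forms n e. \<forall>g \<in> forms n e'. f * g \<in> I \<longrightarrow> f \<in> I \<or> g \<in> I)"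

lemma hprime_hideal: "hprime n I \<Longrightarrow> hideal n I"
  by (simp add: hprime_def)

lemma hprimeD: "hprime n I \<Longrightarrow> f * g \<in> I \<Longrightarrow> f \<in> forms n e \<Longrightarrow> g \<in> forms n e' \<Longrightarrow> f \<in> I \<or> g \<in> I"
  unfolding hprime_def by blast

text \<open>If \<open>I\<close> is proper and not prime, forms \<open>f\<close> and \<open>g\<close>
  outside \<open>I\<close> with product in \<open>I\<close> make both I + (f) and I : f strictly
  larger. The prime case keeps the hypothesis for all larger ideals.\<close>

lemma hideal_devissage [consumes 1, case_names whole prime extension]:
  assumes "hideal n I"
    and whole: "P (polys n)"
    and prime: "\<And>I. hprime n I \<Longrightarrow> (\<And>J. hideal n J \<Longrightarrow> I \<subset> J \<Longrightarrow> P J) \<Longrightarrow> P I"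
    and ext: "\<And>I f e. hideal n I \<Longrightarrow> f \<in> forms n e \<Longrightarrow> P (adjoin n I f) \<Longrightarrow> P (colon n I f) \<Longrightarrow> P I"
  shows "P I"
  using assms(1)
proof (induction I rule: wf_induct_rule[OF wf_hideal[of n]])
  case (1 I)
  have IH: "P J" if "hideal n J" "I \<subset> J" for J using 1 that by blast
  consider "I = polys n" | "hprime n I" | "I \<noteq> polys n" "\<not> hprime n I" by blast
  then show ?case
  proof cases
    case 3
    then obtain e e' f g where fg: "f \<in> forms n e" "g \<in> forms n e'" "f * g \<in> I" "f \<notin> I" "g \<notin> I"
      using 1(2) unfolding hprime_def by blast
    have "I \<subset> adjoin n I f" using adjoin_superset adjoin_self[OF 1(2)] fg(4) by blast
    moreover have "g \<in> colon n I f" using fg forms_polys by (auto simp: colon_def mult.commute)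
    then have "I \<subset> colon n I f" using colon_superset[OF 1(2) forms_polys[OF fg(1)]] fg(5) by blast
    ultimately show ?thesis
      using ext[OF 1(2) fg(1)] IH hideal_adjoin[OF 1(2) fg(1)] hideal_colon[OF 1(2) fg(1)] by blast
  qed (use whole prime IH in blast)+
qed

lemma colon_eqI:
  assumes "hideal n I" "f \<in> forms n e"
    and "\<And>t g. g \<in> forms n t \<Longrightarrow> g * f \<in> I \<Longrightarrow> g \<in> I"
  shows "colon n I f = I"
proof
  show "colon n I f \<subseteq> I"
    unfolding hideal_subset_iff[OF hideal_colon[OF assms(1,2)] assms(1)] using assms(3) by (auto simp: colon_def)
qed (rule colon_superset[OF assms(1) forms_polys[OF assms(2)]])

lemma colon_hprime: "hprime n I \<Longrightarrow> f \<in> forms n e \<Longrightarrow> f \<notin> I \<Longrightarrow> colon n I f = I"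
  by (rule colon_eqI) (auto dest: hprime_hideal hprimeD)

text \<open>Once I : l and \<open>I\<close> have equal Hilbert functions, the exact sequence makes
  the section count H(t + 1) - H(t); on the side of the lists this difference is
  \<open>gotz_cut_dims\<close>.\<close>

lemma gotz_list_adjoin:
  assumes I: "gotz_list n I as" "hideal n I" and l: "l \<in> forms n 1"
    and ev: "\<forall>\<^sub>F t in sequentially. hilb n (colon n I l) t = hilb n I t"
  shows "gotz_list n (adjoin n I l) (cut_dims as)"
  unfolding gotz_list_def
proof
  have ev1: "\<forall>\<^sub>F t in sequentially. hilb n I t = gotz 0 as t" using I(1) by (simp add: gotz_list_def)
  have "\<forall>\<^sub>F t in sequentially. hilb n (adjoin n I l) (Suc t) = gotz 0 (cut_dims as) (Suc t)"
    using ev ev1 ev1[THEN eventually_sequentially_Suc[THEN iffD2]] eventually_ge_at_top[of "length as"]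
  proof eventually_elim
    case (elim t)
    have "hilb n I (Suc t) = hilb n (adjoin n I l) (Suc t) + hilb n (colon n I l) t"
      using hilb_exact[OF I(2) l, of "Suc t"] by simp
    moreover have "gotz 0 as (Suc t) = gotz 0 as t + gotz 0 (cut_dims as) (Suc t)"
      using gotz_cut_dims[OF gotz_list_sorted[OF I(1)], of 0 t] elim by simp
    ultimately show ?case using elim by simp
  qed
  then show "\<forall>\<^sub>F t in sequentially. hilb n (adjoin n I l) t = gotz 0 (cut_dims as) t"
    by (rule eventually_sequentially_Suc[THEN iffD1])
qed (use gotz_list_sorted[OF I(1)] sorted_cut_dims in blast)

text \<open>Since I : f = I, the section counts H(t) - H(t - e), which is at most \<open>e\<close>
  times the sum for the cut list and so grows one order slower.\<close>

lemma hdim_adjoin_hprime: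
  assumes "hprime n I" "f \<in> forms n e" "f \<notin> I"
  shows "hdim n (adjoin n I f) \<le> hdim n I - 1"
proof -
  note I = hprime_hideal[OF assms(1)]
  define as where "as = hlist n I"
  have as: "gotz_list n I as" unfolding as_def by (rule gotz_list_hlist[OF I])
  then obtain N where N: "\<And>t. t \<ge> N \<Longrightarrow> hilb n I t = gotz 0 as t"
    by (auto simp: gotz_list_def eventually_sequentially)
  have ev: "\<forall>\<^sub>F t in sequentially. hilb n (adjoin n I f) t \<le> e * gotz 0 (cut_dims as) t"
    using eventually_ge_at_top[of "N + e"] eventually_ge_at_top[of "length as + e"]
  proof eventually_elim
    case (elim t)
    have "hilb n I t = hilb n (adjoin n I f) t + hilb n I (t - e)"
      using hilb_exact[OF I assms(2), of t] colon_hprime[OF assms] elim by simp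
    moreover have "gotz 0 as t \<le> gotz 0 as (t - e) + e * gotz 0 (cut_dims as) t"
      using gotz_diff_le[OF gotz_list_sorted[OF as]] elim by simp
    ultimately show ?case using N[of t] N[of "t - e"] elim by simp
  qed
  have "grows (gotz 0 (cut_dims as)) (hdim n I - 1)"
    using grows_gotz_dim[OF sorted_cut_dims[OF gotz_list_sorted[OF as]], of 0]
    by (simp add: gotz_dim_cut_dims hdim_def as_def)
  from grows_mono[OF ev grows_mult_const[OF this]] show ?thesis
    by (simp add: hdim_le_iff[OF hideal_adjoin[OF I assms(2)]])
qed

lemma forms_power: "x \<in> forms n 1 \<Longrightarrow> x ^ t \<in> forms n t"
proof (induction t)
  case 0
  then show ?case using const_forms[of 1 n] by (simp add: const_def)
next
  case (Suc t)
  then show ?case using forms_mult[of x n 1 "x ^ t" t] by simp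
qed

lemma hprime_power:
  assumes "hprime n P" "x \<in> forms n 1" "x \<notin> P" shows "x ^ t \<notin> P"
proof (induction t)
  case 0
  then show ?case using assms(1) hideal_eq_polys_iff[of n P] by (auto simp: hprime_def)
next
  case (Suc t)
  then show ?case using hprimeD[OF assms(1) _ assms(2) forms_power[OF assms(2)], of t] assms(3) by auto
qed

lemma hdim_hprime_pos:
  assumes "hprime n P" "\<not> forms n 1 \<subseteq> P" shows "hdim n P > 0"
proof (rule ccontr)
  assume "\<not> hdim n P > 0"
  then have "\<forall>\<^sub>F t in sequentially. hilb n P t = 0"
    using hdim_le_iff[OF hprime_hideal[OF assms(1)], of 0] by (simp add: grows_0_iff)
  then obtain t where "hilb n P t = 0" by (auto simp: eventually_sequentially)
  then have "forms n t \<subseteq> P" using hilb_eq_0_iff[OF hprime_hideal[OF assms(1)]] by blast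
  moreover obtain x where x: "x \<in> forms n 1" "x \<notin> P" using assms(2) by blast
  ultimately show False using hprime_power[OF assms(1) x, of t] forms_power[OF x(1), of t] by blast
qed

section \<open>Krull dimension\<close>

lemma hcomp_lowest_mult:
  fixes p q :: "(nat, 'k::field) mpoly"
  assumes p: "p \<in> polys n" "\<And>m. m \<in> keys p \<Longrightarrow> s \<le> monom_degree m"
    and q: "\<And>m. m \<in> keys q \<Longrightarrow> u \<le> monom_degree m"
  shows "hcomp (s + u) (p * q) = hcomp s p * hcomp u q"
proof -
  have "p * q = hcomp s p * q + (p - hcomp s p) * q" by (simp add: algebra_simps)
  moreover have "hcomp (s + u) ((p - hcomp s p) * q) = 0"
  proof (rule hcomp_eq_0)
    fix m assume "m \<in> keys ((p - hcomp s p) * q)"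
    then obtain a b where ab: "m = a + b" "a \<in> keys (p - hcomp s p)" "b \<in> keys q"
      using keys_mult by blast
    then have "a \<in> keys p" "monom_degree a \<noteq> s"
      by (auto simp: in_keys_iff lookup_minus lookup_hcomp when_def split: if_splits)
    then have "s < monom_degree a" using p(2)[of a] by simp
    then show "monom_degree m \<noteq> s + u" using q[OF ab(3)] ab(1) by (simp add: monom_degree_add)
  qed
  ultimately show ?thesis using hcomp_mult_form[OF hcomp_forms[OF p(1)], of s u q] by (simp add: hcomp_add)
qed

text \<open>The components below the first one outside \<open>I\<close> are subtracted; they lie in
  \<open>I\<close>, so the class of \<open>p\<close> is unchanged.\<close>

lemma hideal_lowest_part:
  assumes I: "hideal n I" and p: "p \<in> polys n" "p \<notin> I"
  obtains p' s where "p - p' \<in> I" "p' \<in> polys n" "\<And>m. m \<in> keys p' \<Longrightarrow> s \<le> monom_degree m" "hcomp s p' \<notin> I"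
proof -
  have "\<exists>t. hcomp t p \<notin> I" using hideal_mem_iff[OF I] p(2) by blast
  define s where "s = (LEAST t. hcomp t p \<notin> I)"
  have s: "hcomp s p \<notin> I" unfolding s_def by (rule LeastI_ex) fact
  have less: "hcomp t p \<in> I" if "t < s" for t using not_less_Least that unfolding s_def by blast
  define p' where "p' = p - (\<Sum>t<s. hcomp t p)"
  have look: "lookup p' m = (lookup p m when s \<le> monom_degree m)" for m
    by (auto simp: p'_def lookup_minus lookup_sum lookup_hcomp when_def)
  show thesis
  proof (rule that)
    show "p - p' \<in> I" unfolding p'_def using hideal_sum[OF I, of "{..<s}" "\<lambda>t. hcomp t p"] less by simp
    then show "p' \<in> polys n" using polys_diff[OF p(1), of "p - p'"] hideal_polys[OF I] by simp
    show "s \<le> monom_degree m" if "m \<in> keys p'" for m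
      using that by (auto simp: in_keys_iff look)
    have "hcomp s p' = hcomp s p" by (intro poly_mapping_eqI) (auto simp: lookup_hcomp look when_def)
    then show "hcomp s p' \<notin> I" using s by simp
  qed
qed

text \<open>Modulo \<open>P\<close> both factors can be given lowest components outside
  \<open>P\<close>. The lowest component of the product is the product of these, which reduces the
  claim to forms.\<close>

lemma hprime_mult_mem:
  assumes P: "hprime n P" and a: "a \<in> polys n" and b: "b \<in> polys n" and "a * b \<in> P"
  shows "a \<in> P \<or> b \<in> P"
proof (rule ccontr)
  note I = hprime_hideal[OF P]
  assume "\<not> (a \<in> P \<or> b \<in> P)"
  then have nab: "a \<notin> P" "b \<notin> P" by auto
  obtain a' s where a': "a - a' \<in> P" "a' \<in> polys n" "\<And>m. m \<in> keys a' \<Longrightarrow> s \<le> monom_degree m" "hcomp s a' \<notin> P"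
    using hideal_lowest_part[OF I a nab(1)] by blast
  obtain b' u where b': "b - b' \<in> P" "b' \<in> polys n" "\<And>m. m \<in> keys b' \<Longrightarrow> u \<le> monom_degree m" "hcomp u b' \<notin> P"
    using hideal_lowest_part[OF I b nab(2)] by blast
  have "a' * b' = a * b - (b * (a - a') + a' * (b - b'))" by (simp add: algebra_simps)
  then have "a' * b' \<in> P"
    using a' b' a b assms(4) hideal_diff[OF I] hideal_add[OF I] hideal_mult[OF I] by simp
  then have "hcomp s a' * hcomp u b' \<in> P"
    using hcomp_lowest_mult[OF a'(2,3) b'(3)] hideal_hcomp[OF I] by metis
  then show False using hprimeD[OF P] hcomp_forms[OF a'(2)] hcomp_forms[OF b'(2)] a'(4) b'(4) by blast
qed

lemma hprime_iff:
  "hprime n P \<longleftrightarrow> primeideal P (poly_ring n) \<and> homogeneous_ideal n P"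
proof
  assume P: "hprime n P"
  have "primeideal P (poly_ring n)"
  proof (rule primeidealI)
    show "ideal P (poly_ring n)" by (rule hideal_ideal[OF hprime_hideal[OF P]])
    show "cring (poly_ring n :: (nat, 'a) mpoly ring)" by (rule poly_ring_cring)
    show "carrier (poly_ring n) \<noteq> P" using P by (auto simp: hprime_def)
  qed (use hprime_mult_mem[OF P] in auto)
  then show "primeideal P (poly_ring n) \<and> homogeneous_ideal n P"
    using hprime_hideal[OF P] by (simp add: homogeneous_ideal_iff)
next
  assume P: "primeideal P (poly_ring n) \<and> homogeneous_ideal n P"
  interpret primeideal P "poly_ring n" using P by blast
  show "hprime n P"
    unfolding hprime_def using P I_notcarr I_prime by (auto simp: homogeneous_ideal_iff dest: forms_polys)
qed

lemma scheme_points_iff: "P \<in> scheme_points n X \<longleftrightarrow> hprime n P \<and> X \<subseteq> P \<and> \<not> forms n 1 \<subseteq> P"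
  by (auto simp: scheme_points_def hprime_iff)

lemma scheme_points_antimono: "X \<subseteq> Y \<Longrightarrow> scheme_points n Y \<subseteq> scheme_points n X"
  unfolding scheme_points_def by blast

lemma hdim_psubset_hprime:
  assumes "hprime n P" "\<not> forms n 1 \<subseteq> P" "hideal n Q" "P \<subset> Q"
  shows "hdim n Q < hdim n P"
proof -
  note I = hprime_hideal[OF assms(1)]
  obtain t f where f: "f \<in> Q" "f \<in> forms n t" "f \<notin> P"
    using assms(4) hideal_subset_iff[OF assms(3) I] by blast
  have "hdim n Q \<le> hdim n (adjoin n P f)"
    using hdim_antimono[OF hideal_adjoin[OF I f(2)] assms(3)] adjoin_minimal[OF assms(3)] assms(4) f(1) by blast
  then show ?thesis
    using hdim_adjoin_hprime[OF assms(1) f(2,3)] hdim_hprime_pos[OF assms(1,2)] by linarith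
qed

lemma chain_length_le:
  assumes "set (P # Ps) \<subseteq> scheme_points n X" "sorted_wrt (\<subset>) (P # Ps)"
  shows "length (P # Ps) \<le> hdim n P"
  using assms
proof (induction Ps arbitrary: P)
  case Nil
  then have "hprime n P" "\<not> forms n 1 \<subseteq> P" by (auto simp: scheme_points_iff simp del: One_nat_def)
  from hdim_hprime_pos[OF this] show ?case by simp
next
  case (Cons Q Ps)
  then have "length (Q # Ps) \<le> hdim n Q" by simp
  moreover have "hdim n Q < hdim n P"
    using Cons.prems by (intro hdim_psubset_hprime) (auto simp: scheme_points_iff hprime_hideal)
  ultimately show ?case by simp
qed

lemma chain_exists:
  assumes "hideal n X"
  shows "\<exists>Ps. length Ps = hdim n X \<and> set Ps \<subseteq> scheme_points n X \<and> sorted_wrt (\<subset>) Ps"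
proof -
  \<comment> \<open>Chains of every length up to the dimension are claimed, so that the inequality
    of \<open>hdim_le_max\<close> is enough when passing to I + (f) or I : f.\<close>
  have "\<exists>Ps. length Ps = s \<and> set Ps \<subseteq> scheme_points n X \<and> sorted_wrt (\<subset>) Ps" if "s \<le> hdim n X" for s
    using assms that
  proof (induction arbitrary: s rule: hideal_devissage)
    case whole
    have "hilb n (polys n :: (nat, 'a) mpoly set) t = 0" for t
      using hilb_eq_0_iff[OF hideal_polys_self] forms_polys by blast
    then have "hdim n (polys n :: (nat, 'a) mpoly set) \<le> 0"
      unfolding hdim_le_iff[OF hideal_polys_self] grows_0_iff by simp
    then show ?case using whole by simp
  next
    case (prime I)
    note I = hprime_hideal[OF prime(1)]
    show ?case
    proof (cases s)
      case (Suc s')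
      \<comment> \<open>Otherwise \<open>I\<close> contains all forms of positive degree and has
        dimension 0, against \<open>s > 0\<close>.\<close>
      have "\<not> forms n 1 \<subseteq> I"
      proof
        assume sub: "forms n 1 \<subseteq> I"
        then have "forms n (Suc t) \<subseteq> I" for t
          using forms_mult_mem[OF I, of 1 1 _ t] by auto
        then have "\<forall>\<^sub>F t in sequentially. hilb n I t = 0"
          unfolding eventually_sequentially using hilb_eq_0_iff[OF I] by (metis Suc_le_D)
        then have "hdim n I \<le> 0" using hdim_le_iff[OF I, of 0] by (simp add: grows_0_iff)
        then show False using prime(3) Suc by simp
      qed
      then obtain x where x: "x \<in> forms n 1" "x \<notin> I" by blast
      have J: "hideal n (adjoin n I x)" "I \<subset> adjoin n I x"
        using hideal_adjoin[OF I x(1)] adjoin_superset adjoin_self[OF I] x(2) by blast+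
      have "gotz_list n (adjoin n I x) (cut_dims (hlist n I))"
        by (rule gotz_list_adjoin[OF gotz_list_hlist[OF I] I x(1)]) (simp add: colon_hprime[OF prime(1) x])
      then have "hdim n (adjoin n I x) = hdim n I - 1" by (simp add: hdim_def hlist_eqI gotz_dim_cut_dims)
      then have "s' \<le> hdim n (adjoin n I x)" using prime(3) Suc by simp
      then obtain Ps where Ps: "length Ps = s'" "set Ps \<subseteq> scheme_points n (adjoin n I x)" "sorted_wrt (\<subset>) Ps"
        using prime(2)[OF J] by blast
      have "I \<in> scheme_points n I" using prime(1) x by (auto simp: scheme_points_iff)
      moreover have "I \<subset> P" "P \<in> scheme_points n I" if "P \<in> set Ps" for P
      proof -
        have "P \<in> scheme_points n (adjoin n I x)" using that Ps(2) by blast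
        then show "I \<subset> P" "P \<in> scheme_points n I"
          using J(2) scheme_points_antimono[of I "adjoin n I x" n] by (auto simp: scheme_points_iff)
      qed
      ultimately show ?thesis using Ps Suc by (intro exI[of _ "I # Ps"]) auto
    qed simp
  next
    case (extension I f e)
    have "s \<le> hdim n (adjoin n I f) \<or> s \<le> hdim n (colon n I f)"
      using hdim_le_max[OF extension(1,2)] extension(5) by auto
    moreover have "scheme_points n (adjoin n I f) \<subseteq> scheme_points n I" "scheme_points n (colon n I f) \<subseteq> scheme_points n I"
      by (intro scheme_points_antimono adjoin_superset colon_superset[OF extension(1) forms_polys[OF extension(2)]])+
    ultimately show ?case using extension(3,4) by (meson subset_trans)
  qed
  then show ?thesis by blast
qed

theorem scheme_dim_eq: "hideal n X \<Longrightarrow> scheme_dim n X = int (hdim n X) - 1"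
proof -
  assume X: "hideal n X"
  have "(GREATEST l. \<exists>ps. length ps = l \<and> set ps \<subseteq> scheme_points n X \<and> sorted_wrt (\<subset>) ps) = hdim n X"
  proof (rule Greatest_equality)
    show "\<exists>ps. length ps = hdim n X \<and> set ps \<subseteq> scheme_points n X \<and> sorted_wrt (\<subset>) ps"
      using chain_exists[OF X] .
    fix l assume "\<exists>ps. length ps = l \<and> set ps \<subseteq> scheme_points n X \<and> sorted_wrt (\<subset>) ps"
    then obtain ps where ps: "length ps = l" "set ps \<subseteq> scheme_points n X" "sorted_wrt (\<subset>) ps" by blast
    show "l \<le> hdim n X"
    proof (cases ps)
      case (Cons P Ps)
      have "hdim n P \<le> hdim n X"
        using ps(2) Cons by (intro hdim_antimono[OF X]) (auto simp: scheme_points_iff hprime_hideal)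
      then show ?thesis using chain_length_le[of P Ps n X] ps Cons by simp
    qed (use ps in simp)
  qed
  then show ?thesis by (simp add: scheme_dim_def)
qed

section \<open>General linear forms\<close>

text \<open>A stand-in for non-empty open sets of linear forms, described without equations: a line
  through a point of \<open>B\<close> is outside \<open>B\<close> for finitely many parameters
  only.\<close>

definition lin_generic :: "nat \<Rightarrow> (nat, 'k::field) mpoly set \<Rightarrow> bool" where
  "lin_generic n B \<longleftrightarrow> B \<subseteq> forms n 1 \<and> B \<noteq> {} \<and>
     (\<forall>a\<in>B. \<forall>v\<in>forms n 1. finite {c. a + cmul c v \<notin> B})"

lemma lin_generic_forms: "lin_generic n (forms n 1)"
  using forms_0[of n 1] by (auto simp: lin_generic_def forms_add forms_cmul simp del: One_nat_def forms_0)

text \<open>Join a point of \<open>A\<close> to a point of \<open>B\<close> by a line: only finitely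
  many of its parameters lead outside \<open>A\<close> or outside \<open>B\<close>. For
  \<open>B\<close> the line is read backwards from \<open>b\<close>, with parameter
  \<open>1 - c\<close>.\<close>

lemma lin_generic_Int:
  fixes A B :: "(nat, 'k::field) mpoly set"
  assumes inf: "infinite (UNIV :: 'k set)" and A: "lin_generic n A" and B: "lin_generic n B"
  shows "lin_generic n (A \<inter> B)"
proof -
  obtain a b where ab: "a \<in> A" "b \<in> B" using A B unfolding lin_generic_def by blast
  then have f: "a \<in> forms n 1" "b \<in> forms n 1" using A B unfolding lin_generic_def by blast+
  have v: "b - a \<in> forms n 1" by (rule mp.subspace_diff[OF subspace_forms f(2,1)])
  have v': "a - b \<in> forms n 1" by (rule mp.subspace_diff[OF subspace_forms f])
  have "finite {c. a + cmul c (b - a) \<notin> A}" using A ab(1) v unfolding lin_generic_def by blast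
  moreover have "finite {c. a + cmul c (b - a) \<notin> B}"
  proof -
    have "a + cmul c (b - a) = b + cmul (1 - c) (a - b)" for c
      by (intro poly_mapping_eqI) (simp add: lookup_add lookup_minus algebra_simps)
    then have "{c. a + cmul c (b - a) \<notin> B} = (\<lambda>c. 1 - c) -` {c. b + cmul c (a - b) \<notin> B}" by auto
    moreover have "finite {c. b + cmul c (a - b) \<notin> B}" using B ab(2) v' unfolding lin_generic_def by blast
    then have "finite ((\<lambda>c. 1 - c) -` {c. b + cmul c (a - b) \<notin> B})" by (rule finite_vimageI) (simp add: inj_on_def)
    ultimately show ?thesis by simp
  qed
  ultimately have "finite ({c. a + cmul c (b - a) \<notin> A} \<union> {c. a + cmul c (b - a) \<notin> B})" by blast
  then obtain c where "c \<notin> {c. a + cmul c (b - a) \<notin> A} \<union> {c. a + cmul c (b - a) \<notin> B}"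
    using inf ex_new_if_finite by blast
  then have "A \<inter> B \<noteq> {}" by blast
  moreover have "finite {c. x + cmul c w \<notin> A \<inter> B}" if x: "x \<in> A \<inter> B" and w: "w \<in> forms n 1" for x w
  proof -
    have "{c. x + cmul c w \<notin> A \<inter> B} = {c. x + cmul c w \<notin> A} \<union> {c. x + cmul c w \<notin> B}" by blast
    then show ?thesis using A B x w unfolding lin_generic_def by simp
  qed
  ultimately show ?thesis using A unfolding lin_generic_def by blast
qed

text \<open>Multiplication by \<open>l\<close> is injective on R/I in all large degrees, so
  \<open>l\<close> is a nonzerodivisor up to a part of finite length.\<close>

definition filter_regular :: "nat \<Rightarrow> (nat, 'k::field) mpoly set \<Rightarrow> (nat, 'k) mpoly \<Rightarrow> bool" where
  "filter_regular n I l \<longleftrightarrow> (\<forall>\<^sub>F t in sequentially. \<forall>f \<in> forms n t. f * l \<in> I \<longrightarrow> f \<in> I)"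

text \<open>A line through a form outside \<open>P\<close> meets \<open>P\<close> at most once: two
  parameters with values in \<open>P\<close> would put the direction \<open>v\<close> and hence the
  whole line into \<open>P\<close>.\<close>

lemma lin_generic_hprime:
  assumes P: "hprime n P" and "\<not> forms n 1 \<subseteq> P"
  shows "lin_generic n (forms n 1 - P)"
proof -
  note I = hprime_hideal[OF P]
  have "finite {c. a + cmul c v \<notin> forms n 1 - P}" if a: "a \<in> forms n 1 - P" and v: "v \<in> forms n 1" for a v
  proof -
    have "c = d" if c: "a + cmul c v \<in> P" and d: "a + cmul d v \<in> P" for c d
    proof (rule ccontr)
      assume "c \<noteq> d"
      have "cmul (c - d) v = (a + cmul c v) - (a + cmul d v)"
        by (intro poly_mapping_eqI) (simp add: lookup_add lookup_minus algebra_simps)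
      then have "cmul (c - d) v \<in> P" using hideal_diff[OF I c d] by simp
      then have "cmul (1 / (c - d)) (cmul (c - d) v) \<in> P" by (rule hideal_cmul[OF I])
      then have "v \<in> P" using \<open>c \<noteq> d\<close> by simp
      then have "a \<in> P" using hideal_diff[OF I c hideal_cmul[OF I, of v c]] by simp
      then show False using a by blast
    qed
    then have "finite {c. a + cmul c v \<in> P}"
      by (metis (mono_tags, lifting) finite.simps finite_subset insertI1 mem_Collect_eq subsetI singletonI)
    moreover have "{c. a + cmul c v \<notin> forms n 1 - P} = {c. a + cmul c v \<in> P}"
      using a v by (auto simp: forms_add forms_cmul simp del: One_nat_def)
    ultimately show ?thesis by simp
  qed
  then show ?thesis using assms(2) unfolding lin_generic_def by blast
qed

lemma forms_subset_later:
  assumes "hideal n I" "forms n N \<subseteq> I" "N \<le> t" shows "forms n t \<subseteq> I"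
proof
  fix g :: "(nat, 'a) mpoly" assume g: "g \<in> forms n t"
  have "g * 1 \<in> I"
    by (rule forms_mult_mem[OF assms(1), of N 1 g "t - N"]) (use assms g in auto)
  then show "g \<in> I" by simp
qed

lemma filter_regular_if_forms_subset:
  assumes "hideal n I" "forms n N \<subseteq> I" shows "filter_regular n I l"
  unfolding filter_regular_def using eventually_ge_at_top[of N]
  by eventually_elim (use forms_subset_later[OF assms] in blast)

text \<open>Regularity modulo I + (f) lets \<open>g\<close> be written as \<open>a + b * f\<close>.
  Then \<open>b * l * f\<close> lies in \<open>I\<close>, so regularity modulo I : f gives
  \<open>b * f \<in> I\<close>.\<close>

lemma filter_regular_extension:
  assumes I: "hideal n I" and f: "f \<in> forms n e" and l: "l \<in> forms n 1"
    and reg: "filter_regular n (adjoin n I f) l" "filter_regular n (colon n I f) l"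
  shows "filter_regular n I l"
proof -
  obtain N where N: "\<And>t g. t \<ge> N \<Longrightarrow> g \<in> forms n t \<Longrightarrow> g * l \<in> adjoin n I f \<Longrightarrow> g \<in> adjoin n I f"
    using reg(1) unfolding filter_regular_def eventually_sequentially by blast
  obtain M where M: "\<And>t g. t \<ge> M \<Longrightarrow> g \<in> forms n t \<Longrightarrow> g * l \<in> colon n I f \<Longrightarrow> g \<in> colon n I f"
    using reg(2) unfolding filter_regular_def eventually_sequentially by blast
  have "g \<in> I" if t: "t \<ge> N + M + e" and g: "g \<in> forms n t" and gl: "g * l \<in> I" for t g
  proof -
    have "g \<in> adjoin n I f" using N[of t g] t g gl adjoin_superset by auto
    then obtain a b where ab: "a \<in> I" "b \<in> forms n (t - e)" "g = a + b * f" "a \<in> forms n t"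
      using adjoin_graded[OF I f _ g] t by auto
    have "b * l * f = g * l - a * l" by (simp add: ab(3) algebra_simps)
    also have "\<dots> \<in> I" using hideal_diff[OF I gl hideal_mult'[OF I ab(1) forms_polys[OF l]]] .
    finally have "b * l \<in> colon n I f"
      using polys_mult[OF forms_polys[OF ab(2)] forms_polys[OF l]] by (simp add: colon_def)
    then have "b \<in> colon n I f" using M[OF _ ab(2)] t by simp
    then show "g \<in> I" using ab(3) hideal_add[OF I ab(1)] by (auto simp: colon_def)
  qed
  then show ?thesis unfolding filter_regular_def eventually_sequentially by blast
qed

text \<open>The usual argument avoids the relevant associated primes. Here the induction supplies a
  generic set for every prime it runs into, and these sets are intersected.\<close>

lemma filter_regular_generic:
  fixes I :: "(nat, 'k::field) mpoly set"
  assumes inf: "infinite (UNIV :: 'k set)" and "hideal n I"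
  shows "\<exists>B. lin_generic n B \<and> (\<forall>l\<in>B. filter_regular n I l)"
  using assms(2)
proof (induction rule: hideal_devissage)
  case whole
  have "filter_regular n (polys n) l" for l :: "(nat, 'k) mpoly"
    by (rule filter_regular_if_forms_subset[OF hideal_polys_self, of n 0]) (auto dest: forms_polys)
  then show ?case using lin_generic_forms by blast
next
  case (prime I)
  show ?case
  proof (cases "forms n 1 \<subseteq> I")
    case True
    then show ?thesis
      using lin_generic_forms filter_regular_if_forms_subset[OF hprime_hideal[OF prime(1)] True] by blast
  next
    case False
    have "filter_regular n I l" if "l \<in> forms n 1 - I" for l
      unfolding filter_regular_def using hprimeD[OF prime(1)] that by (intro always_eventually) blast
    then show ?thesis using lin_generic_hprime[OF prime(1) False] by blast
  qed
next
  case (extension I f e)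
  then obtain A B where AB: "lin_generic n A" "lin_generic n B" "\<And>l. l \<in> A \<Longrightarrow> filter_regular n (adjoin n I f) l"
    "\<And>l. l \<in> B \<Longrightarrow> filter_regular n (colon n I f) l" by blast
  have "filter_regular n I l" if "l \<in> A \<inter> B" for l
    using filter_regular_extension[OF extension(1,2)] AB that unfolding lin_generic_def by blast
  then show ?case using lin_generic_Int[OF inf AB(1,2)] by blast
qed

lemma filter_regular_gotz_list:
  assumes I: "hideal n I" and as: "gotz_list n I as" and l: "l \<in> forms n 1" and reg: "filter_regular n I l"
  shows "gotz_list n (adjoin n I l) (cut_dims as)"
proof (rule gotz_list_adjoin[OF as I l])
  from reg show "\<forall>\<^sub>F t in sequentially. hilb n (colon n I l) t = hilb n I t"
    unfolding filter_regular_def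
  proof eventually_elim
    case (elim t)
    then have "colon n I l \<inter> forms n t = I \<inter> forms n t"
      using colon_superset[OF I forms_polys[OF l]] by (auto simp: colon_def)
    then show ?case by (simp add: hilb_def)
  qed
qed

section \<open>Saturation\<close>

lemma saturation_iff: "f \<in> saturation n I \<longleftrightarrow> f \<in> polys n \<and> (\<exists>N. \<forall>g\<in>forms n N. g * f \<in> I)"
  by (simp add: saturation_def)

lemma saturation_large:
  assumes "hideal n I" "\<And>g. g \<in> forms n N \<Longrightarrow> g * f \<in> I" "N \<le> M" "g \<in> forms n M"
  shows "g * f \<in> I"
  using forms_mult_mem[OF assms(1,2), where g = g and k = "M - N"] assms(3,4) by simp

lemma saturation_superset: "hideal n I \<Longrightarrow> I \<subseteq> saturation n I"
proof
  fix f assume I: "hideal n I" and f: "f \<in> I"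
  then show "f \<in> saturation n I"
    using hideal_polys[OF I f] hideal_mult[OF I f] forms_polys unfolding saturation_iff by blast
qed

lemma hideal_saturation:
  fixes I :: "(nat, 'k::field) mpoly set"
  assumes I: "hideal n I" shows "hideal n (saturation n I)"
proof (rule hidealI)
  show "0 \<in> saturation n I" using saturation_superset[OF I] hideal_0[OF I] by blast
  fix p q :: "(nat, 'k) mpoly" assume p: "p \<in> saturation n I"
  obtain N where N: "\<And>g. g \<in> forms n N \<Longrightarrow> g * p \<in> I" using p by (auto simp: saturation_iff)
  { assume q: "q \<in> saturation n I"
    obtain M where M: "\<And>g. g \<in> forms n M \<Longrightarrow> g * q \<in> I" using q by (auto simp: saturation_iff)
    have "g * (p + q) \<in> I" if g: "g \<in> forms n (N + M)" for g
      using saturation_large[OF I N _ g] saturation_large[OF I M _ g] hideal_add[OF I] by (simp add: distrib_left)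
    then show "p + q \<in> saturation n I" using p q polys_add by (auto simp: saturation_iff)
  next
    assume q: "q \<in> polys n"
    have "g * (q * p) \<in> I" if g: "g \<in> forms n N" for g
      using hideal_mult[OF I N[OF g] q] by (simp add: mult.left_commute)
    then show "q * p \<in> saturation n I" using p q polys_mult by (auto simp: saturation_iff)
  }
  show "hcomp t p \<in> saturation n I" for t
  proof -
    have "g * hcomp t p \<in> I" if g: "g \<in> forms n N" for g
      using hideal_hcomp[OF I N[OF g], of "N + t"] hcomp_mult_form[OF g, of t p] by simp
    then show ?thesis using p hcomp_forms[of p n t] forms_polys by (auto simp: saturation_iff)
  qed
qed (auto simp: saturation_iff)

text \<open>The point is one bound for all elements of the saturation. An ideal that is maximal
  among those between \<open>I\<close> and its saturation which agree with \<open>I\<close> in large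
  degrees must be the saturation, because adjoining a single further form keeps this
  property.\<close>

lemma saturation_eventually:
  fixes I :: "(nat, 'k::field) mpoly set"
  assumes I: "hideal n I"
  shows "\<forall>\<^sub>F t in sequentially. saturation n I \<inter> forms n t = I \<inter> forms n t"
proof -
  define S where "S = {K. hideal n K \<and> I \<subseteq> K \<and> K \<subseteq> saturation n I \<and> (\<exists>N. \<forall>t\<ge>N. K \<inter> forms n t \<subseteq> I)}"
  have "I \<in> S" using I saturation_superset[OF I] by (auto simp: S_def)
  then obtain K where K: "K \<in> S" and max: "\<And>J. hideal n K \<Longrightarrow> hideal n J \<Longrightarrow> K \<subset> J \<Longrightarrow> J \<notin> S"
    using wfE_min[OF wf_hideal[of n], of I S] by (metis (mono_tags, lifting) case_prodI mem_Collect_eq)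
  then have K': "hideal n K" "I \<subseteq> K" "K \<subseteq> saturation n I" unfolding S_def by blast+
  obtain N where N: "\<And>t. t \<ge> N \<Longrightarrow> K \<inter> forms n t \<subseteq> I" using K unfolding S_def by blast
  have "saturation n I \<subseteq> K"
    unfolding hideal_subset_iff[OF hideal_saturation[OF I] K'(1)]
  proof (intro allI subsetI, rule ccontr)
    fix e f assume f: "f \<in> saturation n I \<inter> forms n e" "f \<notin> K"
    then obtain M where M: "\<And>g. g \<in> forms n M \<Longrightarrow> g * f \<in> I" by (auto simp: saturation_iff)
    have fe: "f \<in> forms n e" using f by blast
    have "p \<in> I" if t: "t \<ge> N + M + e" and p: "p \<in> adjoin n K f" "p \<in> forms n t" for t p
    proof -
      obtain a b where ab: "a \<in> K" "b \<in> forms n (t - e)" "p = a + b * f" "a \<in> forms n t"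
        using adjoin_graded[OF K'(1) fe p] t by auto
      have bf: "b * f \<in> I" using saturation_large[OF I M _ ab(2)] t by simp
      have "a \<in> I" using N[of t] ab(1,4) t by auto
      then show ?thesis using hideal_add[OF I _ bf] ab(3) by simp
    qed
    then have "\<exists>N. \<forall>t\<ge>N. adjoin n K f \<inter> forms n t \<subseteq> I" by blast
    moreover have "adjoin n K f \<subseteq> saturation n I"
      using adjoin_minimal[OF hideal_saturation[OF I] K'(3)] f by blast
    moreover have "K \<subset> adjoin n K f" using adjoin_superset adjoin_self[OF K'(1)] f(2) by blast
    moreover have "hideal n (adjoin n K f)" by (rule hideal_adjoin[OF K'(1) fe])
    ultimately show False using max[OF K'(1)] K'(2) unfolding S_def by blast
  qed
  then have "saturation n I \<inter> forms n t = I \<inter> forms n t" if "t \<ge> N" for t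
    using N[OF that] saturation_superset[OF I] by blast
  then show ?thesis unfolding eventually_sequentially by blast
qed

lemma saturation_idem:
  assumes I: "hideal n I" shows "saturation n (saturation n I) = saturation n I"
proof
  note S = hideal_saturation[OF I]
  obtain N where N: "\<And>t. t \<ge> N \<Longrightarrow> saturation n I \<inter> forms n t = I \<inter> forms n t"
    using saturation_eventually[OF I] unfolding eventually_sequentially by blast
  show "saturation n (saturation n I) \<subseteq> saturation n I"
    unfolding hideal_subset_iff[OF hideal_saturation[OF S] S]
  proof (intro allI subsetI)
    fix e f assume f: "f \<in> saturation n (saturation n I) \<inter> forms n e"
    then obtain M where M: "\<And>g. g \<in> forms n M \<Longrightarrow> g * f \<in> saturation n I" by (auto simp: saturation_iff)
    have "g * f \<in> I" if g: "g \<in> forms n (M + N)" for g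
    proof -
      have "g * f \<in> saturation n I" using saturation_large[OF S M _ g] by simp
      moreover have "g * f \<in> forms n (M + N + e)" using forms_mult[OF g, of f e] f by blast
      ultimately show ?thesis using N[of "M + N + e"] by auto
    qed
    then show "f \<in> saturation n I" using f by (auto simp: saturation_iff)
  qed
qed (rule saturation_superset[OF hideal_saturation[OF I]])

lemma gotz_list_saturation:
  assumes "hideal n I" "gotz_list n I as" shows "gotz_list n (saturation n I) as"
  using saturation_eventually[OF assms(1)] assms(2)
  unfolding gotz_list_def hilb_def by (auto elim: eventually_elim2)

text \<open>If \<open>g * l\<close> is in \<open>X\<close>, so is \<open>h * g * l\<close> for
  \<open>h\<close> of large degree; filter-regularity gives \<open>h * g \<in> X\<close>, and
  saturation removes \<open>h\<close>. Thus \<open>l\<close> is a nonzerodivisor modulo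
  \<open>X\<close>.\<close>

lemma colon_saturated:
  assumes X: "hideal n X" "saturation n X = X" and l: "l \<in> forms n 1" and reg: "filter_regular n X l"
  shows "colon n X l = X"
proof (rule colon_eqI[OF X(1) l])
  fix t g assume g: "g \<in> forms n t" "g * l \<in> X"
  obtain N where N: "\<And>s f. s \<ge> N \<Longrightarrow> f \<in> forms n s \<Longrightarrow> f * l \<in> X \<Longrightarrow> f \<in> X"
    using reg unfolding filter_regular_def eventually_sequentially by blast
  have "h * g \<in> X" if h: "h \<in> forms n N" for h
    using N[of "N + t" "h * g"] forms_mult[OF h g(1)] hideal_mult[OF X(1) g(2) forms_polys[OF h]]
    by (simp add: mult.assoc)
  then have "g \<in> saturation n X" using g(1) forms_polys by (auto simp: saturation_iff)
  then show "g \<in> X" using X(2) by simp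
qed

section \<open>A lower bound for Hilbert functions of saturated ideals\<close>

lemma regular_form_exists:
  fixes X :: "(nat, 'k::field) mpoly set"
  assumes inf: "infinite (UNIV :: 'k set)" and X: "hideal n X" "saturation n X = X"
  obtains l where "l \<in> forms n 1" "filter_regular n X l" "hilb n (adjoin n X l) 0 = hilb n X 0"
    "\<And>t. hilb n X (Suc t) = hilb n (adjoin n X l) (Suc t) + hilb n X t"
proof -
  obtain B where B: "lin_generic n B" "\<And>l. l \<in> B \<Longrightarrow> filter_regular n X l"
    using filter_regular_generic[OF inf X(1)] by blast
  then obtain l where l: "l \<in> B" "l \<in> forms n 1" unfolding lin_generic_def by blast
  have "colon n X l = X" by (rule colon_saturated[OF X l(2) B(2)[OF l(1)]])
  then have "hilb n X (Suc t) = hilb n (adjoin n X l) (Suc t) + hilb n X t" for t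
    using hilb_exact[OF X(1) l(2), of "Suc t"] by simp
  then show thesis using that[OF l(2) B(2)[OF l(1)]] hilb_adjoin_less[OF X(1) l(2), of 0] by simp
qed

lemma hilb_saturated_points:
  fixes X :: "(nat, 'k::field) mpoly set"
  assumes inf: "infinite (UNIV :: 'k set)" and X: "hideal n X" "saturation n X = X"
    and ev: "\<forall>\<^sub>F t in sequentially. hilb n X t = d"
  shows "min (Suc t) d \<le> hilb n X t"
proof -
  obtain l where l: "l \<in> forms n 1" "\<And>t. hilb n X (Suc t) = hilb n (adjoin n X l) (Suc t) + hilb n X t"
    using regular_form_exists[OF inf X] by metis
  note J = hideal_adjoin[OF X(1) l(1)]
  \<comment> \<open>Once the Hilbert function repeats a value, the section vanishes in that degree
    and hence in all later ones, so the final value \<open>d\<close> has been reached. Before that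
    every step adds at least 1.\<close>
  have const: "hilb n X t = d" if "hilb n X (Suc t) = hilb n X t" for t
  proof -
    have "forms n (Suc t) \<subseteq> adjoin n X l" using l(2)[of t] that hilb_eq_0_iff[OF J] by simp
    then have "hilb n (adjoin n X l) s = 0" if "s \<ge> Suc t" for s
      using forms_subset_later[OF J _ that] hilb_eq_0_iff[OF J] by blast
    then have step: "hilb n X (Suc s) = hilb n X s" if "s \<ge> t" for s using l(2)[of s] that by simp
    have eq: "hilb n X s = hilb n X t" if "s \<ge> t" for s
      using that by (induction rule: dec_induct) (simp_all add: step)
    obtain N where "\<And>s. s \<ge> N \<Longrightarrow> hilb n X s = d" using ev unfolding eventually_sequentially by blast
    then show ?thesis using eq[of "max N t"] by simp
  qed
  show ?thesis
  proof (induction t)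
    case 0
    show ?case
    proof (cases "hilb n X 0 = 0")
      case True
      then have "hilb n X s = 0" for s
        using forms_subset_later[OF X(1), of 0 s] hilb_eq_0_iff[OF X(1)] by blast
      then show ?thesis using ev by (auto simp: eventually_sequentially)
    qed simp
  next
    case (Suc t)
    then show ?case using const[of t] l(2)[of t] by (cases "hilb n X (Suc t) = hilb n X t") auto
  qed
qed

lemma gotz_replicate_0_le_min: "gotz 0 (replicate d 0) t \<le> min (Suc t) d"
  using gotz_replicate_le[of 0 d t] gotz_replicate_0_le[of 0 d t] by simp

text \<open>For \<open>r > 0\<close> the excess \<open>D\<close> over the hypersurface function
  never decreases, because its increments are the excess of the section; it starts at 0 or above and
  is 0 in the end, so it vanishes throughout. For \<open>r = 0\<close> equality can fail, as points
  need not be collinear.\<close>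

lemma hilb_saturated_lower_bound:
  fixes X :: "(nat, 'k::field) mpoly set"
  assumes inf: "infinite (UNIV :: 'k set)" and "hideal n X" "saturation n X = X"
    and "gotz_list n X (replicate d r)"
  shows "gotz 0 (replicate d r) t \<le> hilb n X t"
    and "r > 0 \<Longrightarrow> hilb n X t = gotz 0 (replicate d r) t"
proof -
  have "(\<forall>t. gotz 0 (replicate d r) t \<le> hilb n X t) \<and> (r > 0 \<longrightarrow> (\<forall>t. hilb n X t = gotz 0 (replicate d r) t))"
    using assms(2-)
  proof (induction r arbitrary: X)
    case 0
    have "\<forall>\<^sub>F t in sequentially. hilb n X t = gotz 0 (replicate d 0) t" using 0(3) by (simp add: gotz_list_def)
    then have "\<forall>\<^sub>F t in sequentially. hilb n X t = d"
      using eventually_ge_at_top[of d] by eventually_elim (simp add: gotz_replicate_0)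
    then show ?case using hilb_saturated_points[OF inf 0(1,2)] gotz_replicate_0_le_min order_trans by blast
  next
    case (Suc r)
    note X = Suc.prems(1,2)
    obtain l where l: "l \<in> forms n 1" "filter_regular n X l" "hilb n (adjoin n X l) 0 = hilb n X 0"
      "\<And>t. hilb n X (Suc t) = hilb n (adjoin n X l) (Suc t) + hilb n X t"
      using regular_form_exists[OF inf X] by metis
    note J = hideal_adjoin[OF X(1) l(1)]
    have "gotz_list n (adjoin n X l) (replicate d r)"
      using filter_regular_gotz_list[OF X(1) Suc.prems(3) l(1,2)] by (simp add: cut_dims_replicate)
    \<comment> \<open>The section need not be saturated, but its saturation has the same list and a
      Hilbert function that is no larger, so the lower bound carries over.\<close>
    then have "\<forall>t. gotz 0 (replicate d r) t \<le> hilb n (saturation n (adjoin n X l)) t"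
      using Suc.IH[OF hideal_saturation[OF J] saturation_idem[OF J]] gotz_list_saturation[OF J] by blast
    then have sec: "gotz 0 (replicate d r) t \<le> hilb n (adjoin n X l) t" for t
      using hilb_antimono[OF saturation_superset[OF J], of n t] order_trans by blast
    define D where "D t = int (hilb n X t) - int (gotz 0 (replicate d (Suc r)) t)" for t
    have "D t \<le> D (Suc t)" for t
      using sec[of "Suc t"] l(4)[of t] gotz_replicate_Suc[of 0 d r t] by (simp add: D_def)
    then have mono: "D s \<le> D t" if "s \<le> t" for s t using lift_Suc_mono_le[of D s t] that by blast
    have "D 0 \<ge> 0" using sec[of 0] l(3) gotz_at_0[of 0 d] by (simp add: D_def)
    then have pos: "D t \<ge> 0" for t using mono[of 0 t] by simp
    obtain N where N: "\<And>t. t \<ge> N \<Longrightarrow> D t = 0"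
      using Suc.prems(3) unfolding gotz_list_def eventually_sequentially D_def by fastforce
    have "D t = 0" for t using mono[of t "max N t"] N[of "max N t"] pos[of t] by simp
    then show ?case unfolding D_def by simp
  qed
  then show "gotz 0 (replicate d r) t \<le> hilb n X t" "r > 0 \<Longrightarrow> hilb n X t = gotz 0 (replicate d r) t" by blast+
qed

section \<open>Linear subspaces and hypersurfaces\<close>

text \<open>Ideals of \<open>k\<close> independent linear forms, built along a flag so that every
  step is governed by an exact sequence.\<close>

inductive linear_ideal :: "nat \<Rightarrow> nat \<Rightarrow> (nat, 'k::field) mpoly set \<Rightarrow> bool" for n where
  zero: "linear_ideal n 0 {0}"
| adjoin: "linear_ideal n k I \<Longrightarrow> l \<in> forms n 1 \<Longrightarrow> l \<notin> I \<Longrightarrow> linear_ideal n (Suc k) (adjoin n I l)"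

lemma linear_ideal_hideal: "linear_ideal n k I \<Longrightarrow> hideal n I"
  by (induction rule: linear_ideal.induct) (auto intro: hideal_zero hideal_adjoin)

lemma hilb_zero: "hilb n {0 :: (nat, 'k::field) mpoly} t = mono_count (Suc n) t"
proof -
  have "{0 :: (nat, 'k) mpoly} \<inter> forms n t = {0}" by auto
  moreover have "mp.dim {0 :: (nat, 'k) mpoly} = 0" using mp.dim_le_card[of "{0}" "{}"] by simp
  ultimately show ?thesis using card_monomials[of "{..n}" t] by (simp add: hilb_def dim_forms)
qed

lemma linear_ideal_low_degree:
  assumes "linear_ideal n k (I :: (nat, 'k::field) mpoly set)"
  shows "hilb n I 0 = 1" "hilb n I 1 + k = Suc n"
  using assms
proof (induction rule: linear_ideal.induct)
  case zero
  show "hilb n {0 :: (nat, 'k) mpoly} 0 = 1" "hilb n {0 :: (nat, 'k) mpoly} 1 + 0 = Suc n"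
    by (simp_all add: hilb_zero mono_count_degree_one[simplified])
next
  case (adjoin k I l)
  note I = linear_ideal_hideal[OF adjoin(1)]
  show "hilb n (adjoin n I l) 0 = 1" using hilb_adjoin_less[OF I adjoin(2), of 0] adjoin by simp
  have "hilb n (colon n I l) 0 \<le> 1"
    using hilb_antimono[of "{0}" "colon n I l" n 0] hideal_0[OF hideal_colon[OF I adjoin(2)]] by (simp add: hilb_zero)
  moreover have "hilb n (colon n I l) 0 \<noteq> 0"
  proof
    assume "hilb n (colon n I l) 0 = 0"
    then have "const 1 \<in> colon n I l"
      using hilb_eq_0_iff[OF hideal_colon[OF I adjoin(2)]] const_forms by blast
    then show False using adjoin(3) by (simp add: colon_def const_def)
  qed
  ultimately have "hilb n (colon n I l) 0 = 1" by linarith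
  then show "hilb n (adjoin n I l) 1 + Suc k = Suc n" using hilb_exact[OF I adjoin(2), of 1] adjoin by simp
qed

lemma hilb_le_sum_adjoin:
  assumes I: "hideal n I" and l: "l \<in> forms n 1"
  shows "hilb n I t \<le> (\<Sum>s\<le>t. hilb n (adjoin n I l) s)"
proof (induction t)
  case 0
  then show ?case using hilb_adjoin_less[OF I l, of 0] by simp
next
  case (Suc t)
  have "hilb n I (Suc t) = hilb n (adjoin n I l) (Suc t) + hilb n (colon n I l) t"
    using hilb_exact[OF I l, of "Suc t"] by simp
  moreover have "hilb n (colon n I l) t \<le> hilb n I t"
    by (rule hilb_antimono[OF colon_superset[OF I forms_polys[OF l]]])
  ultimately show ?case using Suc by simp
qed

text \<open>Induction moves towards the irrelevant ideal, where the bound is immediate: adjoining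
  one more linear form leaves one variable fewer, and summing the bound over the degrees restores
  the variable.\<close>

lemma linear_ideal_hilb_le: "linear_ideal n k I \<Longrightarrow> hilb n I t \<le> mono_count (Suc n - k) t"
proof (induction "Suc n - k" arbitrary: k I t)
  case 0
  then have "forms n 1 \<subseteq> I"
    using linear_ideal_low_degree[OF 0(2)] hilb_eq_0_iff[OF linear_ideal_hideal[OF 0(2)], of 1] by simp
  then have "hilb n I t = 0" if "t > 0"
    using forms_subset_later[OF linear_ideal_hideal[OF 0(2)], of 1 t] hilb_eq_0_iff[OF linear_ideal_hideal[OF 0(2)], of t] that
    by simp
  then show ?case using linear_ideal_low_degree(1)[OF 0(2)] by (cases t) auto
next
  case (Suc u)
  note I = linear_ideal_hideal[OF Suc.prems]
  have "hilb n I 1 \<noteq> 0" using linear_ideal_low_degree(2)[OF Suc.prems] Suc(2) by auto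
  then have "\<not> forms n 1 \<subseteq> I" using hilb_eq_0_iff[OF I, of 1] by simp
  then obtain l where l: "l \<in> forms n 1" "l \<notin> I" by blast
  have "hilb n I t \<le> (\<Sum>s\<le>t. hilb n (adjoin n I l) s)" by (rule hilb_le_sum_adjoin[OF I l(1)])
  also have "\<dots> \<le> (\<Sum>s\<le>t. mono_count (Suc n - Suc k) s)"
    using Suc(2) by (intro sum_mono Suc(1) linear_ideal.adjoin[OF Suc.prems l]) auto
  also have "\<dots> = mono_count (Suc n - k) t" using Suc(2) by (simp add: mono_count_sum Suc_diff_le[symmetric])
  finally show ?case .
qed

lemma linear_ideal_le: "linear_ideal n k I \<Longrightarrow> k \<le> Suc n"
  using linear_ideal_low_degree(2) by fastforce

text \<open>Both inequalities are propagated from \<open>\<Lambda> = {0}\<close>, where equality holds, along a flag.\<close>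

lemma linear_ideal_hilb: "linear_ideal n k I \<Longrightarrow> hilb n I t = mono_count (Suc n - k) t"
proof (induction arbitrary: t rule: linear_ideal.induct)
  case zero
  show ?case by (simp add: hilb_zero)
next
  case (adjoin k I l)
  note J = linear_ideal.adjoin[OF adjoin(1-3)]
  have k: "Suc n - k = Suc (Suc n - Suc k)" using linear_ideal_le[OF J] by simp
  have "(\<Sum>s\<le>t. mono_count (Suc n - Suc k) s) = hilb n I t"
    unfolding adjoin.IH k by (rule mono_count_sum)
  also have "\<dots> \<le> (\<Sum>s\<le>t. hilb n (adjoin n I l) s)"
    by (rule hilb_le_sum_adjoin[OF linear_ideal_hideal[OF adjoin(1)] adjoin(2)])
  finally have "(\<Sum>s\<le>t. mono_count (Suc n - Suc k) s) \<le> (\<Sum>s\<le>t. hilb n (adjoin n I l) s)" .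
  moreover have "(\<Sum>s<t. hilb n (adjoin n I l) s) \<le> (\<Sum>s<t. mono_count (Suc n - Suc k) s)"
    by (intro sum_mono linear_ideal_hilb_le[OF J])
  ultimately have "mono_count (Suc n - Suc k) t \<le> hilb n (adjoin n I l) t"
    by (simp flip: lessThan_Suc_atMost)
  then show ?case using linear_ideal_hilb_le[OF J, of t] by simp
qed

lemma linear_ideal_colon:
  assumes I: "linear_ideal n k I" and l: "l \<in> forms n 1" "l \<notin> I"
  shows "colon n I l = I"
proof -
  note hI = linear_ideal_hideal[OF I] and J = linear_ideal.adjoin[OF I l]
  have k: "Suc n - k = Suc (Suc n - Suc k)" using linear_ideal_le[OF J] by simp
  have "hilb n I t \<le> hilb n (colon n I l) t" for t
    using hilb_exact[OF hI l(1), of "Suc t"] linear_ideal_hilb[OF I] linear_ideal_hilb[OF J, of "Suc t"]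
      mono_count_Suc_Suc[of "Suc n - Suc k" t] by (simp add: k del: diff_Suc_Suc)
  then show ?thesis
    using hideal_eq_if_hilb_le[OF hI hideal_colon[OF hI l(1)] colon_superset[OF hI forms_polys[OF l(1)]]] by simp
qed

text \<open>No change of coordinates is made: starting from the irrelevant ideal, primality descends
  from I + (l) to \<open>I\<close>. If \<open>f * g \<in> I\<close>, one factor, say
  \<open>f\<close>, is \<open>f' * l\<close> modulo \<open>I\<close>; cancelling the nonzerodivisor
  \<open>l\<close> leaves \<open>f' * g \<in> I\<close> in smaller degree.\<close>

lemma linear_ideal_hprime: "linear_ideal n k I \<Longrightarrow> hprime n I"
proof (induction "Suc n - k" arbitrary: k I)
  case 0
  note I = linear_ideal_hideal[OF 0(2)]
  have "forms n 1 \<subseteq> I"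
    using linear_ideal_low_degree[OF 0(2)] hilb_eq_0_iff[OF I, of 1] 0(1) by simp
  then have sub: "forms n t \<subseteq> I" if "t > 0" for t using forms_subset_later[OF I, of 1 t] that by simp
  have one: "I \<noteq> polys n" using linear_ideal_low_degree(1)[OF 0(2)] hilb_eq_0_iff[OF I, of 0] forms_polys[of _ n 0] by auto
  show ?case
    unfolding hprime_def
  proof (intro conjI I one allI ballI impI)
    fix e e' f g assume fg: "f \<in> forms n e" "g \<in> forms n e'" "f * g \<in> I"
    show "f \<in> I \<or> g \<in> I"
    proof (cases "e = 0")
      case True
      then obtain c where c: "f = const c" using forms_degree_0 fg(1) by blast
      show ?thesis
      proof (cases "c = 0")
        case False
        have "cmul (1 / c) (f * g) \<in> I" by (rule hideal_cmul[OF I fg(3)])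
        then show ?thesis using False by (simp add: c const_mult)
      qed (use c hideal_0[OF I] in \<open>simp add: const_def\<close>)
    qed (use sub fg(1) in blast)
  qed
next
  case (Suc u)
  note I = linear_ideal_hideal[OF Suc.prems]
  have one: "I \<noteq> polys n"
    using linear_ideal_low_degree(1)[OF Suc.prems] hilb_eq_0_iff[OF I, of 0] forms_polys[of _ n 0] by auto
  have "hilb n I 1 \<noteq> 0" using linear_ideal_low_degree(2)[OF Suc.prems] Suc(2) by auto
  then have "\<not> forms n 1 \<subseteq> I" using hilb_eq_0_iff[OF I, of 1] by simp
  then obtain l where l: "l \<in> forms n 1" "l \<notin> I" by blast
  have J: "hprime n (adjoin n I l)"
    by (rule Suc(1)[OF _ linear_ideal.adjoin[OF Suc.prems l]]) (use Suc(2) in simp)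
  have reg: "f \<in> I" if "f * l \<in> I" "f \<in> polys n" for f
    using linear_ideal_colon[OF Suc.prems l] that by (auto simp: colon_def)
  have red: "\<exists>f'. f' \<in> forms n (e - 1) \<and> f - f' * l \<in> I \<and> e > 0" if f: "f \<in> forms n e" "f \<in> adjoin n I l" "f \<notin> I" for f e
  proof -
    have "e > 0"
    proof (rule ccontr)
      assume "\<not> e > 0"
      then have "hcomp 0 f = f" using hcomp_form[OF f(1), of 0] by simp
      moreover obtain a b where ab: "f = a + b * l" "a \<in> I" using f(2) by (auto simp: adjoin_def)
      moreover have "hcomp 0 (b * l) = 0" using hcomp_mult_form_less[OF l(1), of 0 b] by (simp add: mult.commute)
      ultimately have "f = hcomp 0 a" by (simp add: hcomp_add)
      then show False using hideal_hcomp[OF I ab(2)] f(3) by simp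
    qed
    then obtain a b where "a \<in> I" "b \<in> forms n (e - 1)" "f = a + b * l" "a \<in> forms n e"
      using adjoin_graded[OF I l(1) f(2,1)] by auto
    then show ?thesis using \<open>e > 0\<close> by (intro exI[of _ b]) simp
  qed
  have "f \<in> I \<or> g \<in> I" if "f \<in> forms n e" "g \<in> forms n e'" "f * g \<in> I" for e e' f g
    using that
  proof (induction "e + e'" arbitrary: e e' f g rule: less_induct)
    case less
    \<comment> \<open>The step for \<open>f\<close> in I + (l), with the induction hypothesis as a
      premise so that it also serves with the two factors exchanged.\<close>
    have *: "f \<in> I \<or> g \<in> I"
      if f: "f \<in> forms n e" and g: "g \<in> forms n e'" and fg: "f * g \<in> I" and fJ: "f \<in> adjoin n I l"
        and IH: "\<And>f'. f' \<in> forms n (e - 1) \<Longrightarrow> e > 0 \<Longrightarrow> f' * g \<in> I \<Longrightarrow> f' \<in> I \<or> g \<in> I" for f g e e'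
    proof (rule ccontr)
      assume nfg: "\<not> (f \<in> I \<or> g \<in> I)"
      then obtain f' where f': "f' \<in> forms n (e - 1)" "f - f' * l \<in> I" "e > 0" using red[OF f fJ] by blast
      have "(f' * g) * l = f * g - (f - f' * l) * g" by (simp add: algebra_simps)
      also have "\<dots> \<in> I" using hideal_diff[OF I fg hideal_mult'[OF I f'(2) forms_polys[OF g]]] .
      finally have "f' * g \<in> I" using reg polys_mult[OF forms_polys[OF f'(1)] forms_polys[OF g]] by blast
      then have "f' \<in> I" using IH[OF f'(1,3)] nfg by blast
      then have "f \<in> I" using hideal_add[OF I f'(2) hideal_mult'[OF I \<open>f' \<in> I\<close> forms_polys[OF l(1)]]] by simp
      then show False using nfg by blast
    qed
    have "f * g \<in> adjoin n I l" using less.prems(3) adjoin_superset by blast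
    then consider "f \<in> adjoin n I l" | "g \<in> adjoin n I l" using hprimeD[OF J _ less.prems(1,2)] by blast
    then show ?case
    proof cases
      case 1
      show ?thesis
      proof (rule *[OF less.prems 1])
        fix f' assume "f' \<in> forms n (e - 1)" "e > 0" "f' * g \<in> I"
        then show "f' \<in> I \<or> g \<in> I" using less.hyps[of "e - 1" e' f' g] less.prems(2) by simp
      qed
    next
      case 2
      have "g \<in> I \<or> f \<in> I"
      proof (rule *[OF less.prems(2,1) _ 2])
        show "g * f \<in> I" using less.prems(3) by (simp add: mult.commute)
        fix g' assume "g' \<in> forms n (e' - 1)" "e' > 0" "g' * f \<in> I"
        then show "g' \<in> I \<or> f \<in> I"
          using less.hyps[of e "e' - 1" f g'] less.prems(1) by (auto simp: mult.commute)
      qed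
      then show ?thesis by blast
    qed
  qed
  then show ?case unfolding hprime_def using I one by blast
qed

lemma hypersurface_hilb:
  assumes I: "linear_ideal n k I" and F: "F \<in> forms n d" "F \<notin> I"
  shows "hilb n (adjoin n I F) t + cone_count (Suc n - k) d t = mono_count (Suc n - k) t"
proof (cases "d \<le> t")
  case True
  then show ?thesis
    using hilb_exact[OF linear_ideal_hideal[OF I] F(1) True] colon_hprime[OF linear_ideal_hprime[OF I] F]
    by (simp add: linear_ideal_hilb[OF I] cone_count_def)
next
  case False
  then show ?thesis
    using hilb_adjoin_less[OF linear_ideal_hideal[OF I] F(1), of t] by (simp add: linear_ideal_hilb[OF I] cone_count_def)
qed

section \<open>The Hilbert function as a dimension of the quotient ring\<close>

lemma const_add: "const (a + b) = const a + const b"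
  and const_mult_const: "const (a * b) = const a * const b"
  and const_0: "const 0 = 0"
  and const_1: "const 1 = 1"
  by (simp_all add: const_def single_add mult_single)

lemma const_minus: "const (- c) = - const c"
  by (simp add: const_def single_uminus)

lemma a_inv_poly_ring: "p \<in> polys n \<Longrightarrow> \<ominus>\<^bsub>poly_ring n\<^esub> p = - p"
  using polys_uminus[of p n] by (intro poly_ring.minus_equality) auto

lemma a_minus_poly_ring: "p \<in> polys n \<Longrightarrow> q \<in> polys n \<Longrightarrow> p \<ominus>\<^bsub>poly_ring n\<^esub> q = p - q"
  by (simp add: a_minus_def a_inv_poly_ring)

lemma subfield_constants: "subfield (range const) (poly_ring n :: (nat, 'k::field) mpoly ring)"
proof (rule poly_ring.subfieldI)
  let ?K = "range const :: (nat, 'k) mpoly set"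
  show "subcring ?K (poly_ring n)"
  proof (rule poly_ring.subcringI'[OF poly_ring.subringI])
    show "\<one>\<^bsub>poly_ring n\<^esub> \<in> ?K" using const_1 by (metis one_poly_ring rangeI)
    fix p q :: "(nat, 'k) mpoly" assume "p \<in> ?K" "q \<in> ?K"
    then obtain a b where ab: "p = const a" "q = const b" by blast
    show "\<ominus>\<^bsub>poly_ring n\<^esub> p \<in> ?K" by (simp add: ab a_inv_poly_ring flip: const_minus)
    show "p \<otimes>\<^bsub>poly_ring n\<^esub> q \<in> ?K" "p \<oplus>\<^bsub>poly_ring n\<^esub> q \<in> ?K"
      by (simp_all add: ab flip: const_mult_const const_add)
  qed auto
  show "Units (poly_ring n\<lparr>carrier := ?K\<rparr>) = ?K - {\<zero>\<^bsub>poly_ring n\<^esub>}"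
  proof (intro equalityI subsetI)
    fix p assume "p \<in> Units (poly_ring n\<lparr>carrier := ?K\<rparr>)"
    then show "p \<in> ?K - {\<zero>\<^bsub>poly_ring n\<^esub>}" by (auto simp: Units_def)
  next
    fix p assume "p \<in> ?K - {\<zero>\<^bsub>poly_ring n\<^esub>}"
    then obtain c where c: "p = const c" "c \<noteq> 0" using const_0 by auto
    have "const (1 / c) * const c = (1 :: (nat, 'k) mpoly)" "const c * const (1 / c) = (1 :: (nat, 'k) mpoly)"
      using c(2) by (simp_all add: const_1 flip: const_mult_const)
    then show "p \<in> Units (poly_ring n\<lparr>carrier := ?K\<rparr>)"
      unfolding Units_def c(1) by (auto intro!: bexI[of _ "const (1 / c)"])
  qed
qed

lemma Span_poly_ring:
  "set Us \<subseteq> polys n \<Longrightarrow> ring.Span (poly_ring n) (range const) Us = mp.span (set Us)"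
proof (induction Us)
  case Nil
  then show ?case by (simp add: poly_ring.Span.simps)
next
  case (Cons u Us)
  then have IH: "poly_ring.Span n (range const) Us = mp.span (set Us)" by simp
  have "p \<in> poly_ring.Span n (range const) (u # Us) \<longleftrightarrow> (\<exists>c. p - cmul c u \<in> mp.span (set Us))" for p
  proof -
    have "p \<in> poly_ring.Span n (range const) (u # Us) \<longleftrightarrow> (\<exists>k\<in>range const. \<exists>v\<in>mp.span (set Us). p = k * u + v)"
      using poly_ring.line_extension_mem_iff[of p n "range const" u "poly_ring.Span n (range const) Us"] IH
      by (simp add: poly_ring.Span.simps)
    also have "\<dots> \<longleftrightarrow> (\<exists>c. p - cmul c u \<in> mp.span (set Us))"
      by (auto simp: cmul_def) (metis add_diff_cancel_left' diff_add_cancel add.commute)+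
    finally show ?thesis .
  qed
  then show ?case by (auto simp: mp.span_breakdown_eq)
qed

lemma independent_poly_ring_Cons:
  assumes "set (u # Us) \<subseteq> polys n"
  shows "ring.independent (poly_ring n) (range const) (u # Us)
    \<longleftrightarrow> u \<notin> mp.span (set Us) \<and> ring.independent (poly_ring n) (range const) Us"
  using poly_ring.independent.simps[of n "range const" "u # Us"] Span_poly_ring[of Us n] assms by auto

lemma quotient_rep_eq_iff:
  assumes "hideal n X" "a \<in> polys n" "b \<in> polys n"
  shows "X +>\<^bsub>poly_ring n\<^esub> a = X +>\<^bsub>poly_ring n\<^esub> b \<longleftrightarrow> a - b \<in> X"
  using poly_ring.quotient_eq_iff_same_a_r_cos[OF hideal_ideal[OF assms(1)], of a b] assms
  by (simp add: a_minus_poly_ring)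

text \<open>A basis \<open>D\<close> of the degree \<open>t\<close> part of \<open>X\<close> is
  extended to a basis \<open>B\<close> of the forms; the classes of \<open>B - D\<close> form a
  basis of the graded piece of the quotient. Properness of \<open>X\<close> makes the image of the
  constants a subfield.\<close>

theorem hilbert_function_eq:
  fixes X :: "(nat, 'k::field) mpoly set"
  assumes X: "hideal n X" "X \<noteq> polys n"
  shows "hilbert_function n X t = hilb n X t"
proof -
  note id = hideal_ideal[OF X(1)]
  interpret X: ideal X "poly_ring n" by (rule id)
  define Q where "Q = poly_ring n Quot X"
  define h where "h = (\<lambda>f. X +>\<^bsub>poly_ring n\<^esub> f)"
  interpret h: ring_hom_ring "poly_ring n" Q h
    unfolding Q_def h_def by (rule X.rcos_ring_hom_ring)
  have h_eq: "h a = h b \<longleftrightarrow> a - b \<in> X" if "a \<in> polys n" "b \<in> polys n" for a b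
    unfolding h_def using quotient_rep_eq_iff[OF X(1) that] .
  have one: "\<one>\<^bsub>Q\<^esub> \<noteq> \<zero>\<^bsub>Q\<^esub>"
  proof
    assume "\<one>\<^bsub>Q\<^esub> = \<zero>\<^bsub>Q\<^esub>"
    then have "h 1 = h 0" using h.hom_one h.hom_zero by simp
    then show False using h_eq[of 1 0] X(2) hideal_eq_polys_iff[OF X(1)] by simp
  qed
  note K = h.img_is_subfield(2)[OF subfield_constants one]
  have Span: "h.S.Span (h ` range const) (map h Us) = h ` mp.span (set Us)" if "set Us \<subseteq> polys n" for Us
    using that
  proof (induction Us)
    case Nil
    have "h 0 = \<zero>\<^bsub>Q\<^esub>" using h.hom_zero by simp
    then show ?case by simp
  next
    case (Cons u Us)
    have sub: "mp.span (set Us) \<subseteq> polys n"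
      using Cons.prems by (intro mp.span_minimal) (auto simp: mp.subspace_def intro: polys_add polys_cmul)
    have hom: "h (cmul c u + v) = h (const c) \<otimes>\<^bsub>Q\<^esub> h u \<oplus>\<^bsub>Q\<^esub> h v" if "v \<in> mp.span (set Us)" for c v
    proof -
      have v: "v \<in> polys n" using sub that by blast
      show ?thesis
        using h.hom_add[of "cmul c u" v] h.hom_mult[of "const c" u] v Cons.prems polys_cmul[of u n c]
        by (simp add: cmul_def)
    qed
    have "y \<in> h.S.Span (h ` range const) (map h (u # Us)) \<longleftrightarrow> y \<in> h ` mp.span (set (u # Us))" for y
    proof -
      have "y \<in> h.S.Span (h ` range const) (map h (u # Us))
          \<longleftrightarrow> (\<exists>c. \<exists>v\<in>mp.span (set Us). y = h (const c) \<otimes>\<^bsub>Q\<^esub> h u \<oplus>\<^bsub>Q\<^esub> h v)"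
        using h.S.line_extension_mem_iff[of y "h ` range const" "h u" "h.S.Span (h ` range const) (map h Us)"] Cons
        by auto
      also have "\<dots> \<longleftrightarrow> (\<exists>c. \<exists>v\<in>mp.span (set Us). y = h (cmul c u + v))"
        using hom by (simp cong: bex_cong)
      also have "\<dots> \<longleftrightarrow> y \<in> h ` mp.span (set (u # Us))"
      proof
        assume "\<exists>c. \<exists>v\<in>mp.span (set Us). y = h (cmul c u + v)"
        then obtain c v where cv: "v \<in> mp.span (set Us)" "y = h (cmul c u + v)" by blast
        then have "cmul c u + v \<in> mp.span (set (u # Us))"
          unfolding list.set mp.span_breakdown_eq by (intro exI[of _ c]) simp
        then show "y \<in> h ` mp.span (set (u # Us))" using cv(2) by blast
      next
        assume "y \<in> h ` mp.span (set (u # Us))"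
        then obtain p where p: "p \<in> mp.span (set (u # Us))" "y = h p" by blast
        then obtain c where "p - cmul c u \<in> mp.span (set Us)" unfolding list.set mp.span_breakdown_eq by blast
        then show "\<exists>c. \<exists>v\<in>mp.span (set Us). y = h (cmul c u + v)"
          using p(2) by (intro exI[of _ c] bexI[of _ "p - cmul c u"]) auto
      qed
      finally show ?thesis .
    qed
    then show ?case by blast
  qed
  let ?V = "X \<inter> forms n t"
  obtain D where D: "D \<subseteq> ?V" "finite D" "mp.independent D" "?V \<subseteq> mp.span D" "card D = mp.dim ?V"
    using mp.finite_basis[of ?V, OF _ finite_dim_forms(2)[of n t]] forms_span[of n t] by (metis Int_lower2)
  have "D \<subseteq> forms n t" using D(1) by blast
  then obtain B where B: "D \<subseteq> B" "B \<subseteq> forms n t" "mp.independent B" "forms n t \<subseteq> mp.span B"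
    using mp.maximal_independent_subset_extend[OF _ D(3)] by metis
  have finB: "finite B"
    using mp.independent_span_bound[OF finite_dim_forms(2)[of n t] B(3)] B(2) forms_span[of n t] by metis
  obtain Cs where Cs: "set Cs = B - D" "distinct Cs" using finite_distinct_list finB by (metis finite_Diff)
  have Cs_forms: "set Cs \<subseteq> forms n t" using Cs(1) B(2) by blast
  have indep: "h.S.independent (h ` range const) (map h Us)" if "distinct Us" "set Us \<subseteq> B - D" for Us
    using that
  proof (induction Us)
    case (Cons u Us)
    have u: "u \<in> forms n t" "set Us \<subseteq> forms n t" using Cons.prems B(2) by auto
    have "h u \<notin> h ` mp.span (set Us)"
    proof
      assume "h u \<in> h ` mp.span (set Us)"
      then obtain v where v: "v \<in> mp.span (set Us)" "h u = h v" by blast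
      have vf: "v \<in> forms n t" using mp.span_minimal[OF u(2) subspace_forms] v(1) by blast
      have "u - v \<in> ?V"
        using h_eq[OF forms_polys[OF u(1)] forms_polys[OF vf]] v(2) mp.subspace_diff[OF subspace_forms u(1) vf] by blast
      then have "(u - v) + v \<in> mp.span (D \<union> set Us)"
        using D(4) v(1) mp.span_mono[of D "D \<union> set Us"] mp.span_mono[of "set Us" "D \<union> set Us"]
        by (intro mp.span_add) auto
      moreover have "D \<union> set Us \<subseteq> B - {u}" using Cons.prems B(1) by auto
      ultimately have "u \<in> mp.span (B - {u})" using mp.span_mono[of "D \<union> set Us" "B - {u}"] by auto
      then show False using B(3) Cons.prems unfolding mp.dependent_def by auto
    qed
    moreover have "set Us \<subseteq> polys n" using u(2) forms_polys by blast
    ultimately have "h u \<notin> h.S.Span (h ` range const) (map h Us)" using Span[of Us] by simp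
    moreover have "h u \<in> carrier Q" using h.hom_closed[of u] forms_polys[OF u(1)] by simp
    moreover have "h.S.independent (h ` range const) (map h Us)" using Cons by simp
    ultimately show ?case using h.S.independent.intros(2)[of "h u" "h ` range const" "map h Us"] by simp
  qed simp
  have "h ` mp.span (set Cs) = h ` forms n t"
  proof (intro equalityI subsetI)
    fix y assume "y \<in> h ` mp.span (set Cs)"
    then show "y \<in> h ` forms n t" using mp.span_minimal[OF Cs_forms subspace_forms] by blast
  next
    fix y assume "y \<in> h ` forms n t"
    then obtain p where p: "p \<in> forms n t" "y = h p" by blast
    have "B = D \<union> set Cs" using B(1) Cs(1) by blast
    then have "p \<in> mp.span (D \<union> set Cs)" using p(1) B(4) by blast
    then obtain a b where ab: "a \<in> mp.span D" "b \<in> mp.span (set Cs)" "p = a + b" unfolding mp.span_Un by blast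
    have "a \<in> ?V" using ab(1) mp.span_minimal[OF D(1) subspace_graded[OF X(1)]] by blast
    moreover have "b \<in> forms n t" using ab(2) mp.span_minimal[OF Cs_forms subspace_forms] by blast
    ultimately have "h p = h b" using h_eq[of p b] p(1) ab(3) forms_polys by auto
    then show "y \<in> h ` mp.span (set Cs)" using p(2) ab(2) by blast
  qed
  moreover have "set Cs \<subseteq> polys n" using Cs_forms forms_polys by blast
  ultimately have "h.S.dimension (length (map h Cs)) (h ` range const) (h ` forms n t)"
    using h.S.dimension_independent[OF indep[OF Cs(2)]] Cs(1) Span[of Cs] by simp
  then have "h.S.dim (h ` range const) (h ` forms n t) = length (map h Cs)"
    using h.S.dimI[OF K] by (simp add: over_def)
  moreover have "length Cs = card B - card D"
    using Cs B(1) finB by (metis card_Diff_subset distinct_card finite_subset)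
  moreover have "card B = mp.dim (forms n t :: (nat, 'k) mpoly set)" using mp.basis_card_eq_dim[OF B(2,4,3)] .
  moreover have "range (\<lambda>c. h (const c)) = h ` range const" by blast
  moreover have "hilbert_function n X t = ring.dim Q (range (\<lambda>c. h (const c))) (h ` forms n t)"
    unfolding hilbert_function_def Q_def h_def by (rule refl)
  ultimately show ?thesis using D(5) by (simp add: hilb_def)
qed

section \<open>Sums of ideals\<close>

text \<open>With \<open>foldr\<close> the head of the list is adjoined last, so the tail gives the
  ideal that the head extends.\<close>

definition adjoins :: "nat \<Rightarrow> (nat, 'k::field) mpoly set \<Rightarrow> (nat, 'k) mpoly list \<Rightarrow> (nat, 'k) mpoly set" where
  "adjoins n I Ls = foldr (\<lambda>l J. adjoin n J l) Ls I"

lemma adjoins_simps [simp]: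
  "adjoins n I [] = I"
  "adjoins n I (l # Ls) = adjoin n (adjoins n I Ls) l"
  by (simp_all add: adjoins_def)

lemma adjoins_append: "adjoins n I (Ls @ Ms) = adjoins n (adjoins n I Ms) Ls"
  by (simp add: adjoins_def)

lemma hideal_adjoins: "hideal n I \<Longrightarrow> set Ls \<subseteq> forms n e \<Longrightarrow> hideal n (adjoins n I Ls)"
  by (induction Ls) (auto intro: hideal_adjoin)

lemma adjoins_superset: "I \<subseteq> adjoins n I Ls"
proof (induction Ls)
  case (Cons l Ls)
  then show ?case using adjoin_superset[of "adjoins n I Ls" n l] by auto
qed simp

lemma adjoins_mem: "hideal n I \<Longrightarrow> set Ls \<subseteq> forms n e \<Longrightarrow> set Ls \<subseteq> adjoins n I Ls"
proof (induction Ls)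
  case (Cons l Ls)
  then show ?case
    using adjoin_self[OF hideal_adjoins[of n I Ls e]] adjoin_superset[of "adjoins n I Ls" n l] by auto
qed simp

lemma adjoins_minimal: "hideal n J \<Longrightarrow> I \<subseteq> J \<Longrightarrow> set Ls \<subseteq> J \<Longrightarrow> adjoins n I Ls \<subseteq> J"
  by (induction Ls) (simp_all add: adjoin_minimal)

lemma genideal_eq_adjoins:
  assumes "set Ls \<subseteq> forms n e" shows "Idl\<^bsub>poly_ring n\<^esub> (set Ls) = adjoins n {0} Ls"
proof
  note J = hideal_adjoins[OF hideal_zero assms]
  show "Idl\<^bsub>poly_ring n\<^esub> (set Ls) \<subseteq> adjoins n {0} Ls"
    by (rule poly_ring.genideal_minimal[OF hideal_ideal[OF J] adjoins_mem[OF hideal_zero assms]])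
  have sub: "set Ls \<subseteq> carrier (poly_ring n)" using assms forms_polys by auto
  interpret G: ideal "Idl\<^bsub>poly_ring n\<^esub> (set Ls)" "poly_ring n" by (rule poly_ring.genideal_ideal[OF sub])
  have "adjoins n {0} Ms \<subseteq> Idl\<^bsub>poly_ring n\<^esub> (set Ls)" if "set Ms \<subseteq> set Ls" for Ms
    using that
  proof (induction Ms)
    case Nil
    then show ?case using G.zero_closed by simp
  next
    case (Cons l Ms)
    have "a + q * l \<in> Idl\<^bsub>poly_ring n\<^esub> (set Ls)" if "a \<in> adjoins n {0} Ms" "q \<in> polys n" for a q
      using G.a_closed[of a "q * l"] G.I_l_closed[of l q] that Cons poly_ring.genideal_self[OF sub] by auto
    then show ?case by (auto simp: adjoin_def)
  qed
  then show "adjoins n {0} Ls \<subseteq> Idl\<^bsub>poly_ring n\<^esub> (set Ls)" by simp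
qed

lemma set_add_poly_ring: "A <+>\<^bsub>poly_ring n\<^esub> B = {a + b |a b. a \<in> A \<and> b \<in> B}"
  unfolding set_add_def' by auto

lemma set_add_adjoins: "X <+>\<^bsub>poly_ring n\<^esub> adjoins n {0} Ls = adjoins n X Ls"
proof (induction Ls)
  case Nil
  then show ?case by (auto simp: set_add_poly_ring)
next
  case (Cons l Ls)
  have "adjoins n X (l # Ls) = {(a + b) + q * l |a b q. a \<in> X \<and> b \<in> adjoins n {0} Ls \<and> q \<in> polys n}"
    unfolding adjoins_simps Cons.IH[symmetric] adjoin_def set_add_poly_ring by blast
  also have "\<dots> = {a + (b + q * l) |a b q. a \<in> X \<and> b \<in> adjoins n {0} Ls \<and> q \<in> polys n}"
    by (simp only: add.assoc)
  also have "\<dots> = X <+>\<^bsub>poly_ring n\<^esub> adjoins n {0} (l # Ls)"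
    unfolding adjoins_simps adjoin_def set_add_poly_ring by blast
  finally show ?case by simp
qed

lemma scheme_inter_eq:
  "set Ls \<subseteq> forms n e \<Longrightarrow> scheme_inter n X (Idl\<^bsub>poly_ring n\<^esub> (set Ls)) = saturation n (adjoins n X Ls)"
  by (simp add: scheme_inter_def genideal_eq_adjoins set_add_adjoins)

lemma set_add_cgenideal: "\<Lambda> <+>\<^bsub>poly_ring n\<^esub> (PIdl\<^bsub>poly_ring n\<^esub> F) = adjoin n \<Lambda> F"
  unfolding set_add_poly_ring cgenideal_def adjoin_def by auto

lemma adjoin_commute: "adjoin n (adjoin n I f) g = adjoin n (adjoin n I g) f"
proof -
  have "adjoin n (adjoin n I f) g \<subseteq> adjoin n (adjoin n I g) f" for f g
  proof
    fix p assume "p \<in> adjoin n (adjoin n I f) g"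
    then obtain a q q' where "p = (a + q * f) + q' * g" "a \<in> I" "q \<in> polys n" "q' \<in> polys n"
      unfolding adjoin_def by blast
    then have "p = (a + q' * g) + q * f" "a + q' * g \<in> adjoin n I g" "q \<in> polys n"
      by (auto simp: adjoin_def add_ac)
    then show "p \<in> adjoin n (adjoin n I g) f" unfolding adjoin_def[of n "adjoin n I g"] by blast
  qed
  then show ?thesis by blast
qed

lemma adjoins_adjoin: "adjoins n (adjoin n I f) Ls = adjoin n (adjoins n I Ls) f"
  by (induction Ls) (simp_all add: adjoin_commute)

lemma adjoins_degree_one:
  assumes "set Ls \<subseteq> forms n 1"
  shows "adjoins n {0} Ls \<inter> forms n 1 = mp.span (set Ls)"
proof
  note J = hideal_adjoins[OF hideal_zero assms]
  show "mp.span (set Ls) \<subseteq> adjoins n {0} Ls \<inter> forms n 1"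
    using adjoins_mem[OF hideal_zero assms] assms by (intro mp.span_minimal subspace_graded[OF J]) blast
  show "adjoins n {0} Ls \<inter> forms n 1 \<subseteq> mp.span (set Ls)"
    using assms
  proof (induction Ls)
    case (Cons l Ls)
    show ?case
    proof
      fix p assume p: "p \<in> adjoins n {0} (l # Ls) \<inter> forms n 1"
      have l: "l \<in> forms n 1" and Ls: "set Ls \<subseteq> forms n 1" using Cons.prems by auto
      obtain a b where ab: "a \<in> adjoins n {0} Ls" "b \<in> forms n (1 - 1)" "p = a + b * l" "a \<in> forms n 1"
        using adjoin_graded[OF hideal_adjoins[OF hideal_zero Ls] l, of p 1] p by auto
      then obtain c where c: "b = const c" using forms_degree_0 by auto
      have "p - cmul c l = a" using ab(3) by (simp add: c const_mult)
      then have "p - cmul c l \<in> mp.span (set Ls)" using Cons.IH[OF Ls] ab(1,4) by auto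
      then show "p \<in> mp.span (set (l # Ls))" unfolding list.set mp.span_breakdown_eq by blast
    qed
  qed (auto simp: mp.span_empty)
qed

text \<open>\<open>k\<close> is the rank of \<open>Ls\<close>. Dependent lists are included because
  the open condition on frames has to be decided for all tuples of linear forms.\<close>

lemma linear_ideal_adjoins:
  assumes "set Ls \<subseteq> forms n 1"
  shows "\<exists>k\<le>length Ls. linear_ideal n k (adjoins n {0} Ls) \<and>
           (k = length Ls \<longleftrightarrow> ring.independent (poly_ring n) (range const) Ls)"
  using assms
proof (induction Ls)
  case Nil
  show ?case by (auto intro: linear_ideal.zero)
next
  case (Cons l Ls)
  then have l: "l \<in> forms n 1" and Ls: "set Ls \<subseteq> forms n 1" by auto
  obtain k where k: "k \<le> length Ls" "linear_ideal n k (adjoins n {0} Ls)"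
    "k = length Ls \<longleftrightarrow> ring.independent (poly_ring n) (range const) Ls" using Cons by auto
  have pol: "set (l # Ls) \<subseteq> polys n" using Cons.prems forms_polys by blast
  have mem: "l \<in> adjoins n {0} Ls \<longleftrightarrow> l \<in> mp.span (set Ls)" using adjoins_degree_one[OF Ls] l by blast
  show ?case
  proof (cases "l \<in> adjoins n {0} Ls")
    case True
    have "adjoin n (adjoins n {0} Ls) l = adjoins n {0} Ls"
      using adjoin_superset adjoin_minimal[OF linear_ideal_hideal[OF k(2)] order_refl True] by blast
    moreover have "\<not> ring.independent (poly_ring n) (range const) (l # Ls)"
      using independent_poly_ring_Cons[OF pol] mem True by blast
    ultimately show ?thesis using k by (intro exI[of _ k]) auto
  next
    case False
    have "linear_ideal n (Suc k) (adjoins n {0} (l # Ls))" using linear_ideal.adjoin[OF k(2) l False] by simp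
    then show ?thesis using k independent_poly_ring_Cons[OF pol] mem False by (intro exI[of _ "Suc k"]) auto
  qed
qed

lemma linear_subspace_linear_ideal:
  assumes "linear_subspace n m \<Lambda>" shows "linear_ideal n (n - m) \<Lambda>"
proof -
  obtain Ls where Ls: "Ls \<in> linear_frames n m" "\<Lambda> = Idl\<^bsub>poly_ring n\<^esub> (set Ls)"
    using assms by (auto simp: linear_subspace_def)
  then have *: "set Ls \<subseteq> forms n 1" "length Ls = n - m" "ring.independent (poly_ring n) (range const) Ls"
    by (simp_all add: linear_frames_def)
  then show ?thesis using linear_ideal_adjoins[OF *(1)] genideal_eq_adjoins[OF *(1)] Ls(2) by auto
qed

section \<open>Invariants of a scheme from its Gotzmann representation\<close>

context
  fixes n :: nat and X :: "(nat, 'k::field) mpoly set" and as :: "nat list"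
  assumes X: "hideal n X" and as: "gotz_list n X as" and nonempty: "as \<noteq> []"
begin

lemma proper_if_gotz_list: "X \<noteq> polys n"
proof
  assume eq: "X = polys n"
  have "forms n t \<subseteq> X" for t unfolding eq using forms_polys by blast
  then have "hilb n X t = 0" for t using hilb_eq_0_iff[OF X] by simp
  then have "gotz_list n X []" by (simp add: gotz_list_def)
  then show False using gotz_list_unique[OF as] nonempty by blast
qed

lemma hilbert_function_gotz: "\<forall>\<^sub>F t in sequentially. hilbert_function n X t = gotz 0 as t"
  using as hilbert_function_eq[OF X proper_if_gotz_list] by (simp add: gotz_list_def)

lemma scheme_dim_gotz: "scheme_dim n X = int (hd as)"
  using scheme_dim_eq[OF X] hlist_eqI[OF as] nonempty by (simp add: hdim_def gotz_dim_def)

lemma gotzmann_number_gotz: "gotzmann_number n X = length as"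
proof -
  have "gotzmann_differences n X = as"
    unfolding gotzmann_differences_def
  proof (rule the_equality)
    show ev: "\<forall>\<^sub>F d in sequentially. macaulay_differences d (hilbert_function n X d) = as"
      using hilbert_function_gotz eventually_ge_at_top[of "length as"]
      by eventually_elim (simp add: macaulay_differences_gotz[OF nonempty gotz_list_sorted[OF as]])
    fix M assume "\<forall>\<^sub>F d in sequentially. macaulay_differences d (hilbert_function n X d) = M"
    with ev have "\<forall>\<^sub>F d in sequentially. M = as" by eventually_elim simp
    then show "M = as" by simp
  qed
  then show ?thesis by (simp add: gotzmann_number_def)
qed

lemma hilbert_polynomial_gotz: "hilbert_polynomial n X = gotz_poly 0 as"
  unfolding hilbert_polynomial_def
proof (rule the_equality)
  show ev: "\<forall>\<^sub>F d in sequentially. poly (gotz_poly 0 as) (of_nat d) = of_nat (hilbert_function n X d)"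
    using hilbert_function_gotz eventually_ge_at_top[of "length as"]
    by eventually_elim (simp add: poly_gotz_poly)
  fix P :: "rat poly" assume "\<forall>\<^sub>F d in sequentially. poly P (of_nat d) = of_nat (hilbert_function n X d)"
  with ev have "\<forall>\<^sub>F d in sequentially. poly (P - gotz_poly 0 as) (of_nat d) = 0" by eventually_elim simp
  then obtain N where N: "\<And>d. d \<ge> N \<Longrightarrow> poly (P - gotz_poly 0 as) (of_nat d) = 0"
    by (auto simp: eventually_sequentially)
  have "infinite ((of_nat :: nat \<Rightarrow> rat) ` {N..})"
    by (subst finite_image_iff) (auto simp: inj_on_def infinite_Ici)
  moreover have "(of_nat :: nat \<Rightarrow> rat) ` {N..} \<subseteq> {x. poly (P - gotz_poly 0 as) x = 0}" using N by auto
  ultimately have "infinite {x. poly (P - gotz_poly 0 as) x = 0}" using infinite_super by blast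
  then show "P = gotz_poly 0 as" using poly_roots_finite[of "P - gotz_poly 0 as"] by auto
qed

lemma scheme_degree_gotz: "scheme_degree n X = of_nat (count_list as (hd as))"
proof -
  have "a \<le> hd as" if "a \<in> set as" for a
    using that gotz_list_sorted[OF as] by (cases as) auto
  then show ?thesis
    using coeff_gotz_poly[of as "hd as" 0] by (simp add: scheme_degree_def scheme_dim_gotz hilbert_polynomial_gotz)
qed

lemma arithmetic_genus_gotz: "arithmetic_genus n X = (-1) ^ hd as * (poly (gotz_poly 0 as) 0 - 1)"
  by (simp add: arithmetic_genus_def scheme_dim_gotz hilbert_polynomial_gotz)

end

lemma arithmetic_genus_hypersurface:
  assumes "hideal n X" "gotz_list n X (replicate d r)" "d > 0"
  shows "arithmetic_genus n X = of_nat ((d - 1) choose (r + 1))"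
  using arithmetic_genus_gotz[OF assms(1,2)] assms(3) poly_gotz_poly_at_0[OF assms(3), of r]
  by simp

section \<open>Repeated sections and the genus\<close>

lemma cut_dims_append_replicate: "cut_dims (replicate d (Suc r) @ bs) = replicate d r @ cut_dims bs"
  by (induction d) auto

lemma count_cut_dims:
  "sorted_wrt (\<ge>) bs \<Longrightarrow> count_list (cut_dims bs) i = count_list bs (Suc i)"
proof (induction bs rule: cut_dims.induct)
  case (2 bs)
  then have "Suc i \<notin> set bs" by auto
  then show ?case by simp
qed auto

text \<open>After \<open>i\<close> cuts the entries of \<open>bs\<close> below \<open>i\<close> have
  disappeared and those equal to \<open>i\<close> have become 0.\<close>

lemma funpow_cut_dims:
  "sorted_wrt (\<ge>) bs \<Longrightarrow> (\<And>b. b \<in> set bs \<Longrightarrow> b \<le> i) \<Longrightarrow> i \<le> r \<Longrightarrow>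
     (cut_dims ^^ i) (replicate d r @ bs) = replicate d (r - i) @ replicate (count_list bs i) 0"
proof (induction i arbitrary: r bs)
  case 0
  then have "bs = replicate (length bs) 0" by (intro replicate_eqI) auto
  moreover have "count_list (replicate k (0 :: nat)) 0 = k" for k by (induction k) auto
  then have "count_list bs 0 = length bs" using calculation by metis
  ultimately show ?case by simp
next
  case (Suc i)
  then obtain r' where r: "r = Suc r'" by (metis Suc_le_D)
  have "(cut_dims ^^ Suc i) (replicate d r @ bs) = (cut_dims ^^ i) (replicate d r' @ cut_dims bs)"
    by (simp add: funpow_Suc_right r cut_dims_append_replicate del: funpow.simps)
  also have "\<dots> = replicate d (r' - i) @ replicate (count_list (cut_dims bs) i) 0"
    using Suc.prems r by (intro Suc.IH sorted_cut_dims) (auto dest!: cut_dims_set)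
  finally show ?case using count_cut_dims[OF Suc.prems(1)] r by simp
qed

lemma sorted_split_top:
  fixes as :: "nat list"
  assumes "sorted_wrt (\<ge>) as" "as \<noteq> []"
  obtains bs where "as = replicate (count_list as (hd as)) (hd as) @ bs" "sorted_wrt (\<ge>) bs" "\<And>b. b \<in> set bs \<Longrightarrow> b < hd as"
proof -
  have "\<exists>bs. as = replicate (count_list as r) r @ bs \<and> sorted_wrt (\<ge>) bs \<and> (\<forall>b\<in>set bs. b < r)"
    if "sorted_wrt (\<ge>) as" "\<And>a. a \<in> set as \<Longrightarrow> a \<le> r" for as and r :: nat
    using that
  proof (induction as)
    case (Cons a as)
    then obtain bs where bs: "as = replicate (count_list as r) r @ bs" "sorted_wrt (\<ge>) bs" "\<forall>b\<in>set bs. b < r" by auto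
    show ?case
    proof (cases "a = r")
      case True
      then show ?thesis using bs by (intro exI[of _ bs]) simp
    next
      case False
      then have "a < r" using Cons.prems(2)[of a] by simp
      then have lt: "\<forall>b\<in>set (a # as). b < r" using Cons.prems(1) by auto
      then have "count_list (a # as) r = 0" by (intro count_notin) auto
      then show ?thesis using lt Cons.prems(1) by (intro exI[of _ "a # as"]) (simp del: count_list.simps)
    qed
  qed simp
  moreover have "a \<le> hd as" if "a \<in> set as" for a using that assms by (cases as) auto
  ultimately show thesis using that assms(1) by blast
qed

text \<open>The lower dimensional part of the Gotzmann list is removed from the top: cutting down to its
  largest entry \<open>b\<close> leaves a hypersurface list and some zeros, which the arithmetic genus counts.\<close>

lemma gotz_list_eq_replicate_if_genus:
  assumes sorted: "sorted_wrt (\<ge>) as" and "as \<noteq> []" and d: "d = count_list as (hd as)"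
    and genus: "\<And>i. i < hd as \<Longrightarrow>
      (-1) ^ (hd as - i) * (poly (gotz_poly 0 ((cut_dims ^^ i) as)) 0 - 1) = of_nat ((d - 1) choose (hd as - i + 1))"
  shows "as = replicate d (hd as)"
proof (rule ccontr)
  let ?r = "hd as"
  assume neq: "as \<noteq> replicate d ?r"
  have d0: "d > 0" using \<open>as \<noteq> []\<close> by (cases as) (auto simp: d)
  obtain bs where bs: "as = replicate d ?r @ bs" "sorted_wrt (\<ge>) bs" "\<And>b. b \<in> set bs \<Longrightarrow> b < ?r"
    using sorted_split_top[OF assms(1,2)] unfolding d by blast
  have "bs \<noteq> []" using neq bs(1) by auto
  then obtain b cs where b: "bs = b # cs" by (cases bs) auto
  have bmax: "x \<le> b" if "x \<in> set bs" for x using that bs(2) by (auto simp: b)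
  have br: "b < ?r" using bs(3) by (simp add: b)
  define e where "e = count_list bs b"
  have "(cut_dims ^^ b) as = replicate d (?r - b) @ replicate e 0"
    using funpow_cut_dims[OF bs(2) bmax, of ?r d] br bs(1) by (simp add: e_def)
  then have "poly (gotz_poly 0 ((cut_dims ^^ b) as)) 0 - 1 = (-1) ^ (?r - b) * of_nat ((d - 1) choose Suc (?r - b)) + of_nat e"
    by (simp add: gotz_poly_append poly_gotz_poly_replicate_0 poly_gotz_poly_at_0[OF d0])
  with genus[OF br] have "(-1) ^ (?r - b) * (of_nat e :: rat) = 0"
    by (simp add: distrib_left)
  then show False by (simp add: e_def b)
qed

section \<open>Open conditions on the coefficients of linear forms\<close>

definition eval_monom :: "('v \<Rightarrow> 'k::field) \<Rightarrow> ('v \<Rightarrow>\<^sub>0 nat) \<Rightarrow> 'k" where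
  "eval_monom a m = (\<Prod>v \<in> keys m. a v ^ lookup m v)"

lemma eval_mpoly_alt: "eval_mpoly a p = (\<Sum>m \<in> keys p. lookup p m * eval_monom a m)"
  by (simp add: eval_mpoly_def eval_monom_def)

lemma eval_monom_superset:
  assumes "finite V" "keys m \<subseteq> V"
  shows "eval_monom a m = (\<Prod>v\<in>V. a v ^ lookup m v)"
  unfolding eval_monom_def using assms by (intro prod.mono_neutral_left) (auto simp: in_keys_iff)

lemma eval_monom_add: "eval_monom a (m + m') = eval_monom a m * eval_monom a m'"
proof -
  let ?V = "keys m \<union> keys m'"
  have "keys (m + m') \<subseteq> ?V" by (rule Poly_Mapping.keys_add)
  then show ?thesis
    using eval_monom_superset[of ?V m a] eval_monom_superset[of ?V m' a] eval_monom_superset[of ?V "m + m'" a]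
    by (simp add: lookup_add power_add prod.distrib)
qed

lemma eval_mpoly_0 [simp]: "eval_mpoly a 0 = 0"
  by (simp add: eval_mpoly_def)

lemma eval_mpoly_single: "eval_mpoly a (single m c) = c * eval_monom a m"
  by (simp add: eval_mpoly_alt)

lemma eval_mpoly_add: "eval_mpoly a (p + q) = eval_mpoly a p + eval_mpoly a q"
  unfolding eval_mpoly_alt by (rule setsum_keys_plus_distrib) (simp_all add: distrib_right)

lemma eval_mpoly_sum: "eval_mpoly a (sum f A) = (\<Sum>i\<in>A. eval_mpoly a (f i))"
  by (induction A rule: infinite_finite_induct) (simp_all add: eval_mpoly_add)

lemma eval_mpoly_diff: "eval_mpoly a (p - q) = eval_mpoly a p - eval_mpoly a q"
  using eval_mpoly_add[of a "p - q" q] by simp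

lemma eval_mpoly_mult: "eval_mpoly a (p * q) = eval_mpoly a p * eval_mpoly a q"
proof -
  let ?s = "\<lambda>p m. single m (lookup p m)"
  have "p * q = (\<Sum>m\<in>keys p. \<Sum>m'\<in>keys q. ?s p m * ?s q m')"
    using sum_singles[of p] sum_singles[of q] by (metis (no_types, lifting) sum.cong sum_product)
  then show ?thesis
    by (simp add: eval_mpoly_sum mult_single eval_mpoly_single eval_monom_add eval_mpoly_alt[of a p]
        eval_mpoly_alt[of a q] sum_product mult_ac)
qed

lemma eval_mpoly_const [simp]: "eval_mpoly a (const c) = c"
  by (simp add: const_def eval_mpoly_single eval_monom_def)

lemma eval_mpoly_1 [simp]: "eval_mpoly a 1 = 1"
  using eval_mpoly_const[of a 1] by (simp add: const_1)

definition var :: "'v \<Rightarrow> ('v, 'k::field) mpoly" where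
  "var v = single (single v 1) 1"

lemma eval_mpoly_var [simp]: "eval_mpoly a (var v) = a v"
  by (simp add: var_def eval_mpoly_single eval_monom_def)

lemma polys_in_mult: "p \<in> polys_in V \<Longrightarrow> q \<in> polys_in V \<Longrightarrow> p * q \<in> polys_in V"
  for p q :: "('v, 'k::field) mpoly"
  using keys_mult[of p q] by (fastforce simp: polys_in_def keys_add_nat)

lemma polys_in_diff: "p \<in> polys_in V \<Longrightarrow> q \<in> polys_in V \<Longrightarrow> p - q \<in> polys_in V"
  for p q :: "('v, 'k::field) mpoly"
proof -
  have "keys (p - q) \<subseteq> keys p \<union> keys q"
    by (auto simp: in_keys_iff lookup_minus)
  then show "p \<in> polys_in V \<Longrightarrow> q \<in> polys_in V \<Longrightarrow> p - q \<in> polys_in V" unfolding polys_in_def by blast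
qed

lemma polys_in_add: "p \<in> polys_in V \<Longrightarrow> q \<in> polys_in V \<Longrightarrow> p + q \<in> polys_in V"
  for p q :: "('v, 'k::field) mpoly"
  using Poly_Mapping.keys_add[of p q] by (auto simp: polys_in_def)

lemma polys_in_sum: "(\<And>i. i \<in> A \<Longrightarrow> f i \<in> polys_in V) \<Longrightarrow> sum f A \<in> polys_in V"
  for f :: "'i \<Rightarrow> ('v, 'k::field) mpoly"
proof (induction A rule: infinite_finite_induct)
  case (insert i A)
  then show ?case by (simp add: polys_in_add)
qed (simp_all add: polys_in_def)

lemma polys_in_const: "const c \<in> polys_in V"
  by (auto simp: polys_in_def const_def split: if_splits)

lemma polys_in_var: "v \<in> V \<Longrightarrow> var v \<in> polys_in V"
  by (auto simp: polys_in_def var_def split: if_splits)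

text \<open>On a line the condition becomes a polynomial in one variable, with finitely many roots
  unless it is 0; this connects open sets of frames to \<open>lin_generic\<close>.\<close>

lemma eval_mpoly_line: "\<exists>P. \<forall>c. poly P c = eval_mpoly (\<lambda>v. a v + c * b v) f"
proof
  show "\<forall>c. poly (\<Sum>m \<in> keys f. Polynomial.smult (lookup f m)
      (\<Prod>v \<in> keys m. [:a v, b v:] ^ lookup m v)) c = eval_mpoly (\<lambda>v. a v + c * b v) f"
    by (simp add: eval_mpoly_def poly_sum poly_prod)
qed

section \<open>Linear independence of lists and elimination\<close>

definition lincomb :: "'k::field list \<Rightarrow> ('v, 'k) mpoly list \<Rightarrow> ('v, 'k) mpoly" where
  "lincomb cs ps = sum_list (map2 cmul cs ps)"

lemma lincomb_simps [simp]: "lincomb [] ps = 0" "lincomb cs [] = 0" "lincomb (c # cs) (p # ps) = cmul c p + lincomb cs ps"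
  by (simp_all add: lincomb_def)

text \<open>A property of lists, in which a repeated entry counts as a dependence.\<close>

definition lin_indep :: "('v, 'k::field) mpoly list \<Rightarrow> bool" where
  "lin_indep ps \<longleftrightarrow> (\<forall>cs. length cs = length ps \<longrightarrow> lincomb cs ps = 0 \<longrightarrow> set cs \<subseteq> {0})"

lemma lincomb_scale: "lincomb (map ((*) c) cs) ps = cmul c (lincomb cs ps)"
  by (induction cs ps rule: list_induct2') (simp_all add: mp.scale_right_distrib)

lemma span_eq_lincomb: "mp.span (set ps) = {lincomb cs ps |cs. length cs = length ps}"
proof (induction ps)
  case (Cons p ps)
  have "x \<in> mp.span (set (p # ps)) \<longleftrightarrow> (\<exists>c cs. length cs = length ps \<and> x = cmul c p + lincomb cs ps)" for x
    unfolding list.set mp.span_breakdown_eq Cons.IH by (auto simp: diff_eq_eq add.commute)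
  also have "\<dots> x \<longleftrightarrow> (\<exists>cs. length cs = length (p # ps) \<and> x = lincomb cs (p # ps))" for x
    by (metis (no_types, lifting) length_Cons length_Suc_conv lincomb_simps(3))
  finally show ?case by blast
qed (simp add: mp.span_empty)

lemma lin_indep_Cons: "lin_indep (p # ps) \<longleftrightarrow> p \<notin> mp.span (set ps) \<and> lin_indep ps"
proof (intro iffI conjI notI)
  assume ind: "lin_indep (p # ps)"
  { assume "p \<in> mp.span (set ps)"
    then obtain cs where cs: "length cs = length ps" "p = lincomb cs ps" unfolding span_eq_lincomb by blast
    then have "lincomb (- 1 # cs) (p # ps) = 0" by simp
    then show False using ind[unfolded lin_indep_def, rule_format, of "- 1 # cs"] cs(1) by simp }
  show "lin_indep ps"
    unfolding lin_indep_def
  proof (intro allI impI)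
    fix cs assume "length cs = length ps" "lincomb cs ps = 0"
    then show "set cs \<subseteq> {0}" using ind[unfolded lin_indep_def, rule_format, of "0 # cs"] by simp
  qed
next
  assume *: "p \<notin> mp.span (set ps) \<and> lin_indep ps"
  show "lin_indep (p # ps)"
    unfolding lin_indep_def
  proof (intro allI impI)
    fix ds assume "length ds = length (p # ps)" "lincomb ds (p # ps) = 0"
    then obtain c cs where cs: "ds = c # cs" "length cs = length ps" "cmul c p + lincomb cs ps = 0"
      by (cases ds) auto
    have "c = 0"
    proof (rule ccontr)
      assume "c \<noteq> 0"
      have "cmul c p = cmul (- 1) (lincomb cs ps)" using cs(3) by (simp add: eq_neg_iff_add_eq_0)
      then have "cmul (1 / c) (cmul c p) = cmul (1 / c) (cmul (- 1) (lincomb cs ps))" by simp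
      then have "p = cmul (- 1 / c) (lincomb cs ps)" using \<open>c \<noteq> 0\<close> by simp
      moreover have "lincomb cs ps \<in> mp.span (set ps)" unfolding span_eq_lincomb using cs(2) by blast
      ultimately show False using * mp.span_scale by metis
    qed
    then show "set ds \<subseteq> {0}" using cs * unfolding lin_indep_def by auto
  qed
qed

lemma lin_indep_iff: "lin_indep ps \<longleftrightarrow> distinct ps \<and> mp.independent (set ps)"
proof (induction ps)
  case Nil
  show ?case by (simp add: lin_indep_def mp.independent_empty)
next
  case (Cons p ps)
  show ?case unfolding lin_indep_Cons Cons by (auto simp: mp.independent_insert mp.span_base)
qed

text \<open>Cross-multiplication clears the coefficient of \<open>q\<close> at \<open>m\<close>
  without division, so the result stays polynomial in the coefficients.\<close>

definition eliminate :: "('v \<Rightarrow>\<^sub>0 nat) \<Rightarrow> ('v, 'k::field) mpoly \<Rightarrow> ('v, 'k) mpoly \<Rightarrow> ('v, 'k) mpoly" where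
  "eliminate m p q = cmul (lookup p m) q - cmul (lookup q m) p"

lemma keys_eliminate: "keys (eliminate m p q) \<subseteq> keys p \<union> keys q"
  by (auto simp: eliminate_def in_keys_iff lookup_minus)

lemma lincomb_eliminate:
  "lincomb cs (map (eliminate m p) ps) = eliminate m p (lincomb cs ps)"
proof (induction cs ps rule: list_induct2')
  case (4 c cs p' ps)
  show ?case unfolding list.map lincomb_simps 4
    by (intro poly_mapping_eqI) (simp add: eliminate_def lookup_add lookup_minus algebra_simps)
qed (simp_all add: eliminate_def)

lemma lin_indep_eliminate:
  assumes nz: "lookup p m \<noteq> 0"
  shows "lin_indep (p # ps) \<longleftrightarrow> lin_indep (map (eliminate m p) ps)"
proof
  assume ind: "lin_indep (p # ps)"
  show "lin_indep (map (eliminate m p) ps)"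
    unfolding lin_indep_def
  proof (intro allI impI)
    fix cs assume cs: "length cs = length (map (eliminate m p) ps)" "lincomb cs (map (eliminate m p) ps) = 0"
    define x where "x = lincomb cs ps"
    have "lincomb (- lookup x m # map ((*) (lookup p m)) cs) (p # ps) = eliminate m p x"
      by (intro poly_mapping_eqI) (simp add: lincomb_scale x_def[symmetric] eliminate_def lookup_add lookup_minus)
    also have "\<dots> = 0" using cs(2) by (simp add: lincomb_eliminate x_def)
    finally have "set (- lookup x m # map ((*) (lookup p m)) cs) \<subseteq> {0}"
      using ind[unfolded lin_indep_def, rule_format, of "- lookup x m # map ((*) (lookup p m)) cs"] cs(1)
      by simp
    then show "set cs \<subseteq> {0}" using nz by auto
  qed
next
  assume ind: "lin_indep (map (eliminate m p) ps)"
  show "lin_indep (p # ps)"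
    unfolding lin_indep_def
  proof (intro allI impI)
    fix ds assume "length ds = length (p # ps)" "lincomb ds (p # ps) = 0"
    then obtain c cs where cs: "ds = c # cs" "length cs = length ps" "cmul c p + lincomb cs ps = 0"
      by (cases ds) auto
    then have x: "lincomb cs ps = cmul (- c) p" by (simp add: eq_neg_iff_add_eq_0 add.commute)
    have "lincomb cs (map (eliminate m p) ps) = 0"
      unfolding lincomb_eliminate x by (intro poly_mapping_eqI) (simp add: eliminate_def lookup_minus)
    then have "set cs \<subseteq> {0}" using ind cs(2) unfolding lin_indep_def by simp
    moreover from this have "lincomb cs ps = 0" by (induction cs ps rule: list_induct2') auto
    then have "cmul c p = 0" using cs(3) by simp
    then have "c = 0" using nz by (metis lookup_cmul lookup_zero mult_eq_0_iff)
    ultimately show "set ds \<subseteq> {0}" using cs(1) by simp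
  qed
qed

text \<open>Polynomials whose non-vanishing expresses that a family of vectors, with polynomials in the
  parameters as coordinates, is linearly independent; obtained by fraction-free Gaussian elimination.\<close>

function indep_polys :: "'i set \<Rightarrow> ('i \<Rightarrow> ('w, 'k::field) mpoly) list \<Rightarrow> ('w, 'k) mpoly set" where
  "indep_polys T [] = {1}"
| "indep_polys T (v # vs) =
     (\<Union>m\<in>T. (*) (v m) ` indep_polys T (map (\<lambda>w i. v m * w i - w m * v i) vs))"
  by pat_completeness auto
termination by (relation "measure (\<lambda>(T, vs). length vs)") auto

lemma indep_polys_polys_in:
  assumes "\<And>v i. v \<in> set vs \<Longrightarrow> v i \<in> polys_in W" shows "indep_polys T vs \<subseteq> polys_in W"
  using assms
proof (induction T vs rule: indep_polys.induct)
  case (1 T)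
  then show ?case by (simp add: polys_in_def)
next
  case (2 T v vs)
  have "indep_polys T (map (\<lambda>w i. v m * w i - w m * v i) vs) \<subseteq> polys_in W" if "m \<in> T" for m
  proof (rule 2(1)[OF that])
    fix u i assume "u \<in> set (map (\<lambda>w i. v m * w i - w m * v i) vs)"
    then obtain w where "w \<in> set vs" "u = (\<lambda>i. v m * w i - w m * v i)" by auto
    then show "u i \<in> polys_in W" using 2(2)[of v] 2(2)[of w] by (simp add: polys_in_diff polys_in_mult)
  qed
  then show ?case using 2(2) by (auto intro!: polys_in_mult)
qed

text \<open>Every index of \<open>T\<close> is tried as a pivot, and the factor \<open>v m\<close>
  records that the pivot is non-zero. Supports lie in \<open>T\<close>, so a non-zero vector has a
  pivot there.\<close>

lemma indep_polys_iff:
  assumes "list_all2 (\<lambda>v p. (\<forall>m\<in>T. eval_mpoly a (v m) = lookup p m) \<and> keys p \<subseteq> T) vs ps"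
  shows "(\<exists>f\<in>indep_polys T vs. eval_mpoly a f \<noteq> 0) \<longleftrightarrow> lin_indep ps"
  using assms
proof (induction T vs arbitrary: ps rule: indep_polys.induct)
  case (1 T)
  then show ?case by (simp add: lin_indep_def)
next
  case (2 T v vs)
  then obtain p qs where ps: "ps = p # qs" by (cases ps) auto
  have v: "eval_mpoly a (v m) = lookup p m" if "m \<in> T" for m using 2(2) that by (simp add: ps)
  have keys: "keys p \<subseteq> T" using 2(2) by (simp add: ps)
  have step: "(\<exists>f\<in>indep_polys T (map (\<lambda>w i. v m * w i - w m * v i) vs). eval_mpoly a f \<noteq> 0)
      \<longleftrightarrow> lin_indep (map (eliminate m p) qs)" if m: "m \<in> T" for m
  proof (rule 2(1)[OF m], unfold list_all2_map1 list_all2_map2, rule list_all2_mono)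
    show "list_all2 (\<lambda>v p. (\<forall>m\<in>T. eval_mpoly a (v m) = lookup p m) \<and> keys p \<subseteq> T) vs qs"
      using 2(2) by (simp add: ps)
    fix w q assume "(\<forall>m\<in>T. eval_mpoly a (w m) = lookup q m) \<and> keys q \<subseteq> T"
    then show "(\<forall>i\<in>T. eval_mpoly a (v m * w i - w m * v i) = lookup (eliminate m p q) i)
        \<and> keys (eliminate m p q) \<subseteq> T"
      using m v keys keys_eliminate[of m p q]
      by (auto simp: eval_mpoly_diff eval_mpoly_mult lookup_minus eliminate_def[of m p q])
  qed
  have "(\<exists>f\<in>indep_polys T (v # vs). eval_mpoly a f \<noteq> 0)
      \<longleftrightarrow> (\<exists>m\<in>T. lookup p m \<noteq> 0 \<and> lin_indep (map (eliminate m p) qs))"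
    using step v by (auto simp: eval_mpoly_mult)
  also have "\<dots> \<longleftrightarrow> (\<exists>m\<in>T. lookup p m \<noteq> 0) \<and> lin_indep (p # qs)"
    using lin_indep_eliminate by blast
  also have "\<dots> \<longleftrightarrow> lin_indep (p # qs)"
  proof -
    have "\<exists>m\<in>T. lookup p m \<noteq> 0" if "lin_indep (p # qs)"
    proof -
      have "p \<noteq> 0" using that mp.span_zero unfolding lin_indep_Cons by blast
      then have "keys p \<noteq> {}" by (auto simp: poly_mapping_eq_iff in_keys_iff fun_eq_iff)
      then obtain m where "m \<in> keys p" by blast
      then show ?thesis using keys unfolding in_keys_iff subset_iff by blast
    qed
    then show ?thesis by blast
  qed
  finally show ?case by (simp add: ps)
qed

definition eval_vector :: "(nat \<Rightarrow>\<^sub>0 nat) set \<Rightarrow> ('w \<Rightarrow> 'k::field) \<Rightarrow> ((nat \<Rightarrow>\<^sub>0 nat) \<Rightarrow> ('w, 'k) mpoly) \<Rightarrow> (nat, 'k) mpoly" where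
  "eval_vector T a v = (\<Sum>m\<in>T. single m (eval_mpoly a (v m)))"

lemma lookup_eval_vector:
  "finite T \<Longrightarrow> lookup (eval_vector T a v) m = (if m \<in> T then eval_mpoly a (v m) else 0)"
  by (auto simp: eval_vector_def lookup_sum lookup_single when_def)

text \<open>A span has dimension at least \<open>N\<close> exactly if some \<open>N\<close> of the
  generators are independent; collecting the polynomials of all choices expresses this by one
  set.\<close>

lemma dim_ge_iff_polys:
  assumes T: "finite T" and V: "finite V"
  shows "N \<le> mp.dim (mp.span (eval_vector T a ` V))
    \<longleftrightarrow> (\<exists>f \<in> (\<Union>vs \<in> {vs. set vs \<subseteq> V \<and> length vs = N}. indep_polys T vs). eval_mpoly a f \<noteq> 0)"
proof -
  let ?W = "eval_vector T a ` V"
  have *: "(\<exists>f\<in>indep_polys T vs. eval_mpoly a f \<noteq> 0) \<longleftrightarrow> lin_indep (map (eval_vector T a) vs)" for vs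
    by (rule indep_polys_iff)
      (auto simp: list_all2_map2 lookup_eval_vector[OF T] in_keys_iff split: if_splits intro!: list.rel_refl)
  have "(\<exists>vs. set vs \<subseteq> V \<and> length vs = N \<and> lin_indep (map (eval_vector T a) vs)) \<longleftrightarrow> N \<le> mp.dim (mp.span ?W)"
  proof
    assume "\<exists>vs. set vs \<subseteq> V \<and> length vs = N \<and> lin_indep (map (eval_vector T a) vs)"
    then obtain vs where vs: "set vs \<subseteq> V" "length vs = N" "lin_indep (map (eval_vector T a) vs)" by blast
    let ?B = "set (map (eval_vector T a) vs)"
    have "N = card ?B" "mp.independent ?B" using vs(2,3) distinct_card unfolding lin_indep_iff by fastforce+
    then have "N = mp.dim ?B" using mp.dim_eq_card_independent by metis
    also have "\<dots> \<le> mp.dim (mp.span ?W)"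
      by (rule mp.dim_le_dim[of _ _ ?W]) (use vs(1) V mp.span_superset[of ?W] in auto)
    finally show "N \<le> mp.dim (mp.span ?W)" .
  next
    assume N: "N \<le> mp.dim (mp.span ?W)"
    obtain B where B: "B \<subseteq> ?W" "finite B" "mp.independent B" "?W \<subseteq> mp.span B" "card B = mp.dim ?W"
      by (rule mp.finite_basis[OF mp.span_superset finite_imageI[OF V]])
    then obtain C where C: "C \<subseteq> B" "card C = N" using N obtain_subset_with_card_n[of N B] unfolding mp.dim_span by metis
    obtain ps where ps: "set ps = C" "distinct ps" using finite_distinct_list C(1) B(2) finite_subset by metis
    have "\<forall>p\<in>set ps. \<exists>v. v \<in> V \<and> eval_vector T a v = p" using ps C B by blast
    then obtain g where g: "\<And>p. p \<in> set ps \<Longrightarrow> g p \<in> V" "\<And>p. p \<in> set ps \<Longrightarrow> eval_vector T a (g p) = p" by metis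
    define vs where "vs = map g ps"
    have vs: "set vs \<subseteq> V" "ps = map (eval_vector T a) vs" using g by (auto simp: vs_def map_idI)
    have "lin_indep ps" using ps B(3) C(1) mp.independent_mono unfolding lin_indep_iff by blast
    moreover have "length vs = N" using vs(2) ps C(2) distinct_card by fastforce
    ultimately show "\<exists>vs. set vs \<subseteq> V \<and> length vs = N \<and> lin_indep (map (eval_vector T a) vs)" using vs by blast
  qed
  then show ?thesis using * by blast
qed

section \<open>Rank conditions on the graded pieces of sections\<close>

lemma frame_coeff_simp: "frame_coeff Ls (l, j) = lookup (Ls ! l) (single j 1)"
  by (simp add: frame_coeff_def)

lemma monomials_one: "monomials {..n} 1 = (\<lambda>j. single j 1) ` {..n}"
proof (intro equalityI subsetI)
  fix m assume m: "m \<in> monomials {..n} 1"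
  then have "m \<noteq> 0" by (auto simp: monomials_def)
  then obtain v where v: "v \<in> keys m" by (auto simp: poly_mapping_eq_iff in_keys_iff fun_eq_iff)
  have eq: "(m - single v 1) + single v 1 = m" by (rule monomial_factor[OF v])
  then have "monom_degree (m - single v 1) = 0"
    using m monom_degree_add[of "m - single v 1" "single v 1"] by (simp add: monomials_def)
  then have "m = single v 1" using eq by (simp add: monom_degree_eq_0_iff)
  moreover have "v \<le> n" using m v by (auto simp: monomials_def)
  ultimately show "m \<in> (\<lambda>j. single j 1) ` {..n}" by blast
qed (auto simp: monomials_def)

lemma adjoins_graded_span:
  assumes X: "hideal n X" and Ls: "set Ls \<subseteq> forms n 1" and B: "mp.span B = X \<inter> forms n (Suc d)"
  shows "adjoins n X Ls \<inter> forms n (Suc d) =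
    mp.span (B \<union> {single m 1 * l |m l. m \<in> monomials {..n} d \<and> l \<in> set Ls})"
proof -
  let ?G = "\<lambda>Ls. {single m 1 * l |m l. m \<in> monomials {..n} d \<and> l \<in> set Ls}"
  show ?thesis
  proof
    note J = hideal_adjoins[OF X Ls]
    have "single m 1 * l \<in> adjoins n X Ls \<inter> forms n (Suc d)"
      if "m \<in> monomials {..n} d" "l \<in> set Ls" for m l
      using forms_mult[OF forms_single[OF that(1), of 1], of l 1] hideal_mult[OF J, of l "single m 1"]
        adjoins_mem[OF X Ls] Ls that forms_polys[OF forms_single[OF that(1)]] by (auto simp: subset_iff)
    moreover have "B \<subseteq> adjoins n X Ls \<inter> forms n (Suc d)"
      using mp.span_superset[of B] adjoins_superset[of X n Ls] unfolding B by blast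
    ultimately show "mp.span (B \<union> ?G Ls) \<subseteq> adjoins n X Ls \<inter> forms n (Suc d)"
      by (intro mp.span_minimal subspace_graded[OF J]) blast
    show "adjoins n X Ls \<inter> forms n (Suc d) \<subseteq> mp.span (B \<union> ?G Ls)"
      using Ls
    proof (induction Ls)
      case Nil
      then show ?case using mp.span_mono[of B "B \<union> ?G []"] B by auto
    next
      case (Cons l Ls)
      then have l: "l \<in> forms n 1" and Ls: "set Ls \<subseteq> forms n 1" by auto
      show ?case
      proof
        fix p assume p: "p \<in> adjoins n X (l # Ls) \<inter> forms n (Suc d)"
        obtain a b where ab: "a \<in> adjoins n X Ls" "b \<in> forms n (Suc d - 1)" "p = a + b * l" "a \<in> forms n (Suc d)"
          using adjoin_graded[OF hideal_adjoins[OF X Ls] l, of p "Suc d"] p by auto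
        have "a \<in> mp.span (B \<union> ?G Ls)" using Cons.IH[OF Ls] ab by auto
        moreover have "mp.span (B \<union> ?G Ls) \<subseteq> mp.span (B \<union> ?G (l # Ls))" by (intro mp.span_mono) auto
        moreover have "b * l \<in> mp.span (B \<union> ?G (l # Ls))"
        proof -
          have "b * l = (\<Sum>m\<in>keys b. cmul (lookup b m) (single m 1 * l))"
            by (subst sum_singles[of b]) (simp add: sum_distrib_right single_eq_cmul[of _ "lookup b _"] cmul_mult_left)
          also have "\<dots> \<in> mp.span (B \<union> ?G (l # Ls))"
            using ab(2) by (intro mp.span_sum mp.span_scale mp.span_base) (auto simp: forms_iff)
          finally show ?thesis .
        qed
        ultimately show "p \<in> mp.span (B \<union> ?G (l # Ls))" unfolding ab(3) by (intro mp.span_add) auto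
      qed
    qed
  qed
qed

text \<open>The coefficients of \<open>x\<^sup>m\<close> times the \<open>l\<close>-th linear form.\<close>

definition shifted_form :: "nat \<Rightarrow> (nat \<Rightarrow>\<^sub>0 nat) \<Rightarrow> nat \<Rightarrow> (nat \<Rightarrow>\<^sub>0 nat) \<Rightarrow> (nat \<times> nat, 'k::field) mpoly" where
  "shifted_form n m l = (\<lambda>i. \<Sum>j\<in>{j. j \<le> n \<and> i = m + single j 1}. var (l, j))"

lemma eval_shifted_form:
  assumes m: "m \<in> monomials {..n} d" and l: "Ls ! l \<in> forms n 1"
  shows "eval_vector (monomials {..n} (Suc d)) (frame_coeff Ls) (shifted_form n m l) = single m 1 * (Ls ! l)"
proof (rule poly_mapping_eqI)
  fix i
  have fin: "finite (monomials {..n} (Suc d))" by (simp add: finite_monomials)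
  have prod: "single m 1 * (Ls ! l) \<in> forms n (Suc d)"
    using forms_mult[OF forms_single[OF m, of 1] l] by simp
  show "lookup (eval_vector (monomials {..n} (Suc d)) (frame_coeff Ls) (shifted_form n m l)) i
      = lookup (single m 1 * (Ls ! l)) i"
  proof (cases "\<exists>j\<le>n. i = m + single j 1")
    case True
    then obtain j where j: "j \<le> n" "i = m + single j 1" by blast
    have "{j'. j' \<le> n \<and> i = m + single j' 1} = {j}"
    proof (intro equalityI subsetI)
      fix j' assume "j' \<in> {j'. j' \<le> n \<and> i = m + single j' 1}"
      then have "single j (1::nat) = single j' 1" using j by simp
      then have "keys (single j (1::nat)) = keys (single j' (1::nat))" by simp
      then show "j' \<in> {j}" by simp
    qed (use j in auto)
    moreover have "i \<in> monomials {..n} (Suc d)"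
      using m j by (auto simp: monomials_def monom_degree_add keys_add_nat)
    ultimately show ?thesis
      by (simp add: lookup_eval_vector[OF fin] shifted_form_def frame_coeff_simp) (simp add: j(2) lookup_single_mult)
  next
    case False
    then have "{j. j \<le> n \<and> i = m + single j 1} = {}" by blast
    then have "shifted_form n m l i = (0 :: (nat \<times> nat, 'a) mpoly)" unfolding shifted_form_def by (simp only: sum.empty)
    moreover have "i \<notin> keys (single m 1 * (Ls ! l))"
    proof
      assume "i \<in> keys (single m 1 * (Ls ! l))"
      then obtain b where b: "i = m + b" "b \<in> keys (Ls ! l)"
        using keys_mult[of "single m 1" "Ls ! l"] by auto
      then have "b \<in> monomials {..n} 1" using l by (auto simp: forms_iff simp del: One_nat_def)
      then show False using False b(1) unfolding monomials_one by blast
    qed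
    ultimately show ?thesis by (simp add: lookup_eval_vector[OF fin] in_keys_iff)
  qed
qed

text \<open>Semicontinuity: the degree \<open>d + 1\<close> part of the section is spanned by
  vectors whose coordinates are constants or polynomials in the coefficients of \<open>Ls\<close>,
  and a small Hilbert function means a large rank.\<close>

lemma hilb_le_open:
  fixes X :: "(nat, 'k::field) mpoly set"
  assumes X: "hideal n X"
  shows "\<exists>S \<subseteq> polys_in ({..<i} \<times> {..n}). \<forall>Ls. set Ls \<subseteq> forms n 1 \<longrightarrow> length Ls = i \<longrightarrow>
    (hilb n (adjoins n X Ls) (Suc d) \<le> h \<longleftrightarrow> (\<exists>f\<in>S. eval_mpoly (frame_coeff Ls) f \<noteq> 0))"
proof -
  let ?T = "monomials {..n} (Suc d)"
  have finT: "finite ?T" by (simp add: finite_monomials)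
  obtain B where B: "B \<subseteq> X \<inter> forms n (Suc d)" "finite B" "X \<inter> forms n (Suc d) \<subseteq> mp.span B"
    using mp.finite_basis[of "X \<inter> forms n (Suc d)", OF _ finite_dim_forms(2)[of n "Suc d"]] forms_span[of n "Suc d"]
    by (metis Int_lower2)
  have spanB: "mp.span B = X \<inter> forms n (Suc d)"
    using B(1,3) mp.span_minimal[OF B(1) subspace_graded[OF X]] by blast
  define V1 where "V1 = (\<lambda>b i. const (lookup b i) :: (nat \<times> nat, 'k) mpoly) ` B"
  define V2 where "V2 = (\<lambda>(m, l). shifted_form n m l :: _ \<Rightarrow> (nat \<times> nat, 'k) mpoly) ` (monomials {..n} d \<times> {..<i})"
  \<comment> \<open>Truncated subtraction is harmless: if \<open>h\<close> is at least the full
    dimension, \<open>N\<close> is 0 and both conditions hold.\<close>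
  define N where "N = mp.dim (forms n (Suc d) :: (nat, 'k) mpoly set) - h"
  define S where "S = (\<Union>vs \<in> {vs. set vs \<subseteq> V1 \<union> V2 \<and> length vs = N}. indep_polys ?T vs)"
  have finV: "finite (V1 \<union> V2)" using B(2) by (simp add: V1_def V2_def finite_monomials)
  have "S \<subseteq> polys_in ({..<i} \<times> {..n})"
  proof -
    have V: "v j \<in> polys_in ({..<i} \<times> {..n})" if "v \<in> V1 \<union> V2" for v j
      using that by (auto simp: V1_def V2_def shifted_form_def intro!: polys_in_const polys_in_sum polys_in_var)
    show ?thesis
      unfolding S_def
    proof (rule UN_least)
      fix vs assume "vs \<in> {vs. set vs \<subseteq> V1 \<union> V2 \<and> length vs = N}"
      then show "indep_polys ?T vs \<subseteq> polys_in ({..<i} \<times> {..n})" using V by (intro indep_polys_polys_in) blast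
    qed
  qed
  moreover have "hilb n (adjoins n X Ls) (Suc d) \<le> h \<longleftrightarrow> (\<exists>f\<in>S. eval_mpoly (frame_coeff Ls) f \<noteq> 0)"
    if Ls: "set Ls \<subseteq> forms n 1" "length Ls = i" for Ls
  proof -
    have l: "Ls ! l \<in> forms n 1" if "l < i" for l using that Ls nth_mem by blast
    have "eval_vector ?T (frame_coeff Ls) ` V1 = (\<lambda>b. b) ` B"
      unfolding V1_def image_image
    proof (rule image_cong[OF refl])
      fix b assume "b \<in> B"
      then have "b \<in> forms n (Suc d)" using B(1) by blast
      then have "keys b \<subseteq> ?T" by (simp add: forms_iff)
      then show "eval_vector ?T (frame_coeff Ls) (\<lambda>i. const (lookup b i)) = b"
        by (intro poly_mapping_eqI) (auto simp: lookup_eval_vector[OF finT] in_keys_iff)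
    qed
    moreover have "eval_vector ?T (frame_coeff Ls) ` V2
        = (\<lambda>(m, l). single m 1 * (Ls ! l)) ` (monomials {..n} d \<times> {..<i})"
      unfolding V2_def image_image by (rule image_cong[OF refl]) (auto intro!: eval_shifted_form l simp del: One_nat_def)
    moreover have "\<dots> = {single m 1 * l |m l. m \<in> monomials {..n} d \<and> l \<in> set Ls}"
      using Ls(2) by (auto simp: set_conv_nth image_iff)
    ultimately have "mp.span (eval_vector ?T (frame_coeff Ls) ` (V1 \<union> V2)) = adjoins n X Ls \<inter> forms n (Suc d)"
      using adjoins_graded_span[OF X Ls(1) spanB] by (simp add: image_Un)
    then have "N \<le> mp.dim (adjoins n X Ls \<inter> forms n (Suc d)) \<longleftrightarrow> (\<exists>f\<in>S. eval_mpoly (frame_coeff Ls) f \<noteq> 0)"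
      using dim_ge_iff_polys[OF finT finV, of N "frame_coeff Ls"] by (simp add: S_def)
    moreover have "hilb n (adjoins n X Ls) (Suc d) \<le> h \<longleftrightarrow> N \<le> mp.dim (adjoins n X Ls \<inter> forms n (Suc d))"
      using hilb_dim[of n "adjoins n X Ls" "Suc d"] unfolding N_def by linarith
    ultimately show ?thesis by blast
  qed
  ultimately show ?thesis by blast
qed

section \<open>General linear sections\<close>

fun regular_sequence :: "nat \<Rightarrow> (nat, 'k::field) mpoly set \<Rightarrow> (nat, 'k) mpoly list \<Rightarrow> bool" where
  "regular_sequence n X [] \<longleftrightarrow> True"
| "regular_sequence n X (l # Ls) \<longleftrightarrow> filter_regular n (adjoins n X Ls) l \<and> regular_sequence n X Ls"

lemma regular_sequence_gotz_list:
  assumes X: "hideal n X" "gotz_list n X as" and "set Ls \<subseteq> forms n 1" "regular_sequence n X Ls"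
  shows "gotz_list n (adjoins n X Ls) ((cut_dims ^^ length Ls) as)"
  using assms(3,4)
proof (induction Ls)
  case (Cons l Ls)
  then show ?case
    using filter_regular_gotz_list[OF hideal_adjoins[OF X(1), of Ls 1]] by auto
qed (use X in simp)

lemma lin_generic_frame:
  fixes Ls :: "(nat, 'k::field) mpoly list"
  assumes "set Ls \<subseteq> forms n 1" "k < length Ls" "eval_mpoly (frame_coeff Ls) f \<noteq> 0"
  shows "lin_generic n {l \<in> forms n 1. eval_mpoly (frame_coeff (Ls[k := l])) f \<noteq> 0}"
  unfolding lin_generic_def
proof (intro conjI ballI)
  let ?G = "{l \<in> forms n 1. eval_mpoly (frame_coeff (Ls[k := l])) f \<noteq> 0}"
  have "Ls ! k \<in> ?G" using assms nth_mem[of k Ls] by auto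
  then show "?G \<noteq> {}" by blast
  fix a v :: "(nat, 'k) mpoly" assume a: "a \<in> ?G" and v: "v \<in> forms n 1"
  define b where "b = (\<lambda>(l, j). if l = k then lookup v (single j 1) else 0)"
  have line: "frame_coeff (Ls[k := a + cmul c v]) = (\<lambda>x. frame_coeff (Ls[k := a]) x + c * b x)" for c
  proof
    fix x :: "nat \<times> nat"
    obtain l j where x: "x = (l, j)" by (cases x)
    show "frame_coeff (Ls[k := a + cmul c v]) x = frame_coeff (Ls[k := a]) x + c * b x"
      using assms(2) by (cases "l = k") (auto simp: x frame_coeff_def b_def lookup_add)
  qed
  obtain P where P: "\<And>c. poly P c = eval_mpoly (frame_coeff (Ls[k := a + cmul c v])) f"
    using eval_mpoly_line[of "frame_coeff (Ls[k := a])" b f] unfolding line by blast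
  have "poly P 0 \<noteq> 0" using a by (simp add: P)
  then have "finite {c. poly P c = 0}" by (intro poly_roots_finite) auto
  moreover have "{c. a + cmul c v \<notin> ?G} = {c. poly P c = 0}"
    using a v by (auto simp: P forms_add forms_cmul simp del: One_nat_def)
  ultimately show "finite {c. a + cmul c v \<notin> ?G}" by simp
qed auto

text \<open>Entries are exchanged one at a time from the end, where the cutting starts; each new
  entry is generic for the section by the tail and, by \<open>lin_generic_frame\<close>, can be
  chosen without making \<open>f\<close> vanish.\<close>

theorem regular_sequence_exists:
  fixes X :: "(nat, 'k::field) mpoly set"
  assumes inf: "infinite (UNIV :: 'k set)" and X: "hideal n X"
    and Ls: "set Ls \<subseteq> forms n 1" "eval_mpoly (frame_coeff Ls) f \<noteq> 0"
  shows "\<exists>Ms. length Ms = length Ls \<and> set Ms \<subseteq> forms n 1 \<and> eval_mpoly (frame_coeff Ms) f \<noteq> 0 \<and> regular_sequence n X Ms"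
proof -
  have "\<exists>Ms. length Ms = length Ls \<and> set Ms \<subseteq> forms n 1 \<and> eval_mpoly (frame_coeff Ms) f \<noteq> 0 \<and>
      regular_sequence n X (drop (length Ls - k) Ms)" if "k \<le> length Ls" for k
    using that
  proof (induction k)
    case 0
    then show ?case using Ls by (intro exI[of _ Ls]) simp
  next
    case (Suc k)
    then obtain Ms where Ms: "length Ms = length Ls" "set Ms \<subseteq> forms n 1" "eval_mpoly (frame_coeff Ms) f \<noteq> 0"
      "regular_sequence n X (drop (length Ls - k) Ms)" by auto
    define j where "j = length Ls - Suc k"
    have j: "j < length Ms" "length Ls - k = Suc j" using Suc.prems Ms(1) by (auto simp: j_def)
    let ?D = "drop (Suc j) Ms"
    have D: "set ?D \<subseteq> forms n 1" using Ms(2) set_drop_subset by fast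
    obtain B where B: "lin_generic n B" "\<And>l. l \<in> B \<Longrightarrow> filter_regular n (adjoins n X ?D) l"
      using filter_regular_generic[OF inf hideal_adjoins[OF X D]] by blast
    have "lin_generic n (B \<inter> {l \<in> forms n 1. eval_mpoly (frame_coeff (Ms[j := l])) f \<noteq> 0})"
      by (rule lin_generic_Int[OF inf B(1) lin_generic_frame[OF Ms(2) j(1) Ms(3)]])
    then obtain l where l: "l \<in> B" "l \<in> forms n 1" "eval_mpoly (frame_coeff (Ms[j := l])) f \<noteq> 0"
      unfolding lin_generic_def by blast
    have "drop j (Ms[j := l]) = l # ?D"
      using j(1) by (simp add: Cons_nth_drop_Suc[symmetric])
    then have "regular_sequence n X (drop (length Ls - Suc k) (Ms[j := l]))"
      using Ms(4) B(2)[OF l(1)] by (simp add: j_def[symmetric] j(2))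
    moreover have "set (Ms[j := l]) \<subseteq> forms n 1" using set_update_subset_insert[of Ms j l] Ms(2) l(2) by blast
    ultimately show ?case using Ms(1) l(3) by (intro exI[of _ "Ms[j := l]"]) simp
  qed
  from this[of "length Ls"] show ?thesis by simp
qed

section \<open>Hypersurfaces in linear subspaces\<close>

lemma mono_count_strict_mono:
  assumes "u < v" "d > 0" shows "mono_count u d < mono_count v d"
proof -
  obtain d' where d: "d = Suc d'" using assms(2) by (cases d) auto
  have "mono_count u d < mono_count (Suc u) d" using mono_count_pos[of "Suc u" d'] by (simp add: d mono_count_Suc_Suc)
  also have "\<dots> \<le> mono_count v d" using assms(1) by (intro mono_count_mono) simp
  finally show ?thesis .
qed

lemma sorted_replicate: "sorted_wrt (\<ge>) (replicate d (r :: nat))"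
  by (induction d) auto

lemma hypersurface_hilb_gotz:
  assumes "linear_ideal n k I" "F \<in> forms n d" "F \<notin> I" "Suc n - k = r + 2"
  shows "hilb n (adjoin n I F) t = gotz 0 (replicate d r) t"
  using hypersurface_hilb[OF assms(1-3), of t] gotz_replicate[of 0 d r t] by (simp add: assms(4))

lemma hypersurface_gotz_list:
  assumes "linear_ideal n k I" "F \<in> forms n d" "F \<notin> I" "Suc n - k = r + 2"
  shows "gotz_list n (adjoin n I F) (replicate d r)"
  by (simp add: gotz_list_def sorted_replicate hypersurface_hilb_gotz[OF assms])

lemma independent_poly_ring_iff:
  "set Ls \<subseteq> polys n \<Longrightarrow> ring.independent (poly_ring n) (range const) Ls \<longleftrightarrow> lin_indep Ls"
proof (induction Ls)
  case Nil
  then show ?case by (auto simp: lin_indep_def)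
next
  case (Cons l Ls)
  then show ?case using independent_poly_ring_Cons[OF Cons.prems] by (simp add: lin_indep_Cons)
qed

theorem hypersurface_if_gotz_list:
  fixes X :: "(nat, 'k::field) mpoly set"
  assumes inf: "infinite (UNIV :: 'k set)" and X: "hideal n X" "saturation n X = X"
    and as: "gotz_list n X (replicate d r)" and "r > 0" "d > 0" "r < n"
  shows "\<exists>\<Lambda>. linear_subspace n (r + 1) \<Lambda> \<and> is_hypersurface_in n d \<Lambda> X"
proof -
  have hilb: "hilb n X t = gotz 0 (replicate d r) t" for t
    using hilb_saturated_lower_bound(2)[OF inf X as \<open>r > 0\<close>] .
  have one: "hilb n X 1 \<le> r + 2"
    using hilb[of 1] gotz_replicate[of 0 d r 1] mono_count_degree_one[of "r + 2"] by simp
  have "mp.dim (forms n 1 :: (nat, 'k) mpoly set) = Suc n"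
    using card_monomials[of "{..n}" 1] mono_count_degree_one[of "Suc n"] by (simp add: dim_forms)
  then have dim: "n - (r + 1) \<le> mp.dim (X \<inter> forms n 1)" using hilb_dim[of n X 1] one by linarith
  obtain B where B: "B \<subseteq> X \<inter> forms n 1" "finite B" "mp.independent B" "X \<inter> forms n 1 \<subseteq> mp.span B"
    "card B = mp.dim (X \<inter> forms n 1)"
    by (rule mp.finite_basis[OF subset_trans[OF Int_lower2 finite_dim_forms(1)] finite_dim_forms(2)])
  \<comment> \<open>For \<open>d = 1\<close> there are more linear forms in \<open>X\<close>; only
    as many are taken as define a space of dimension \<open>r + 1\<close>, and \<open>F\<close> is
    then linear too.\<close>
  obtain C where C: "C \<subseteq> B" "card C = n - (r + 1)"
    using dim obtain_subset_with_card_n[of "n - (r + 1)" B] B(5) by metis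
  obtain Ls where Ls: "set Ls = C" "distinct Ls" using finite_distinct_list C(1) B(2) finite_subset by metis
  have Lsf: "set Ls \<subseteq> forms n 1" and LsX: "set Ls \<subseteq> X" using Ls(1) C(1) B(1) by blast+
  have Lsp: "set Ls \<subseteq> polys n" using Lsf forms_polys by blast
  have len: "length Ls = n - (r + 1)" using Ls C(2) distinct_card by fastforce
  have "lin_indep Ls" unfolding lin_indep_iff using Ls C(1) B(3) mp.independent_mono by blast
  then have ind: "ring.independent (poly_ring n) (range const) Ls" using independent_poly_ring_iff[OF Lsp] by blast
  then have frame: "Ls \<in> linear_frames n (r + 1)" using Lsf len by (simp add: linear_frames_def)
  define \<Lambda> where "\<Lambda> = adjoins n {0} Ls"
  have \<Lambda>: "\<Lambda> = Idl\<^bsub>poly_ring n\<^esub> (set Ls)" using genideal_eq_adjoins[OF Lsf] by (simp add: \<Lambda>_def)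
  have lin: "linear_subspace n (r + 1) \<Lambda>"
    unfolding linear_subspace_def using frame \<Lambda> \<open>r < n\<close> by auto
  then have lid: "linear_ideal n (n - (r + 1)) \<Lambda>" by (rule linear_subspace_linear_ideal)
  note h\<Lambda> = linear_ideal_hideal[OF lid]
  have codim: "Suc n - (n - (r + 1)) = r + 2" using \<open>r < n\<close> by simp
  have sub: "\<Lambda> \<subseteq> X" unfolding \<Lambda>_def by (rule adjoins_minimal[OF X(1) _ LsX]) (simp add: hideal_0[OF X(1)])
  \<comment> \<open>In degree \<open>d\<close> the removed cone has just its generator, so
    \<open>X\<close> has one dimension of forms more than the linear space.\<close>
  have "hilb n X d < hilb n \<Lambda> d"
    using hilb[of d] gotz_replicate[of 0 d r d] linear_ideal_hilb[OF lid, of d, unfolded codim]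
    by (simp add: cone_count_def)
  then have "\<not> mp.dim (X \<inter> forms n d) \<le> mp.dim (\<Lambda> \<inter> forms n d)"
    using hilb_dim[of n X d] hilb_dim[of n \<Lambda> d] by linarith
  then have "\<not> X \<inter> forms n d \<subseteq> \<Lambda> \<inter> forms n d" using dim_graded_le[OF _ Int_lower2] by blast
  then obtain F where F: "F \<in> X" "F \<in> forms n d" "F \<notin> \<Lambda>" by blast
  have "adjoin n \<Lambda> F = X"
  proof (rule hideal_eq_if_hilb_le[OF hideal_adjoin[OF h\<Lambda> F(2)] X(1)])
    show "adjoin n \<Lambda> F \<subseteq> X" by (rule adjoin_minimal[OF X(1) sub F(1)])
    show "hilb n (adjoin n \<Lambda> F) t \<le> hilb n X t" for t
      using hypersurface_hilb_gotz[OF lid F(2,3) codim] hilb by simp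
  qed
  then have "is_hypersurface_in n d \<Lambda> X"
    unfolding is_hypersurface_in_def set_add_cgenideal using F by blast
  then show ?thesis using lin by blast
qed

lemma gotz_list_if_hypersurface:
  assumes "linear_subspace n (r + 1) \<Lambda>" "is_hypersurface_in n d \<Lambda> X" "r < n"
  shows "gotz_list n X (replicate d r)"
proof -
  obtain F where F: "F \<in> forms n d" "F \<notin> \<Lambda>" "X = adjoin n \<Lambda> F"
    using assms(2) unfolding is_hypersurface_in_def set_add_cgenideal by blast
  show ?thesis
    unfolding F(3) by (rule hypersurface_gotz_list[OF linear_subspace_linear_ideal[OF assms(1)] F(1,2)]) (use assms(3) in simp)
qed

text \<open>A bound on the Hilbert function in the single degree \<open>d\<close> is an open condition on the frame \<open>Ls\<close>
  and depends only on the linear subspace it defines.\<close>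

lemma hypersurface_section:
  fixes Ls Ms :: "(nat, 'k::field) mpoly list"
  assumes Ms: "set Ms \<subseteq> forms n 1" "length Ms = n - (r + 1)" and F: "F \<in> forms n d"
    and Ls: "set Ls \<subseteq> forms n 1" "length Ls < r" and rn: "r < n" and "d > 0"
  defines "X \<equiv> adjoin n (adjoins n {0} Ms) F"
  shows "hilb n (adjoins n X Ls) d < mono_count (r - length Ls + 2) d \<longleftrightarrow>
      gotz_list n (adjoins n X Ls) (replicate d (r - length Ls))" (is "?A \<longleftrightarrow> ?B")
    and "hilb n (adjoins n X Ls) d < mono_count (r - length Ls + 2) d \<Longrightarrow>
      ring.independent (poly_ring n) (range const) Ls"
proof -
  let ?L = "adjoins n {0} (Ls @ Ms)"
  have LM: "set (Ls @ Ms) \<subseteq> forms n 1" using Ms Ls by simp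
  obtain k where k: "k \<le> length (Ls @ Ms)" "linear_ideal n k ?L"
    "k = length (Ls @ Ms) \<longleftrightarrow> ring.independent (poly_ring n) (range const) (Ls @ Ms)"
    using linear_ideal_adjoins[OF LM] by blast
  have XL: "adjoins n X Ls = adjoin n ?L F" by (simp add: X_def adjoins_adjoin adjoins_append)
  \<comment> \<open>The number of variables left by all the linear forms; it takes its least value
    \<open>r - length Ls + 2\<close> exactly if they are independent.\<close>
  define u where "u = Suc n - k"
  have k_le: "k \<le> length Ls + (n - (r + 1))" using k(1) Ms(2) by simp
  have u: "r - length Ls + 2 \<le> u" using k_le Ls(2) rn by (simp add: u_def)
  have u_eq: "u = r - length Ls + 2 \<longleftrightarrow> k = length (Ls @ Ms)"
    using k_le linear_ideal_le[OF k(2)] Ls(2) rn Ms(2) by (auto simp: u_def)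
  \<comment> \<open>If \<open>F\<close> vanishes on the linear section, the result is a linear space
    of too large a dimension, with the one-entry list \<open>[v]\<close>, and both sides
    fail.\<close>
  have mem: "\<not> ?A \<and> \<not> ?B" if "F \<in> ?L"
  proof
    have eq: "adjoins n X Ls = ?L"
      unfolding XL using adjoin_superset adjoin_minimal[OF linear_ideal_hideal[OF k(2)] order_refl that] by blast
    have h: "hilb n (adjoins n X Ls) t = mono_count u t" for t unfolding eq u_def by (rule linear_ideal_hilb[OF k(2)])
    show "\<not> ?A" using h mono_count_mono[OF u, of d] by simp
    obtain v where v: "u = Suc v" "v > r - length Ls" using u by (cases u) auto
    have "gotz_list n (adjoins n X Ls) [v]" by (simp add: gotz_list_def h v(1))
    show "\<not> ?B"
    proof
      assume ?B
      from gotz_list_unique[OF \<open>gotz_list n (adjoins n X Ls) [v]\<close> this] show False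
        using v(2) by (cases d) auto
    qed
  qed
  have hyp: "gotz_list n (adjoins n X Ls) (replicate d (u - 2))" "hilb n (adjoins n X Ls) d + 1 = mono_count u d"
    if "F \<notin> ?L"
  proof -
    show "gotz_list n (adjoins n X Ls) (replicate d (u - 2))"
      unfolding XL using u by (intro hypersurface_gotz_list[OF k(2) F that]) (simp add: u_def)
    show "hilb n (adjoins n X Ls) d + 1 = mono_count u d"
      using hypersurface_hilb[OF k(2) F that, of d] by (simp add: XL u_def cone_count_def)
  qed
  have AB: "?A \<longleftrightarrow> u = r - length Ls + 2" "?B \<longleftrightarrow> u = r - length Ls + 2" if "F \<notin> ?L"
  proof -
    have "?A \<longleftrightarrow> \<not> r - length Ls + 2 < u"
      using hyp(2)[OF that] mono_count_strict_mono[of "r - length Ls + 2" u d] \<open>d > 0\<close> u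
      by (cases "u = r - length Ls + 2") auto
    then show "?A \<longleftrightarrow> u = r - length Ls + 2" using u by auto
    have "replicate d (u - 2) = replicate d (r - length Ls) \<longleftrightarrow> u - 2 = r - length Ls"
      using \<open>d > 0\<close> by simp
    then show "?B \<longleftrightarrow> u = r - length Ls + 2"
      using gotz_list_unique[OF hyp(1)[OF that], of "replicate d (r - length Ls)"] hyp(1)[OF that] u by auto
  qed
  show "?A \<longleftrightarrow> ?B" using mem AB by blast
  assume ?A
  then have "k = length (Ls @ Ms)" using mem AB(1) u_eq by blast
  then have "ring.independent (poly_ring n) (range const) (Ls @ Ms)" using k(3) by blast
  moreover have "set (Ls @ Ms) \<subseteq> polys n" using LM forms_polys by blast
  ultimately have "lin_indep (Ls @ Ms)" using independent_poly_ring_iff by blast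
  then have "lin_indep Ls" unfolding lin_indep_iff using mp.independent_mono[of "set (Ls @ Ms)" "set Ls"] by auto
  then show "ring.independent (poly_ring n) (range const) Ls"
    using independent_poly_ring_iff[of Ls n] Ls(1) forms_polys by blast
qed

theorem general_section_genus:
  fixes X :: "(nat, 'k::field) mpoly set"
  assumes inf: "infinite (UNIV :: 'k set)"
    and "linear_subspace n (r + 1) \<Lambda>" "is_hypersurface_in n d \<Lambda> X" and "i < r" "r < n" "d > 0"
  shows "for_general_linear_subspace n (n - i)
    (\<lambda>\<Lambda>. arithmetic_genus n (scheme_inter n X \<Lambda>) = of_nat ((d - 1) choose (r - i + 1)))"
proof -
  obtain Ms where Ms: "set Ms \<subseteq> forms n 1" "length Ms = n - (r + 1)" "\<Lambda> = adjoins n {0} Ms"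
    using assms(2) genideal_eq_adjoins by (fastforce simp: linear_subspace_def linear_frames_def)
  obtain F where F: "F \<in> forms n d" "F \<notin> \<Lambda>" "X = adjoin n \<Lambda> F"
    using assms(3) unfolding is_hypersurface_in_def set_add_cgenideal by blast
  have X: "hideal n X" unfolding F(3) Ms(3) by (rule hideal_adjoin[OF hideal_adjoins[OF hideal_zero Ms(1)] F(1)])
  obtain d' where d: "d = Suc d'" using \<open>d > 0\<close> by (cases d) auto
  have ni: "n - (n - i) = i" using assms by simp
  let ?h = "mono_count (r - i + 2) d"
  note sect = hypersurface_section[OF Ms(1,2) F(1) _ _ \<open>r < n\<close> \<open>d > 0\<close>, folded Ms(3), folded F(3)]
  \<comment> \<open>The threshold is the dimension of the forms of degree \<open>d\<close> on a
    linear space of the expected dimension; the equation \<open>F\<close> brings the value just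
    below it. The condition uses the sum of ideals and so depends on the subspace alone.\<close>
  define U where "U = {\<Lambda>'. linear_subspace n (n - i) \<Lambda>' \<and> hilb n (X <+>\<^bsub>poly_ring n\<^esub> \<Lambda>') d < ?h}"
  have sum: "X <+>\<^bsub>poly_ring n\<^esub> (Idl\<^bsub>poly_ring n\<^esub> (set Ls)) = adjoins n X Ls" if "set Ls \<subseteq> forms n 1" for Ls
    using genideal_eq_adjoins[OF that] set_add_adjoins by metis
  obtain S where S: "S \<subseteq> polys_in ({..<i} \<times> {..n})"
    "\<And>Ls. set Ls \<subseteq> forms n 1 \<Longrightarrow> length Ls = i \<Longrightarrow>
      hilb n (adjoins n X Ls) d \<le> ?h - 1 \<longleftrightarrow> (\<exists>f\<in>S. eval_mpoly (frame_coeff Ls) f \<noteq> 0)"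
    using hilb_le_open[OF X, of i d' "?h - 1"] unfolding d by blast
  have "?h > 0" by (simp add: mono_count_pos)
  then have less_iff: "a < ?h \<longleftrightarrow> a \<le> ?h - 1" for a by auto
  have frames: "Ls \<in> linear_frames n (n - i) \<and> Idl\<^bsub>poly_ring n\<^esub> (set Ls) \<in> U \<longleftrightarrow> hilb n (adjoins n X Ls) d < ?h"
    if Ls: "set Ls \<subseteq> forms n 1" "length Ls = i" for Ls
  proof
    assume "Ls \<in> linear_frames n (n - i) \<and> Idl\<^bsub>poly_ring n\<^esub> (set Ls) \<in> U"
    then show "hilb n (adjoins n X Ls) d < ?h" using sum[OF Ls(1)] by (simp add: U_def)
  next
    assume h: "hilb n (adjoins n X Ls) d < ?h"
    then have "Ls \<in> linear_frames n (n - i)"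
      using sect(2)[OF Ls(1)] Ls \<open>i < r\<close> by (simp add: linear_frames_def ni)
    then show "Ls \<in> linear_frames n (n - i) \<and> Idl\<^bsub>poly_ring n\<^esub> (set Ls) \<in> U"
      using h sum[OF Ls(1)] unfolding U_def linear_subspace_def by auto
  qed
  have "grassmannian_open n (n - i) U"
    unfolding grassmannian_open_def
  proof (intro conjI exI[of _ S] allI impI)
    show "U \<subseteq> Collect (linear_subspace n (n - i))" by (auto simp: U_def)
    show "S \<subseteq> polys_in ({..<n - (n - i)} \<times> {..n})" using S(1) by (simp add: ni)
    fix Ls :: "(nat, 'k) mpoly list" assume Ls: "set Ls \<subseteq> forms n 1" "length Ls = n - (n - i)"
    then show "Ls \<in> linear_frames n (n - i) \<and> Idl\<^bsub>poly_ring n\<^esub> (set Ls) \<in> U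
        \<longleftrightarrow> (\<exists>f\<in>S. eval_mpoly (frame_coeff Ls) f \<noteq> 0)"
      using frames[OF Ls(1)] S(2)[OF Ls(1)] unfolding ni less_iff by blast
  qed
  moreover have "U \<noteq> {}"
  proof -
    \<comment> \<open>The polynomial 1 imposes no condition, so the zero tuple can serve as the
      starting point from which all entries are replaced.\<close>
    have zero: "set (replicate i (0 :: (nat, 'k) mpoly)) \<subseteq> forms n 1" by auto
    obtain Ls where Ls: "length Ls = i" "set Ls \<subseteq> forms n 1" "regular_sequence n X Ls"
      using regular_sequence_exists[OF inf X zero, of 1] by auto
    have "(cut_dims ^^ i) (replicate d r) = replicate d (r - i)"
      using funpow_cut_dims[of "[]" i r d] \<open>i < r\<close> by simp
    then have "gotz_list n (adjoins n X Ls) (replicate d (r - i))"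
      using regular_sequence_gotz_list[OF X gotz_list_if_hypersurface[OF assms(2,3,5)] Ls(2,3)] Ls(1) by simp
    then have "hilb n (adjoins n X Ls) d < ?h" using sect(1)[OF Ls(2)] Ls(1) \<open>i < r\<close> by simp
    then show ?thesis using frames[OF Ls(2,1)] by blast
  qed
  moreover have "arithmetic_genus n (scheme_inter n X \<Lambda>') = of_nat ((d - 1) choose (r - i + 1))" if \<Lambda>': "\<Lambda>' \<in> U" for \<Lambda>'
  proof -
    obtain Ls where Ls: "set Ls \<subseteq> forms n 1" "length Ls = i" "\<Lambda>' = Idl\<^bsub>poly_ring n\<^esub> (set Ls)"
      using \<Lambda>' by (auto simp: U_def linear_subspace_def linear_frames_def ni)
    have "gotz_list n (adjoins n X Ls) (replicate d (r - i))"
      using \<Lambda>' sect(1)[OF Ls(1)] sum[OF Ls(1)] Ls \<open>i < r\<close> by (simp add: U_def)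
    note J = hideal_adjoins[OF X Ls(1)]
    show ?thesis
      unfolding Ls(3) scheme_inter_eq[OF Ls(1)]
      by (rule arithmetic_genus_hypersurface[OF hideal_saturation[OF J] gotz_list_saturation[OF J] \<open>d > 0\<close>]) fact
  qed
  ultimately show ?thesis unfolding for_general_linear_subspace_def by blast
qed

theorem gotz_list_if_general_section_genus:
  fixes X :: "(nat, 'k::field) mpoly set"
  assumes inf: "infinite (UNIV :: 'k set)" and X: "hideal n X" and as: "gotz_list n X as" "as \<noteq> []"
    and d: "d = count_list as (hd as)" and rn: "hd as < n"
    and genus: "\<And>i. i < hd as \<Longrightarrow> for_general_linear_subspace n (n - i)
      (\<lambda>\<Lambda>. arithmetic_genus n (scheme_inter n X \<Lambda>) = of_nat ((d - 1) choose (hd as - i + 1)))"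
  shows "as = replicate d (hd as)"
proof (rule gotz_list_eq_replicate_if_genus[OF gotz_list_sorted[OF as(1)] as(2) d])
  fix i assume i: "i < hd as"
  have ni: "n - (n - i) = i" using i rn by simp
  obtain U S where U: "U \<noteq> {}" "U \<subseteq> Collect (linear_subspace n (n - i))"
      "\<And>\<Lambda>. \<Lambda> \<in> U \<Longrightarrow> arithmetic_genus n (scheme_inter n X \<Lambda>) = of_nat ((d - 1) choose (hd as - i + 1))"
    and S: "\<And>Ls. set Ls \<subseteq> forms n 1 \<Longrightarrow> length Ls = i \<Longrightarrow>
      Ls \<in> linear_frames n (n - i) \<and> Idl\<^bsub>poly_ring n\<^esub> (set Ls) \<in> U \<longleftrightarrow> (\<exists>f\<in>S. eval_mpoly (frame_coeff Ls) f \<noteq> 0)"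
    using genus[OF i] unfolding for_general_linear_subspace_def grassmannian_open_def ni by blast
  obtain Ls where Ls: "Ls \<in> linear_frames n (n - i)" "Idl\<^bsub>poly_ring n\<^esub> (set Ls) \<in> U"
    using U(1,2) unfolding linear_subspace_def by blast
  have Ls': "set Ls \<subseteq> forms n 1" "length Ls = i" using Ls(1) by (simp_all add: linear_frames_def ni)
  \<comment> \<open>Some defining polynomial of the open set is non-zero at the frame of a member;
    keeping it non-zero lets the frame become filter-regular while the subspace stays in
    \<open>U\<close>.\<close>
  obtain f where f: "f \<in> S" "eval_mpoly (frame_coeff Ls) f \<noteq> 0" using S[OF Ls'] Ls by blast
  obtain Ms where Ms: "length Ms = i" "set Ms \<subseteq> forms n 1" "eval_mpoly (frame_coeff Ms) f \<noteq> 0" "regular_sequence n X Ms"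
    using regular_sequence_exists[OF inf X Ls'(1) f(2)] Ls'(2) by blast
  have mem: "Idl\<^bsub>poly_ring n\<^esub> (set Ms) \<in> U" using S[OF Ms(2,1)] f(1) Ms(3) by blast
  note J = hideal_adjoins[OF X Ms(2)]
  define bs where "bs = (cut_dims ^^ i) as"
  have bs: "gotz_list n (saturation n (adjoins n X Ms)) bs"
    using gotz_list_saturation[OF J regular_sequence_gotz_list[OF X as(1) Ms(2,4)]] Ms(1) by (simp add: bs_def)
  have hd_cut: "as' \<noteq> [] \<Longrightarrow> j \<le> hd as' \<Longrightarrow> (cut_dims ^^ j) as' \<noteq> [] \<and> hd ((cut_dims ^^ j) as') = hd as' - j" for j as'
  proof (induction j)
    case (Suc j)
    then obtain a cs where acs: "(cut_dims ^^ j) as' = a # cs" and a: "a = hd as' - j"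
      by (cases "(cut_dims ^^ j) as'") auto
    have "a \<noteq> 0" using Suc.prems a by simp
    then obtain b where b: "a = Suc b" using not0_implies_Suc by blast
    have "(cut_dims ^^ Suc j) as' = b # cut_dims cs" using acs b by simp
    moreover have "b = hd as' - Suc j" using a b by simp
    ultimately show ?case by simp
  qed simp
  have bs_hd: "bs \<noteq> []" "hd bs = hd as - i" using hd_cut[OF as(2), of i] i by (auto simp: bs_def)
  have "arithmetic_genus n (saturation n (adjoins n X Ms)) = (-1) ^ hd bs * (poly (gotz_poly 0 bs) 0 - 1)"
    by (rule arithmetic_genus_gotz[OF hideal_saturation[OF J] bs bs_hd(1)])
  then show "(-1) ^ (hd as - i) * (poly (gotz_poly 0 ((cut_dims ^^ i) as)) 0 - 1) = of_nat ((d - 1) choose (hd as - i + 1))"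
    using U(3)[OF mem] scheme_inter_eq[OF Ms(2)] bs_hd(2) by (simp add: bs_def)
qed

text \<open>The bounds on \<open>r\<close>: for \<open>r = 0\<close> condition (c) is empty and (a)
  always holds, although the scheme need not lie on a line; for \<open>r = n\<close> there is no
  linear subspace of dimension \<open>r + 1\<close>.\<close>

theorem theorem3p11:
  fixes X :: "(nat, 'k::{alg_closed_field, field_char_0}) mpoly set"
    and n r d :: nat
  assumes "closed_subscheme n X"
    and "scheme_dim n X = int r"
    and "scheme_degree n X = of_nat d"
    and "1 \<le> r" and "r < n"
  shows
    "(of_nat (gotzmann_number n X) = scheme_degree n X \<and> scheme_degree n X = of_nat d
        \<longleftrightarrow> (\<exists>\<Lambda>. linear_subspace n (r + 1) \<Lambda> \<and> is_hypersurface_in n d \<Lambda> X))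
     \<and>
     ((\<exists>\<Lambda>. linear_subspace n (r + 1) \<Lambda> \<and> is_hypersurface_in n d \<Lambda> X)
        \<longleftrightarrow> (\<forall>i < r. for_general_linear_subspace n (n - i)
               (\<lambda>\<Lambda>. arithmetic_genus n (scheme_inter n X \<Lambda>)
                      = of_nat ((d - 1) choose (r - i + 1)))))"
proof -
  have inf: "infinite (UNIV :: 'k set)" by (rule infinite_UNIV_char_0)
  have X: "hideal n X" "saturation n X = X"
    using assms(1) by (simp_all add: closed_subscheme_def homogeneous_ideal_iff)
  define as where "as = hlist n X"
  have as: "gotz_list n X as" unfolding as_def by (rule gotz_list_hlist[OF X(1)])
  have "hdim n X = Suc r" using scheme_dim_eq[OF X(1)] assms(2) by simp
  then have nonempty: "as \<noteq> []" and hd: "hd as = r" by (auto simp: hdim_def gotz_dim_def as_def split: if_splits)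
  note inv = X(1) as nonempty
  have d: "d = count_list as (hd as)" using scheme_degree_gotz[OF inv] assms(3) by simp
  \<comment> \<open>The degree is positive, so \<open>d - 1\<close> in (c) is not truncated.\<close>
  have d0: "d > 0" using nonempty by (cases as) (auto simp: d)
  \<comment> \<open>All three conditions are compared with \<open>as = replicate d r\<close>. For
    (a), the degree counts the entries equal to \<open>r\<close> and the Gotzmann number counts all
    entries.\<close>
  have a_iff: "of_nat (gotzmann_number n X) = scheme_degree n X \<and> scheme_degree n X = of_nat d \<longleftrightarrow> as = replicate d r"
  proof -
    have "length as = d \<longleftrightarrow> as = replicate d r"
    proof
      assume len: "length as = d"
      obtain bs where "as = replicate d r @ bs"
        using sorted_split_top[OF gotz_list_sorted[OF as] nonempty] hd unfolding d by metis
      then show "as = replicate d r" using len by simp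
    qed simp
    then show ?thesis using assms(3) gotzmann_number_gotz[OF inv] by simp
  qed
  have b_iff: "(\<exists>\<Lambda>. linear_subspace n (r + 1) \<Lambda> \<and> is_hypersurface_in n d \<Lambda> X) \<longleftrightarrow> as = replicate d r"
  proof
    assume "\<exists>\<Lambda>. linear_subspace n (r + 1) \<Lambda> \<and> is_hypersurface_in n d \<Lambda> X"
    then show "as = replicate d r"
      using gotz_list_if_hypersurface[OF _ _ assms(5)] gotz_list_unique[OF as] by blast
  next
    assume "as = replicate d r"
    then show "\<exists>\<Lambda>. linear_subspace n (r + 1) \<Lambda> \<and> is_hypersurface_in n d \<Lambda> X"
      using hypersurface_if_gotz_list[OF inf X] as assms(4,5) d0 by simp
  qed
  have "(\<forall>i < r. for_general_linear_subspace n (n - i)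
      (\<lambda>\<Lambda>. arithmetic_genus n (scheme_inter n X \<Lambda>) = of_nat ((d - 1) choose (r - i + 1)))) \<longleftrightarrow> as = replicate d r"
  proof
    assume "\<forall>i < r. for_general_linear_subspace n (n - i)
      (\<lambda>\<Lambda>. arithmetic_genus n (scheme_inter n X \<Lambda>) = of_nat ((d - 1) choose (r - i + 1)))"
    then show "as = replicate d r"
      using gotz_list_if_general_section_genus[OF inf inv d] assms(5) unfolding hd by blast
  next
    assume "as = replicate d r"
    then show "\<forall>i < r. for_general_linear_subspace n (n - i)
      (\<lambda>\<Lambda>. arithmetic_genus n (scheme_inter n X \<Lambda>) = of_nat ((d - 1) choose (r - i + 1)))"
      using b_iff general_section_genus[OF inf _ _ _ assms(5) d0] by blast
  qed
  then show ?thesis using a_iff b_iff by blast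
qed

end
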